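(* Let $R$ be a commutative noetherian ring and $\mathfrak a$ an ideal of $R$. The subcategory of $\mathfrak a$-cofinite $R$-modules in $\mathcal D_{\leq 1}$ is Serre.
   Context: An $R$-module $M$ is $\mathfrak a$-cofinite if $\operatorname{Supp}_RM\subseteq V(\mathfrak a)$ and $\operatorname{Ext}_R^i(R/\mathfrak a,M)$ is finitely generated for all $i\geq 0$. For an $R$-module $M$, $\overline{\dim}\,M=\dim R/\operatorname{Ann}_RM$, and $\mathcal D_{\leq n}$ is the full subcategory of all $R$-modules $M$ with $\overline{\dim}\,M\leq n$. A full subcategory of the category of $R$-modules is Serre if it is closed under taking submodules, quotients and extensions. *)

theory Defs
  imports "HOL-Algebra.Module" "HOL-Algebra.Ring_Divisibility" "HOL-Library.Extended_Real"
begin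

text \<open>Modules are those of \<^locale>\<open>module\<close>. Its records also carry ring fields \<^const>\<open>mult\<close> and
  \<^const>\<open>one\<close>, which are meaningless for a module and left \<^term>\<open>undefined\<close> below.\<close>

section \<open>Basic constructions on modules\<close>

definition mod_hom ::
  "('a, 'x) ring_scheme \<Rightarrow> ('a, 'm, 'y) module_scheme \<Rightarrow> ('a, 'n, 'z) module_scheme \<Rightarrow> ('m \<Rightarrow> 'n) set" where
  "mod_hom R M N =
    {f \<in> carrier M \<rightarrow> carrier N.
       (\<forall>x \<in> carrier M. \<forall>y \<in> carrier M. f (x \<oplus>\<^bsub>M\<^esub> y) = f x \<oplus>\<^bsub>N\<^esub> f y) \<and>
       (\<forall>r \<in> carrier R. \<forall>x \<in> carrier M. f (r \<odot>\<^bsub>M\<^esub> x) = r \<odot>\<^bsub>N\<^esub> f x)}"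

definition module_ker ::
  "('a, 'm, 'y) module_scheme \<Rightarrow> ('a, 'n, 'z) module_scheme \<Rightarrow> ('m \<Rightarrow> 'n) \<Rightarrow> 'm set" where
  "module_ker M N f = {x \<in> carrier M. f x = \<zero>\<^bsub>N\<^esub>}"

definition regular_module :: "('a, 'x) ring_scheme \<Rightarrow> ('a, 'a) module" where
  "regular_module R =
    \<lparr>carrier = carrier R, mult = undefined, one = undefined,
     zero = \<zero>\<^bsub>R\<^esub>, add = (\<oplus>\<^bsub>R\<^esub>), smult = (\<otimes>\<^bsub>R\<^esub>)\<rparr>"

text \<open>As in \<^const>\<open>FactRing\<close>, the elements of \<open>M / H\<close> are the cosets of \<open>H\<close>.\<close>

definition quotient_module :: "('a, 'm, 'y) module_scheme \<Rightarrow> 'm set \<Rightarrow> ('a, 'm set) module" where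
  "quotient_module M H =
    \<lparr>carrier = a_rcosets\<^bsub>M\<^esub> H, mult = undefined, one = undefined,
     zero = H, add = set_add M, smult = (\<lambda>r X. \<Union>x\<in>X. H +>\<^bsub>M\<^esub> (r \<odot>\<^bsub>M\<^esub> x))\<rparr>"

definition free_module :: "('a, 'x) ring_scheme \<Rightarrow> nat \<Rightarrow> ('a, nat \<Rightarrow> 'a) module" where
  "free_module R n =
    \<lparr>carrier = {..<n} \<rightarrow>\<^sub>E carrier R, mult = undefined, one = undefined,
     zero = (\<lambda>i\<in>{..<n}. \<zero>\<^bsub>R\<^esub>),
     add = (\<lambda>x y. \<lambda>i\<in>{..<n}. x i \<oplus>\<^bsub>R\<^esub> y i),
     smult = (\<lambda>r x. \<lambda>i\<in>{..<n}. r \<otimes>\<^bsub>R\<^esub> x i)\<rparr>"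

text \<open>The elements of \<open>Hom(M, N)\<close> are taken extensional on \<open>M\<close>, so that equality of
  homomorphisms is equality of functions.\<close>

definition hom_module ::
  "('a, 'x) ring_scheme \<Rightarrow> ('a, 'm, 'y) module_scheme \<Rightarrow> ('a, 'n, 'z) module_scheme \<Rightarrow>
    ('a, 'm \<Rightarrow> 'n) module" where
  "hom_module R M N =
    \<lparr>carrier = mod_hom R M N \<inter> extensional (carrier M), mult = undefined, one = undefined,
     zero = (\<lambda>x\<in>carrier M. \<zero>\<^bsub>N\<^esub>),
     add = (\<lambda>f g. \<lambda>x\<in>carrier M. f x \<oplus>\<^bsub>N\<^esub> g x),
     smult = (\<lambda>r f. \<lambda>x\<in>carrier M. r \<odot>\<^bsub>N\<^esub> f x)\<rparr>"

definition finitely_generated_module ::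
  "('a, 'x) ring_scheme \<Rightarrow> ('a, 'm, 'y) module_scheme \<Rightarrow> bool" where
  "finitely_generated_module R M \<longleftrightarrow>
    (\<exists>A. finite A \<and> A \<subseteq> carrier M \<and> carrier M = \<Inter>{H. submodule H R M \<and> A \<subseteq> H})"


section \<open>Ext\<close>

text \<open>\<open>free_resolution R N n d e\<close> says that
  \<open>\<dots> \<rightarrow> R\<^bsup>n 2\<^esup> \<rightarrow> R\<^bsup>n 1\<^esup> \<rightarrow> R\<^bsup>n 0\<^esup> \<rightarrow> N \<rightarrow> 0\<close> is exact, where the maps are \<open>d 1\<close>, \<open>d 0\<close> and
  the augmentation \<open>e\<close>; thus \<open>d i\<close> starts in degree \<open>i + 1\<close>.\<close>

definition free_resolution ::
  "('a, 'x) ring_scheme \<Rightarrow> ('a, 'n, 'z) module_scheme \<Rightarrow>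
    (nat \<Rightarrow> nat) \<Rightarrow> (nat \<Rightarrow> (nat \<Rightarrow> 'a) \<Rightarrow> (nat \<Rightarrow> 'a)) \<Rightarrow> ((nat \<Rightarrow> 'a) \<Rightarrow> 'n) \<Rightarrow> bool" where
  "free_resolution R N n d e \<longleftrightarrow>
    e \<in> mod_hom R (free_module R (n 0)) N \<and>
    e ` carrier (free_module R (n 0)) = carrier N \<and>
    (\<forall>i. d i \<in> mod_hom R (free_module R (n (Suc i))) (free_module R (n i))) \<and>
    d 0 ` carrier (free_module R (n 1)) = module_ker (free_module R (n 0)) N e \<and>
    (\<forall>i. d (Suc i) ` carrier (free_module R (n (Suc (Suc i)))) =
         module_ker (free_module R (n (Suc i))) (free_module R (n i)) (d i))"

definition coboundary_map ::
  "('a, 'x) ring_scheme \<Rightarrow> (nat \<Rightarrow> nat) \<Rightarrow> (nat \<Rightarrow> (nat \<Rightarrow> 'a) \<Rightarrow> (nat \<Rightarrow> 'a)) \<Rightarrow> nat \<Rightarrow>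
    ((nat \<Rightarrow> 'a) \<Rightarrow> 'm) \<Rightarrow> ((nat \<Rightarrow> 'a) \<Rightarrow> 'm)" where
  "coboundary_map R n d i f = (\<lambda>x\<in>carrier (free_module R (n (Suc i))). f (d i x))"

definition ext_cocycles ::
  "('a, 'x) ring_scheme \<Rightarrow> (nat \<Rightarrow> nat) \<Rightarrow> (nat \<Rightarrow> (nat \<Rightarrow> 'a) \<Rightarrow> (nat \<Rightarrow> 'a)) \<Rightarrow> nat \<Rightarrow>
    ('a, 'm, 'y) module_scheme \<Rightarrow> ((nat \<Rightarrow> 'a) \<Rightarrow> 'm) set" where
  "ext_cocycles R n d i M =
    module_ker (hom_module R (free_module R (n i)) M)
      (hom_module R (free_module R (n (Suc i))) M) (coboundary_map R n d i)"

fun ext_coboundaries ::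
  "('a, 'x) ring_scheme \<Rightarrow> (nat \<Rightarrow> nat) \<Rightarrow> (nat \<Rightarrow> (nat \<Rightarrow> 'a) \<Rightarrow> (nat \<Rightarrow> 'a)) \<Rightarrow> nat \<Rightarrow>
    ('a, 'm, 'y) module_scheme \<Rightarrow> ((nat \<Rightarrow> 'a) \<Rightarrow> 'm) set" where
  "ext_coboundaries R n d 0 M = {\<zero>\<^bsub>hom_module R (free_module R (n 0)) M\<^esub>}"
| "ext_coboundaries R n d (Suc i) M =
    coboundary_map R n d i ` carrier (hom_module R (free_module R (n i)) M)"

definition ext_of_resolution ::
  "('a, 'x) ring_scheme \<Rightarrow> (nat \<Rightarrow> nat) \<Rightarrow> (nat \<Rightarrow> (nat \<Rightarrow> 'a) \<Rightarrow> (nat \<Rightarrow> 'a)) \<Rightarrow> nat \<Rightarrow>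
    ('a, 'm, 'y) module_scheme \<Rightarrow> ('a, ((nat \<Rightarrow> 'a) \<Rightarrow> 'm) set) module" where
  "ext_of_resolution R n d i M =
    quotient_module
      ((hom_module R (free_module R (n i)) M)\<lparr>carrier := ext_cocycles R n d i M\<rparr>)
      (ext_coboundaries R n d i M)"

text \<open>\<open>Ext\<^bsup>i\<^esup>(N, M)\<close> for a finitely generated module \<open>N\<close> over a noetherian ring: such an \<open>N\<close> has a
  resolution by free modules of finite rank, and up to isomorphism the result does not depend on
  the one chosen. The choice does not involve \<open>M\<close> or \<open>i\<close>.
  (For other \<open>N\<close> there may be no such resolution, and then the value is meaningless.)\<close>

definition Ext ::
  "('a, 'x) ring_scheme \<Rightarrow> nat \<Rightarrow> ('a, 'n, 'z) module_scheme \<Rightarrow> ('a, 'm, 'y) module_scheme \<Rightarrow>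
    ('a, ((nat \<Rightarrow> 'a) \<Rightarrow> 'm) set) module" where
  "Ext R i N M =
    (let (n, d) = (SOME (n, d). \<exists>e. free_resolution R N n d e) in ext_of_resolution R n d i M)"


section \<open>Support, annihilator and dimension\<close>

text \<open>The underlying set of the localization \<open>S\<^bsup>-1\<^esup>M\<close>: classes of fractions \<open>x/s\<close>, represented by
  pairs \<open>(x, s)\<close>.\<close>

definition fraction_rel ::
  "'a set \<Rightarrow> ('a, 'm, 'y) module_scheme \<Rightarrow> (('m \<times> 'a) \<times> ('m \<times> 'a)) set" where
  "fraction_rel S M =
    {((x, s), (y, t)). x \<in> carrier M \<and> s \<in> S \<and> y \<in> carrier M \<and> t \<in> S \<and>
       (\<exists>u\<in>S. u \<odot>\<^bsub>M\<^esub> (t \<odot>\<^bsub>M\<^esub> x) = u \<odot>\<^bsub>M\<^esub> (s \<odot>\<^bsub>M\<^esub> y))}"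

definition localization :: "'a set \<Rightarrow> ('a, 'm, 'y) module_scheme \<Rightarrow> ('m \<times> 'a) set set" where
  "localization S M = (carrier M \<times> S) // fraction_rel S M"

definition localization_zero ::
  "('a, 'x) ring_scheme \<Rightarrow> 'a set \<Rightarrow> ('a, 'm, 'y) module_scheme \<Rightarrow> ('m \<times> 'a) set" where
  "localization_zero R S M = fraction_rel S M `` {(\<zero>\<^bsub>M\<^esub>, \<one>\<^bsub>R\<^esub>)}"

definition Supp :: "('a, 'x) ring_scheme \<Rightarrow> ('a, 'm, 'y) module_scheme \<Rightarrow> 'a set set" where
  "Supp R M =
    {p. primeideal p R \<and>
        localization (carrier R - p) M \<noteq> {localization_zero R (carrier R - p) M}}"

definition zero_locus :: "('a, 'x) ring_scheme \<Rightarrow> 'a set \<Rightarrow> 'a set set" where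
  "zero_locus R I = {p. primeideal p R \<and> I \<subseteq> p}"

definition Ann :: "('a, 'x) ring_scheme \<Rightarrow> ('a, 'm, 'y) module_scheme \<Rightarrow> 'a set" where
  "Ann R M = {r \<in> carrier R. \<forall>x \<in> carrier M. r \<odot>\<^bsub>M\<^esub> x = \<zero>\<^bsub>M\<^esub>}"

text \<open>The dimension of the zero ring is \<open>Sup {} = -\<infinity>\<close>.\<close>

definition krull_dim :: "('a, 'x) ring_scheme \<Rightarrow> ereal" where
  "krull_dim R =
    Sup {ereal (real n) | n.
      \<exists>p. (\<forall>i\<le>n. primeideal (p i) R) \<and> (\<forall>i<n. p i \<subset> p (Suc i))}"

definition dim_bar :: "('a, 'x) ring_scheme \<Rightarrow> ('a, 'm, 'y) module_scheme \<Rightarrow> ereal" where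
  "dim_bar R M = krull_dim (R Quot Ann R M)"


section \<open>Cofinite modules and Serre subcategories\<close>

definition cofinite_module ::
  "('a, 'x) ring_scheme \<Rightarrow> 'a set \<Rightarrow> ('a, 'm, 'y) module_scheme \<Rightarrow> bool" where
  "cofinite_module R I M \<longleftrightarrow>
    Supp R M \<subseteq> zero_locus R I \<and>
    (\<forall>i. finitely_generated_module R (Ext R i (quotient_module (regular_module R) I) M))"

text \<open>A full subcategory is given by a predicate \<open>S\<close> on modules. The ambient category consists of
  the \<open>R\<close>-modules whose elements lie in an arbitrary type \<open>'m\<close>. Submodules and quotients are taken
  up to isomorphism, as sources of injective and targets of surjective homomorphisms; in
  particular they need not be literal subsets or sets of cosets.\<close>

definition serre_subcategory :: "('a, 'x) ring_scheme \<Rightarrow> (('a, 'm) module \<Rightarrow> bool) \<Rightarrow> bool" where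
  "serre_subcategory R S \<longleftrightarrow>
    (\<forall>L M f. module R L \<and> module R M \<and> f \<in> mod_hom R L M \<and> inj_on f (carrier L) \<and> S M
        \<longrightarrow> S L) \<and>
    (\<forall>M N g. module R M \<and> module R N \<and> g \<in> mod_hom R M N \<and> g ` carrier M = carrier N \<and> S M
        \<longrightarrow> S N) \<and>
    (\<forall>L M N f g. module R L \<and> module R M \<and> module R N \<and>
        f \<in> mod_hom R L M \<and> inj_on f (carrier L) \<and>
        g \<in> mod_hom R M N \<and> g ` carrier M = carrier N \<and>
        f ` carrier L = module_ker M N g \<and> S L \<and> S N
        \<longrightarrow> S M)"

end

theory Submission
  imports Defs
begin

text \<open>Let \<open>M\<close> be an \<open>\<aa>\<close>-torsion module with \<open>dim R / Ann M \<le> 1\<close>. It is \<open>\<aa>\<close>-cofinite as soon as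
  \<open>T\<^sub>1 = (0 : \<aa>)\<close>, which is \<open>Hom(R / \<aa>, M)\<close>, is noetherian. In that case all the
  \<open>T\<^sub>k = (0 : \<aa>\<^sup>k)\<close> are noetherian. The ideals \<open>Ann(M / T\<^sub>k)\<close> increase to some \<open>b = Ann(M / T\<^sub>n)\<close>,
  and by the dimension hypothesis all primes over \<open>\<aa> + b\<close> are maximal. Hence \<open>T\<^sub>n\<^sub>+\<^sub>1 / T\<^sub>n\<close> has
  finite length, and \<open>M / T\<^sub>n\<close> is artinian by Melkersson's criterion. So each \<open>Ext\<^sup>i(R / \<aa>, M)\<close> is an
  extension of an artinian module killed by \<open>\<aa> + b\<close>, which is thus of finite length, by a
  noetherian one.

  The condition on \<open>T\<^sub>1\<close> passes to submodules; quotients and extensions are then handled by the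
  long exact sequence of \<open>Ext\<close>.\<close>

section \<open>Chain conditions on intervals of submodules\<close>

text \<open>Quotients are the obstacle. In Ext^0(M) -> Ext^0(M / K) -> Ext^1(K), with first argument
  R / \<aa> throughout, the middle term depends on Ext^1(K) as well, so finiteness of T_1 alone does
  not pass from M to M / K. This is why the criterion has to produce all Ext^i from T_1: applied to
  the submodule K of M it supplies Ext^1(K), and the higher terms in the same way.

  Finite length is never introduced. A subquotient killed by an ideal over which all primes are
  maximal satisfies one chain condition as soon as it satisfies the other, by noetherian induction
  on that ideal, with vector spaces over R / p at the bottom. This exchange is made twice: from
  ascending to descending for T_(n+1) / T_n, and back for the last piece of Ext. All pieces are
  intervals in M or in one cochain module Hom(F i, M), so no quotient of a quotient arises.

  The dimension bound enters only by forbidding strict chains of three primes over Ann M.\<close>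

text \<open>The flag \<open>asc\<close> selects the ascending (maximal elements) or the descending (minimal elements)
  condition. Stating it for the submodules between \<open>K\<close> and \<open>H\<close> inside a fixed module avoids
  forming the quotient \<open>H / K\<close>.\<close>

definition chain_cond :: "bool \<Rightarrow> 'm set set \<Rightarrow> bool" where
  "chain_cond asc S \<longleftrightarrow>
    (\<forall>P \<subseteq> S. P \<noteq> {} \<longrightarrow> (\<exists>N\<in>P. \<forall>N'\<in>P. (if asc then N \<subseteq> N' else N' \<subseteq> N) \<longrightarrow> N' = N))"

definition interval ::
  "('a, 'x) ring_scheme \<Rightarrow> ('a, 'm, 'y) module_scheme \<Rightarrow> 'm set \<Rightarrow> 'm set \<Rightarrow> 'm set set" where
  "interval R M K H = {N. submodule N R M \<and> K \<subseteq> N \<and> N \<subseteq> H}"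

abbreviation cc ::
  "bool \<Rightarrow> ('a, 'x) ring_scheme \<Rightarrow> ('a, 'm, 'y) module_scheme \<Rightarrow> 'm set \<Rightarrow> 'm set \<Rightarrow> bool" where
  "cc asc R M K H \<equiv> chain_cond asc (interval R M K H)"

text \<open>An extremal image is pulled back: monotonicity carries comparability over to the images,
  and \<open>inj\<close> brings equality of images back. Injectivity is asked of nested pairs, the
  only ones a chain condition compares.\<close>

lemma chain_cond_transfer:
  assumes S: "chain_cond asc S"
    and into: "\<And>N. N \<in> T \<Longrightarrow> \<Phi> N \<in> S"
    and mono: "\<And>N N'. N \<in> T \<Longrightarrow> N' \<in> T \<Longrightarrow> N \<subseteq> N' \<Longrightarrow> \<Phi> N \<subseteq> \<Phi> N'"
    and inj: "\<And>N N'. N \<in> T \<Longrightarrow> N' \<in> T \<Longrightarrow> N \<subseteq> N' \<Longrightarrow> \<Phi> N' \<subseteq> \<Phi> N \<Longrightarrow> N' \<subseteq> N"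
  shows "chain_cond asc T"
  unfolding chain_cond_def
proof (intro allI impI)
  fix P assume P: "P \<subseteq> T" "P \<noteq> {}"
  then have "\<Phi> ` P \<subseteq> S" "\<Phi> ` P \<noteq> {}" using into by auto
  then obtain N where N: "N \<in> P"
    "\<And>N'. N' \<in> P \<Longrightarrow> (if asc then \<Phi> N \<subseteq> \<Phi> N' else \<Phi> N' \<subseteq> \<Phi> N) \<Longrightarrow> \<Phi> N' = \<Phi> N"
    using S[unfolded chain_cond_def, rule_format, of "\<Phi> ` P"] by auto
  have PT: "X \<in> T" if "X \<in> P" for X using P that by auto
  have "N' = N" if N': "N' \<in> P" "if asc then N \<subseteq> N' else N' \<subseteq> N" for N'
  proof (cases asc)
    case True
    then have "\<Phi> N' = \<Phi> N" using N N' mono P by (metis subsetD)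
    then show ?thesis using True N' inj[OF PT[OF N(1)] PT[OF N'(1)]] by auto
  next
    case False
    then have "\<Phi> N' = \<Phi> N" using N N' mono P by (metis subsetD)
    then show ?thesis using False N' inj[OF PT[OF N'(1)] PT[OF N(1)]] by auto
  qed
  then show "\<exists>N\<in>P. \<forall>N'\<in>P. (if asc then N \<subseteq> N' else N' \<subseteq> N) \<longrightarrow> N' = N" using N(1) by blast
qed

lemma chain_cond_maximal:
  assumes "chain_cond True S" "P \<subseteq> S" "P \<noteq> {}"
  obtains N where "N \<in> P" "\<And>N'. N' \<in> P \<Longrightarrow> N \<subseteq> N' \<Longrightarrow> N' = N"
  using assms(1)[unfolded chain_cond_def, rule_format, of P] assms(2,3) by auto

lemma chain_cond_minimal:
  assumes "chain_cond False S" "P \<subseteq> S" "P \<noteq> {}"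
  obtains N where "N \<in> P" "\<And>N'. N' \<in> P \<Longrightarrow> N' \<subseteq> N \<Longrightarrow> N' = N"
  using assms(1)[unfolded chain_cond_def, rule_format, of P] assms(2,3) by auto

context module
begin

text \<open>Negation is multiplication by \<open>\<ominus> \<one>\<close>, so the scalar clause
  yields additive inverses.\<close>

lemma submodule_iff:
  "submodule H R M \<longleftrightarrow> H \<subseteq> carrier M \<and> \<zero>\<^bsub>M\<^esub> \<in> H \<and> (\<forall>x\<in>H. \<forall>y\<in>H. x \<oplus>\<^bsub>M\<^esub> y \<in> H) \<and>
    (\<forall>r\<in>carrier R. \<forall>x\<in>H. r \<odot>\<^bsub>M\<^esub> x \<in> H)"
proof
  assume H: "submodule H R M"
  have "\<zero>\<^bsub>M\<^esub> \<in> H" using subgroup.one_closed[OF submodule.axioms(1)[OF H]] by simp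
  then show "H \<subseteq> carrier M \<and> \<zero>\<^bsub>M\<^esub> \<in> H \<and> (\<forall>x\<in>H. \<forall>y\<in>H. x \<oplus>\<^bsub>M\<^esub> y \<in> H) \<and>
    (\<forall>r\<in>carrier R. \<forall>x\<in>H. r \<odot>\<^bsub>M\<^esub> x \<in> H)"
    using submoduleE[OF H] by blast
next
  assume H: "H \<subseteq> carrier M \<and> \<zero>\<^bsub>M\<^esub> \<in> H \<and> (\<forall>x\<in>H. \<forall>y\<in>H. x \<oplus>\<^bsub>M\<^esub> y \<in> H) \<and>
    (\<forall>r\<in>carrier R. \<forall>x\<in>H. r \<odot>\<^bsub>M\<^esub> x \<in> H)"
  have "\<ominus>\<^bsub>M\<^esub> x = (\<ominus> \<one>) \<odot>\<^bsub>M\<^esub> x" if "x \<in> carrier M" for x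
    using smult_l_minus[OF R.one_closed that] that by simp
  then show "submodule H R M" using H by (intro submoduleI) auto
qed

lemma submodule_minus:
  "submodule H R M \<Longrightarrow> x \<in> H \<Longrightarrow> y \<in> H \<Longrightarrow> x \<ominus>\<^bsub>M\<^esub> y \<in> H"
  using submoduleE[of H] by (auto simp: a_minus_def)

lemma submodule_zero: "submodule {\<zero>\<^bsub>M\<^esub>} R M"
  by (simp add: submodule_iff)

lemma minus_zero: "\<ominus>\<^bsub>M\<^esub> \<zero>\<^bsub>M\<^esub> = \<zero>\<^bsub>M\<^esub>"
  using M.r_neg[of "\<zero>\<^bsub>M\<^esub>"] by simp

lemma minus_add_cancel:
  "x \<in> carrier M \<Longrightarrow> y \<in> carrier M \<Longrightarrow> (x \<ominus>\<^bsub>M\<^esub> y) \<oplus>\<^bsub>M\<^esub> y = x"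
  by (simp add: a_minus_def M.a_assoc M.l_neg)

lemma smult_minus:
  "a \<in> carrier R \<Longrightarrow> x \<in> carrier M \<Longrightarrow> y \<in> carrier M \<Longrightarrow>
    a \<odot>\<^bsub>M\<^esub> (x \<ominus>\<^bsub>M\<^esub> y) = a \<odot>\<^bsub>M\<^esub> x \<ominus>\<^bsub>M\<^esub> a \<odot>\<^bsub>M\<^esub> y"
  by (simp add: a_minus_def smult_r_distr smult_r_minus)

lemma smult_comm:
  "a \<in> carrier R \<Longrightarrow> b \<in> carrier R \<Longrightarrow> x \<in> carrier M \<Longrightarrow>
    a \<odot>\<^bsub>M\<^esub> (b \<odot>\<^bsub>M\<^esub> x) = b \<odot>\<^bsub>M\<^esub> (a \<odot>\<^bsub>M\<^esub> x)"
  by (metis smult_assoc1 R.m_comm)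

text \<open>The set is H \<inter> (N + D). It occurs three times: in the modular law, as the
  submodules \<open>V N k\<close> of Melkersson's criterion, and when Ext is split along the
  torsion.\<close>

lemma sum_submodule:
  assumes H: "submodule H R M" and N: "submodule N R M" and D: "submodule D R M"
  shows "submodule {x \<in> H. \<exists>y\<in>N. x \<ominus>\<^bsub>M\<^esub> y \<in> D} R M" (is "submodule ?s R M")
  unfolding submodule_iff
proof (intro conjI ballI)
  show "?s \<subseteq> carrier M" using H by (auto simp: submodule_iff)
  show "\<zero>\<^bsub>M\<^esub> \<in> ?s"
    using H D N by (auto simp: submodule_iff a_minus_def minus_zero intro!: bexI[of _ "\<zero>\<^bsub>M\<^esub>"])
next
  fix x y assume x: "x \<in> ?s" and y: "y \<in> ?s"
  then obtain x' y' where *: "x \<in> H" "y \<in> H" "x' \<in> N" "y' \<in> N" "x \<ominus>\<^bsub>M\<^esub> x' \<in> D" "y \<ominus>\<^bsub>M\<^esub> y' \<in> D"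
    by auto
  have c: "x \<in> carrier M" "y \<in> carrier M" "x' \<in> carrier M" "y' \<in> carrier M"
    using * H N unfolding submodule_iff by blast+
  have "(x \<oplus>\<^bsub>M\<^esub> y) \<ominus>\<^bsub>M\<^esub> (x' \<oplus>\<^bsub>M\<^esub> y') = (x \<ominus>\<^bsub>M\<^esub> x') \<oplus>\<^bsub>M\<^esub> (y \<ominus>\<^bsub>M\<^esub> y')"
    using c by (simp add: a_minus_def M.minus_add M.a_ac)
  then have "(x \<oplus>\<^bsub>M\<^esub> y) \<ominus>\<^bsub>M\<^esub> (x' \<oplus>\<^bsub>M\<^esub> y') \<in> D" using * D by (simp add: submodule_iff)
  then show "x \<oplus>\<^bsub>M\<^esub> y \<in> ?s"
    using * H N by (auto simp: submodule_iff)
next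
  fix r x assume r: "r \<in> carrier R" and x: "x \<in> ?s"
  then obtain x' where *: "x \<in> H" "x' \<in> N" "x \<ominus>\<^bsub>M\<^esub> x' \<in> D"
    by auto
  have "x \<in> carrier M" "x' \<in> carrier M" using * H N unfolding submodule_iff by blast+
  then have "r \<odot>\<^bsub>M\<^esub> x \<ominus>\<^bsub>M\<^esub> r \<odot>\<^bsub>M\<^esub> x' \<in> D" using smult_minus[OF r] * r D by (metis submodule_iff)
  then show "r \<odot>\<^bsub>M\<^esub> x \<in> ?s" using * r H N by (auto simp: submodule_iff)
qed

text \<open>By the modular law, nested submodules with the same sum with \<open>D\<close> and the
  same intersection with \<open>D\<close> coincide. An extremal member is therefore found in two
  rounds: extremal N + D, then extremal N \<inter> D among the members attaining it.\<close>

lemma cc_extension: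
  assumes D: "submodule D R M" "K \<subseteq> D" "D \<subseteq> H"
    and H: "submodule H R M"
    and KD: "cc asc R M K D" and DH: "cc asc R M D H"
  shows "cc asc R M K H"
  unfolding chain_cond_def
proof (intro allI impI)
  fix P assume P: "P \<subseteq> interval R M K H" "P \<noteq> {}"
  \<comment> \<open>This is N + D, because \<open>N\<close> and \<open>D\<close> lie in
    \<open>H\<close>.\<close>
  define s where "s N = {x \<in> H. \<exists>y\<in>N. x \<ominus>\<^bsub>M\<^esub> y \<in> D}" for N
  define le where "le N N' = (if asc then N \<subseteq> N' else N' \<subseteq> N)" for N N' :: "'c set"
  have sub: "submodule N R M" "K \<subseteq> N" "N \<subseteq> H" if "N \<in> P" for N
    using P that by (auto simp: interval_def)
  note [simp] = submodule_iff
  have "s N \<in> interval R M D H" if "N \<in> P" for N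
  proof -
    have "submodule (s N) R M"
      unfolding s_def by (rule sum_submodule[OF H sub(1)[OF that] D(1)])
    moreover have "D \<subseteq> s N"
    proof
      fix x assume "x \<in> D"
      moreover have "x \<in> carrier M" "\<zero>\<^bsub>M\<^esub> \<in> N" using \<open>x \<in> D\<close> D sub[OF that] by auto
      ultimately show "x \<in> s N" using D by (auto simp: s_def a_minus_def minus_zero intro!: bexI[of _ "\<zero>\<^bsub>M\<^esub>"])
    qed
    ultimately show ?thesis by (auto simp: interval_def s_def)
  qed
  then have "s ` P \<subseteq> interval R M D H" by auto
  moreover have "s ` P \<noteq> {}" using P by auto
  ultimately obtain N0 where N0: "N0 \<in> P" "\<And>N'. N' \<in> P \<Longrightarrow> le (s N0) (s N') \<Longrightarrow> s N' = s N0"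
    using DH[unfolded chain_cond_def, rule_format, of "s ` P"] unfolding le_def by auto
  define Q where "Q = {N \<in> P. s N = s N0}"
  have "(\<lambda>N. N \<inter> D) ` Q \<subseteq> interval R M K D"
    using sub D by (fastforce simp: interval_def Q_def)
  moreover have "(\<lambda>N. N \<inter> D) ` Q \<noteq> {}" using N0 by (auto simp: Q_def)
  ultimately obtain N1 where N1: "N1 \<in> Q" "\<And>N'. N' \<in> Q \<Longrightarrow> le (N1 \<inter> D) (N' \<inter> D) \<Longrightarrow> N' \<inter> D = N1 \<inter> D"
    using KD[unfolded chain_cond_def, rule_format, of "(\<lambda>N. N \<inter> D) ` Q"] unfolding le_def by auto
  \<comment> \<open>Modular law: an element \<open>x\<close> of \<open>B\<close> is congruent modulo
    \<open>D\<close> to some \<open>y\<close> of \<open>A\<close>, and x - y lies in B \<inter> D =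
    A \<inter> D.\<close>
  have eq: "A = B" if AB: "A \<in> P" "B \<in> P" "s A = s B" "A \<inter> D = B \<inter> D" "A \<subseteq> B" for A B
  proof -
    have "x \<in> A" if "x \<in> B" for x
    proof -
      have c: "x \<in> carrier M" "x \<in> H" using that sub[OF AB(2)] by auto
      have "x \<in> s B" using that sub[OF AB(2)] c D
        by (auto simp: s_def a_minus_def M.r_neg intro!: bexI[of _ x])
      then have "x \<in> s A" using AB by simp
      then obtain y where y: "y \<in> A" "x \<ominus>\<^bsub>M\<^esub> y \<in> D" by (auto simp: s_def)
      then have "x \<ominus>\<^bsub>M\<^esub> y \<in> B" using submodule_minus[of B x y] sub[OF AB(2)] AB that by auto
      then have "x \<ominus>\<^bsub>M\<^esub> y \<in> A" using y AB by auto
      moreover have "x = (x \<ominus>\<^bsub>M\<^esub> y) \<oplus>\<^bsub>M\<^esub> y"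
        using c y sub[OF AB(1)] by (auto simp: minus_add_cancel)
      ultimately show ?thesis using y sub[OF AB(1)] by (metis submodule_iff)
    qed
    then show ?thesis using AB by auto
  qed
  have smono: "s A \<subseteq> s B" if "A \<subseteq> B" for A B using that by (auto simp: s_def)
  have "N' = N1" if N': "N' \<in> P" "le N1 N'" for N'
  proof -
    have "le (s N1) (s N')" using N' smono by (auto simp: le_def)
    then have "N' \<in> Q" using N0 N1 N' by (auto simp: Q_def)
    moreover have "le (N1 \<inter> D) (N' \<inter> D)" using N' by (auto simp: le_def split: if_splits)
    ultimately have "N' \<inter> D = N1 \<inter> D" "s N' = s N1" using N1 by (auto simp: Q_def)
    moreover have "N1 \<in> P" using N1 by (simp add: Q_def)
    ultimately show ?thesis
      using eq[of N' N1] eq[of N1 N'] N' by (cases asc) (simp_all add: le_def)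
  qed
  then show "\<exists>N\<in>P. \<forall>N'\<in>P. (if asc then N \<subseteq> N' else N' \<subseteq> N) \<longrightarrow> N' = N"
    using N1 unfolding Q_def le_def by blast
qed

end

text \<open>\<open>\<rho>\<close> exhibits \<open>H' / K'\<close> as a subquotient of \<open>H / K\<close>.\<close>

lemma cc_linear:
  assumes "module R M" "module R M'"
    and K: "submodule K R M" and H: "submodule H R M" and KH: "K \<subseteq> H"
    and H': "submodule H' R M'"
    and cc: "cc asc R M K H"
    and add: "\<And>x y x' y'. \<lbrakk>x \<in> H; x' \<in> H; y \<in> H'; y' \<in> H'; \<rho> x y; \<rho> x' y'\<rbrakk>
      \<Longrightarrow> \<rho> (x \<oplus>\<^bsub>M\<^esub> x') (y \<oplus>\<^bsub>M'\<^esub> y')"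
    and smult: "\<And>r x y. \<lbrakk>r \<in> carrier R; x \<in> H; y \<in> H'; \<rho> x y\<rbrakk> \<Longrightarrow> \<rho> (r \<odot>\<^bsub>M\<^esub> x) (r \<odot>\<^bsub>M'\<^esub> y)"
    and total: "\<And>y. y \<in> H' \<Longrightarrow> \<exists>x\<in>H. \<rho> x y"
    and ker: "\<And>x y. \<lbrakk>x \<in> K; y \<in> H'; \<rho> x y\<rbrakk> \<Longrightarrow> y \<in> K'"
  shows "cc asc R M' K' H'"
proof -
  interpret M: module R M by fact
  interpret M': module R M' by fact
  \<comment> \<open>The preimage of \<open>N\<close> under the relation, enlarged by
    \<open>K\<close> to reach the interval. The enlargement loses nothing, because elements of
    \<open>K\<close> are related only to elements of \<open>K'\<close>, which every \<open>N\<close>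
    contains.\<close>
  define \<Phi> where "\<Phi> N = {x \<in> H. \<exists>u\<in>H. \<exists>y\<in>N. \<exists>k\<in>K. \<rho> u y \<and> x = u \<oplus>\<^bsub>M\<^esub> k}" for N
  have Kc: "k \<in> H" "k \<in> carrier M" if "k \<in> K" for k
    using that KH H by (auto simp: M.submodule_iff)
  have Hc: "h \<in> carrier M" if "h \<in> H" for h using that H by (auto simp: M.submodule_iff)
  have H'c: "h \<in> carrier M'" if "h \<in> H'" for h using that H' by (auto simp: M'.submodule_iff)
  have Ha: "x \<oplus>\<^bsub>M\<^esub> y \<in> H" "r \<in> carrier R \<Longrightarrow> r \<odot>\<^bsub>M\<^esub> x \<in> H" if "x \<in> H" "y \<in> H" for x y r
    using that H by (auto simp: M.submodule_iff)
  have Ka: "x \<oplus>\<^bsub>M\<^esub> y \<in> K" "r \<in> carrier R \<Longrightarrow> r \<odot>\<^bsub>M\<^esub> x \<in> K" if "x \<in> K" "y \<in> K" for x y r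
    using that K by (auto simp: M.submodule_iff)
  have K0: "\<zero>\<^bsub>M\<^esub> \<in> K" using K by (auto simp: M.submodule_iff)
  have \<rho>m: "\<rho> (x \<ominus>\<^bsub>M\<^esub> x') (y \<ominus>\<^bsub>M'\<^esub> y')"
    if "x \<in> H" "x' \<in> H" "y \<in> H'" "y' \<in> H'" "\<rho> x y" "\<rho> x' y'" for x x' y y'
  proof -
    have "\<ominus>\<^bsub>M\<^esub> x' = (\<ominus>\<^bsub>R\<^esub> \<one>\<^bsub>R\<^esub>) \<odot>\<^bsub>M\<^esub> x'" "\<ominus>\<^bsub>M'\<^esub> y' = (\<ominus>\<^bsub>R\<^esub> \<one>\<^bsub>R\<^esub>) \<odot>\<^bsub>M'\<^esub> y'"
      using M.smult_l_minus[OF M.R.one_closed Hc[OF that(2)]]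
        M'.smult_l_minus[OF M.R.one_closed H'c[OF that(4)]] that Hc H'c by auto
    moreover have "\<ominus>\<^bsub>R\<^esub> \<one>\<^bsub>R\<^esub> \<in> carrier R" by simp
    moreover have "(\<ominus>\<^bsub>R\<^esub> \<one>\<^bsub>R\<^esub>) \<odot>\<^bsub>M'\<^esub> y' \<in> H'" using that H' by (auto simp: M'.submodule_iff)
    ultimately show ?thesis
      unfolding a_minus_def using add smult that Ha by metis
  qed
  show ?thesis
  proof (rule chain_cond_transfer[OF cc, where \<Phi> = \<Phi>])
    fix N assume "N \<in> interval R M' K' H'"
    then have N: "submodule N R M'" "K' \<subseteq> N" "N \<subseteq> H'" by (auto simp: interval_def)
    have Na: "x \<oplus>\<^bsub>M'\<^esub> y \<in> N" "r \<in> carrier R \<Longrightarrow> r \<odot>\<^bsub>M'\<^esub> x \<in> N" if "x \<in> N" "y \<in> N" for x y r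
      using that N by (auto simp: M'.submodule_iff)
    have \<Phi>I: "u \<oplus>\<^bsub>M\<^esub> k \<in> \<Phi> N" if "u \<in> H" "y \<in> N" "k \<in> K" "\<rho> u y" for u y k
      using that Kc Ha unfolding \<Phi>_def by blast
    have K\<Phi>: "K \<subseteq> \<Phi> N"
    proof
      fix k assume k: "k \<in> K"
      obtain u where u: "u \<in> H" "\<rho> u \<zero>\<^bsub>M'\<^esub>" using total H' by (metis M'.submodule_iff)
      \<comment> \<open>Scaling an arbitrary related pair by zero relates zero to zero, and so puts
        \<open>K\<close> into \<open>\<Phi> N\<close>.\<close>
      have "\<rho> (\<zero>\<^bsub>R\<^esub> \<odot>\<^bsub>M\<^esub> u) (\<zero>\<^bsub>R\<^esub> \<odot>\<^bsub>M'\<^esub> \<zero>\<^bsub>M'\<^esub>)"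
        using smult u H' by (metis M'.submodule_iff M.R.zero_closed)
      then have "\<rho> \<zero>\<^bsub>M\<^esub> \<zero>\<^bsub>M'\<^esub>" using u Hc by auto
      moreover have "\<zero>\<^bsub>M'\<^esub> \<in> N" using N by (auto simp: M'.submodule_iff)
      ultimately show "k \<in> \<Phi> N"
        using k \<Phi>I[OF Kc(1)[OF K0] _ k] Kc by simp
    qed
    have "submodule (\<Phi> N) R M"
      unfolding M.submodule_iff
    proof (intro conjI ballI)
      show "\<Phi> N \<subseteq> carrier M" using Hc by (auto simp: \<Phi>_def)
      show "\<zero>\<^bsub>M\<^esub> \<in> \<Phi> N" using K\<Phi> K0 by auto
    next
      fix x x' assume "x \<in> \<Phi> N" "x' \<in> \<Phi> N"
      then obtain u y k u' y' k' where *: "u \<in> H" "u' \<in> H" "y \<in> N" "y' \<in> N" "k \<in> K" "k' \<in> K"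
        "\<rho> u y" "\<rho> u' y'" "x = u \<oplus>\<^bsub>M\<^esub> k" "x' = u' \<oplus>\<^bsub>M\<^esub> k'" by (auto simp: \<Phi>_def)
      have "\<rho> (u \<oplus>\<^bsub>M\<^esub> u') (y \<oplus>\<^bsub>M'\<^esub> y')" using add[OF *(1,2) _ _ *(7,8)] *(3,4) N(3) by blast
      moreover have "x \<oplus>\<^bsub>M\<^esub> x' = (u \<oplus>\<^bsub>M\<^esub> u') \<oplus>\<^bsub>M\<^esub> (k \<oplus>\<^bsub>M\<^esub> k')"
        using * Hc Kc by (simp add: M.M.a_ac)
      ultimately show "x \<oplus>\<^bsub>M\<^esub> x' \<in> \<Phi> N"
        using \<Phi>I[OF Ha(1)[OF *(1,2)] Na(1)[OF *(3,4)] Ka(1)[OF *(5,6)]] by simp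
    next
      fix r x assume r: "r \<in> carrier R" and "x \<in> \<Phi> N"
      then obtain u y k where *: "u \<in> H" "y \<in> N" "k \<in> K" "\<rho> u y" "x = u \<oplus>\<^bsub>M\<^esub> k" by (auto simp: \<Phi>_def)
      have "\<rho> (r \<odot>\<^bsub>M\<^esub> u) (r \<odot>\<^bsub>M'\<^esub> y)" using smult[OF r *(1) _ *(4)] *(2) N(3) by blast
      moreover have "r \<odot>\<^bsub>M\<^esub> x = (r \<odot>\<^bsub>M\<^esub> u) \<oplus>\<^bsub>M\<^esub> (r \<odot>\<^bsub>M\<^esub> k)"
        using * Hc Kc r by (simp add: M.smult_r_distr)
      ultimately show "r \<odot>\<^bsub>M\<^esub> x \<in> \<Phi> N"
        using \<Phi>I[OF Ha(2)[OF *(1,1) r] Na(2)[OF *(2,2) r] Ka(2)[OF *(3,3) r]] by simp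
    qed
    then show "\<Phi> N \<in> interval R M K H" using K\<Phi> by (auto simp: interval_def \<Phi>_def)
  next
    fix N N' assume "N \<in> interval R M' K' H'" "N \<subseteq> N'"
    then show "\<Phi> N \<subseteq> \<Phi> N'" by (auto simp: \<Phi>_def)
  next
    fix N N' assume *: "N \<in> interval R M' K' H'" "N' \<in> interval R M' K' H'" "\<Phi> N' \<subseteq> \<Phi> N"
    then have N: "submodule N R M'" "K' \<subseteq> N" "N \<subseteq> H'" "N' \<subseteq> H'" by (auto simp: interval_def)
    show "N' \<subseteq> N"
    proof
      fix y assume y: "y \<in> N'"
      then obtain x where x: "x \<in> H" "\<rho> x y" using total N(4) by blast
      have "x = x \<oplus>\<^bsub>M\<^esub> \<zero>\<^bsub>M\<^esub>" using x Hc by simp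
      then have "x \<in> \<Phi> N'" using x y K0 unfolding \<Phi>_def by blast
      then obtain u y' k where u: "u \<in> H" "y' \<in> N" "k \<in> K" "\<rho> u y'" "x = u \<oplus>\<^bsub>M\<^esub> k"
        using * unfolding \<Phi>_def by blast
      have yH: "y \<in> H'" "y' \<in> H'" using y u N by blast+
      \<comment> \<open>The difference relates an element \<open>k\<close> of \<open>K\<close> to y
        - y', which therefore lies in \<open>K'\<close> and so in \<open>N\<close>.\<close>
      have "\<rho> (x \<ominus>\<^bsub>M\<^esub> u) (y \<ominus>\<^bsub>M'\<^esub> y')"
        using \<rho>m[OF x(1) u(1) yH x(2) u(4)] .
      moreover have "x \<ominus>\<^bsub>M\<^esub> u = k"
        using u Hc Kc by (simp add: a_minus_def M.M.a_ac M.M.r_neg M.M.r_neg2)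
      moreover have "y \<ominus>\<^bsub>M'\<^esub> y' \<in> H'" using M'.submodule_minus[OF H' yH] .
      ultimately have "y \<ominus>\<^bsub>M'\<^esub> y' \<in> N" using ker[of k "y \<ominus>\<^bsub>M'\<^esub> y'"] u(3) N(2) by auto
      then have "(y \<ominus>\<^bsub>M'\<^esub> y') \<oplus>\<^bsub>M'\<^esub> y' \<in> N" using u N by (auto simp: M'.submodule_iff)
      moreover have "(y \<ominus>\<^bsub>M'\<^esub> y') \<oplus>\<^bsub>M'\<^esub> y' = y"
        using M'.minus_add_cancel H'c yH by blast
      ultimately show "y \<in> N" by simp
    qed
  qed
qed

lemma chain_cond_subset: "chain_cond asc S \<Longrightarrow> T \<subseteq> S \<Longrightarrow> chain_cond asc T"
  unfolding chain_cond_def using subset_trans[of _ T S] by presburger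

lemma chain_cond_finite:
  assumes "finite S"
  shows "chain_cond asc S"
  unfolding chain_cond_def
proof (intro allI impI)
  fix P assume "P \<subseteq> S" "P \<noteq> {}"
  then have "finite P" "P \<noteq> {}" using assms finite_subset by auto
  from finite_has_minimal[OF this] finite_has_maximal[OF this]
  show "\<exists>N\<in>P. \<forall>N'\<in>P. (if asc then N \<subseteq> N' else N' \<subseteq> N) \<longrightarrow> N' = N"
    by (cases asc) (simp_all add: eq_commute)
qed

lemma cc_refl: "cc asc R M K K"
proof -
  have "interval R M K K \<subseteq> {K}" by (auto simp: interval_def)
  then show ?thesis by (intro chain_cond_finite) (rule finite_subset, auto)
qed

lemma cc_subinterval:
  "cc asc R M K H \<Longrightarrow> K \<subseteq> K' \<Longrightarrow> H' \<subseteq> H \<Longrightarrow> cc asc R M K' H'"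
  by (rule chain_cond_subset) (auto simp: interval_def)

section \<open>Homomorphisms, and chain conditions carried along them\<close>

lemma mod_homD:
  assumes "f \<in> mod_hom R M N"
  shows "x \<in> carrier M \<Longrightarrow> f x \<in> carrier N"
    and "x \<in> carrier M \<Longrightarrow> y \<in> carrier M \<Longrightarrow> f (x \<oplus>\<^bsub>M\<^esub> y) = f x \<oplus>\<^bsub>N\<^esub> f y"
    and "r \<in> carrier R \<Longrightarrow> x \<in> carrier M \<Longrightarrow> f (r \<odot>\<^bsub>M\<^esub> x) = r \<odot>\<^bsub>N\<^esub> f x"
  using assms unfolding mod_hom_def by auto

lemma mod_homI:
  assumes "\<And>x. x \<in> carrier M \<Longrightarrow> f x \<in> carrier N"
    and "\<And>x y. x \<in> carrier M \<Longrightarrow> y \<in> carrier M \<Longrightarrow> f (x \<oplus>\<^bsub>M\<^esub> y) = f x \<oplus>\<^bsub>N\<^esub> f y"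
    and "\<And>r x. r \<in> carrier R \<Longrightarrow> x \<in> carrier M \<Longrightarrow> f (r \<odot>\<^bsub>M\<^esub> x) = r \<odot>\<^bsub>N\<^esub> f x"
  shows "f \<in> mod_hom R M N"
  using assms unfolding mod_hom_def by auto

lemma mod_hom_zero:
  assumes "module R M" "module R N" "f \<in> mod_hom R M N"
  shows "f \<zero>\<^bsub>M\<^esub> = \<zero>\<^bsub>N\<^esub>"
proof -
  interpret M: module R M by fact
  interpret N: module R N by fact
  have "f (\<zero>\<^bsub>R\<^esub> \<odot>\<^bsub>M\<^esub> \<zero>\<^bsub>M\<^esub>) = \<zero>\<^bsub>R\<^esub> \<odot>\<^bsub>N\<^esub> f \<zero>\<^bsub>M\<^esub>"
    by (rule mod_homD(3)[OF assms(3)]) simp_all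
  then show ?thesis using mod_homD(1)[OF assms(3) M.M.zero_closed] by simp
qed

lemma mod_hom_minus:
  assumes "module R M" "module R N" "f \<in> mod_hom R M N" "x \<in> carrier M" "y \<in> carrier M"
  shows "f (x \<ominus>\<^bsub>M\<^esub> y) = f x \<ominus>\<^bsub>N\<^esub> f y"
proof -
  interpret M: module R M by fact
  interpret N: module R N by fact
  have c: "f x \<in> carrier N" "f y \<in> carrier N" using assms mod_homD by metis+
  have "f (x \<ominus>\<^bsub>M\<^esub> y) \<oplus>\<^bsub>N\<^esub> f y = f x"
    using assms mod_homD(2)[OF assms(3), of "x \<ominus>\<^bsub>M\<^esub> y" y] M.minus_add_cancel by simp
  moreover have "f (x \<ominus>\<^bsub>M\<^esub> y) \<in> carrier N" using assms mod_homD by (metis M.minus_closed)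
  ultimately show ?thesis using c
    by (metis N.minus_add_cancel N.M.add.right_cancel N.minus_closed)
qed

lemma (in module) smult_mod_hom: "r \<in> carrier R \<Longrightarrow> (\<lambda>x. r \<odot>\<^bsub>M\<^esub> x) \<in> mod_hom R M M"
  by (rule mod_homI) (simp_all add: smult_r_distr smult_comm)

lemma submodule_vimage:
  assumes "module R M" "module R N" "f \<in> mod_hom R M N" "submodule H R M" "submodule L R N"
  shows "submodule {h \<in> H. f h \<in> L} R M"
proof -
  interpret M: module R M by fact
  interpret N: module R N by fact
  have "h \<in> carrier M" if "h \<in> H" for h using assms(4) that by (auto simp: M.submodule_iff)
  then show ?thesis
    using assms(4,5) mod_homD[OF assms(3)] mod_hom_zero[OF assms(1-3)]
    by (auto simp: M.submodule_iff N.submodule_iff)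
qed

lemma mod_hom_image_submodule:
  assumes "module R M" "module R N" "f \<in> mod_hom R M N" "submodule H R M"
  shows "submodule (f ` H) R N"
proof -
  interpret M: module R M by fact
  interpret N: module R N by fact
  have H: "H \<subseteq> carrier M" "\<zero>\<^bsub>M\<^esub> \<in> H" "\<And>x y. x \<in> H \<Longrightarrow> y \<in> H \<Longrightarrow> x \<oplus>\<^bsub>M\<^esub> y \<in> H"
    "\<And>r x. r \<in> carrier R \<Longrightarrow> x \<in> H \<Longrightarrow> r \<odot>\<^bsub>M\<^esub> x \<in> H"
    using assms(4) by (auto simp: M.submodule_iff)
  show ?thesis
    unfolding N.submodule_iff
  proof (intro conjI ballI)
    show "f ` H \<subseteq> carrier N" using H mod_homD(1)[OF assms(3)] by auto
    show "\<zero>\<^bsub>N\<^esub> \<in> f ` H" using H(2) mod_hom_zero[OF assms(1-3)] by (metis imageI)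
  next
    fix y y' assume "y \<in> f ` H" "y' \<in> f ` H"
    then obtain x x' where x: "x \<in> H" "x' \<in> H" "y = f x" "y' = f x'" by auto
    then have "y \<oplus>\<^bsub>N\<^esub> y' = f (x \<oplus>\<^bsub>M\<^esub> x')" using mod_homD(2)[OF assms(3)] H(1) by (auto simp: subset_iff)
    then show "y \<oplus>\<^bsub>N\<^esub> y' \<in> f ` H" using H(3) x by blast
  next
    fix r y assume r: "r \<in> carrier R" and "y \<in> f ` H"
    then obtain x where x: "x \<in> H" "y = f x" by auto
    then have "r \<odot>\<^bsub>N\<^esub> y = f (r \<odot>\<^bsub>M\<^esub> x)" using mod_homD(3)[OF assms(3)] H(1) r by (auto simp: subset_iff)
    then show "r \<odot>\<^bsub>N\<^esub> y \<in> f ` H" using H(4) x r by blast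
  qed
qed

text \<open>Congruence of \<open>z\<close> and \<open>f c\<close> modulo \<open>B\<close> is the
  relation fed to \<open>cc_linear\<close>: D / B is the image of a submodule of H / K under the map
  induced by \<open>f\<close>.\<close>

lemma cc_congruent:
  assumes "module R M" "module R M'" "f \<in> mod_hom R M M'"
    and K: "submodule K R M" and H: "submodule H R M" and KH: "K \<subseteq> H"
    and B: "submodule B R M'" and D: "submodule D R M'"
    and cc: "cc asc R M K H"
    and total: "\<And>z. z \<in> D \<Longrightarrow> \<exists>c\<in>H. z \<ominus>\<^bsub>M'\<^esub> f c \<in> B"
    and ker: "\<And>c. c \<in> K \<Longrightarrow> f c \<in> B"
  shows "cc asc R M' B D"
proof -
  interpret M: module R M by fact
  interpret M': module R M' by fact
  note f = mod_homD[OF assms(3)]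
  have Hc: "c \<in> carrier M" if "c \<in> H" for c using that H by (auto simp: M.submodule_iff)
  have Dc: "z \<in> carrier M'" if "z \<in> D" for z using that D by (auto simp: M'.submodule_iff)
  show ?thesis
  proof (rule cc_linear[OF assms(1,2) K H KH D cc, where \<rho> = "\<lambda>c z. z \<ominus>\<^bsub>M'\<^esub> f c \<in> B"])
    fix c z c' z' assume *: "c \<in> H" "c' \<in> H" "z \<in> D" "z' \<in> D"
      "z \<ominus>\<^bsub>M'\<^esub> f c \<in> B" "z' \<ominus>\<^bsub>M'\<^esub> f c' \<in> B"
    have "(z \<oplus>\<^bsub>M'\<^esub> z') \<ominus>\<^bsub>M'\<^esub> f (c \<oplus>\<^bsub>M\<^esub> c') = (z \<ominus>\<^bsub>M'\<^esub> f c) \<oplus>\<^bsub>M'\<^esub> (z' \<ominus>\<^bsub>M'\<^esub> f c')"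
      using *(1-4) Hc Dc f by (simp add: a_minus_def M'.M.minus_add M'.M.a_ac)
    then show "(z \<oplus>\<^bsub>M'\<^esub> z') \<ominus>\<^bsub>M'\<^esub> f (c \<oplus>\<^bsub>M\<^esub> c') \<in> B"
      using *(5,6) B by (simp add: M'.submodule_iff)
  next
    fix r c z assume *: "r \<in> carrier R" "c \<in> H" "z \<in> D" "z \<ominus>\<^bsub>M'\<^esub> f c \<in> B"
    have "r \<odot>\<^bsub>M'\<^esub> z \<ominus>\<^bsub>M'\<^esub> f (r \<odot>\<^bsub>M\<^esub> c) = r \<odot>\<^bsub>M'\<^esub> (z \<ominus>\<^bsub>M'\<^esub> f c)"
      using *(1-3) Hc Dc f by (simp add: M'.smult_minus)
    then show "r \<odot>\<^bsub>M'\<^esub> z \<ominus>\<^bsub>M'\<^esub> f (r \<odot>\<^bsub>M\<^esub> c) \<in> B"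
      using *(1,4) B by (simp add: M'.submodule_iff)
  next
    fix c z assume *: "c \<in> K" "z \<in> D" "z \<ominus>\<^bsub>M'\<^esub> f c \<in> B"
    then have "(z \<ominus>\<^bsub>M'\<^esub> f c) \<oplus>\<^bsub>M'\<^esub> f c \<in> B" using ker B by (simp add: M'.submodule_iff)
    moreover have "c \<in> carrier M" using *(1) KH Hc by blast
    ultimately show "z \<in> B" using M'.minus_add_cancel[OF Dc[OF *(2)] f(1)] by simp
  qed (rule total)
qed

text \<open>\<open>f\<close> embeds the quotient of \<open>H\<close> by the preimage of
  \<open>L\<close> into L' / L.\<close>

lemma cc_vimage:
  assumes "module R M" "module R N" "f \<in> mod_hom R M N" "submodule H R M"
    "submodule L R N" "submodule L' R N" "L \<subseteq> L'" "f ` H \<subseteq> L'" "cc asc R N L L'"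
  shows "cc asc R M {h \<in> H. f h \<in> L} H"
proof -
  interpret M: module R M by fact
  have H: "h \<in> carrier M" if "h \<in> H" for h using assms(4) that by (auto simp: M.submodule_iff)
  show ?thesis
    by (rule cc_linear[OF assms(2,1) assms(5-7) assms(4) assms(9), where \<rho> = "\<lambda>y h. f h = y"])
      (use assms(8) H mod_homD[OF assms(3)] in auto)
qed

text \<open>\<open>H\<close> is cut down by one \<open>f i\<close> at a time, and each layer embeds
  into L' / L. The families that occur are multiplications by generators of an ideal and evaluations
  at basis vectors.\<close>

lemma cc_vimage_family:
  assumes "finite I" "module R M" "module R N" "\<And>i. i \<in> I \<Longrightarrow> f i \<in> mod_hom R M N"
    "submodule H R M" "submodule L R N" "submodule L' R N" "L \<subseteq> L'"
    "\<And>i. i \<in> I \<Longrightarrow> f i ` H \<subseteq> L'" "cc asc R N L L'"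
  shows "submodule {h \<in> H. \<forall>i\<in>I. f i h \<in> L} R M \<and> cc asc R M {h \<in> H. \<forall>i\<in>I. f i h \<in> L} H"
  using assms(1,4,9)
proof (induction I)
  case empty
  then show ?case using assms(5) cc_refl by auto
next
  case (insert j I)
  interpret M: module R M by fact
  let ?D = "{h \<in> H. \<forall>i\<in>I. f i h \<in> L}"
  have D: "submodule ?D R M" "cc asc R M ?D H" using insert by auto
  have eq: "{h \<in> H. \<forall>i\<in>insert j I. f i h \<in> L} = {h \<in> ?D. f j h \<in> L}" by auto
  have fj: "f j \<in> mod_hom R M N" "f j ` ?D \<subseteq> L'" using insert by auto
  have jD: "cc asc R M {h \<in> ?D. f j h \<in> L} ?D"
    using cc_vimage[OF assms(2,3) fj(1) D(1) assms(6-8) fj(2) assms(10)] .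
  have "cc asc R M {h \<in> ?D. f j h \<in> L} H"
    by (rule M.cc_extension[OF D(1) _ _ assms(5) jD D(2)]) auto
  then show ?case
    unfolding eq using submodule_vimage[OF assms(2,3) fj(1) D(1) assms(6)] by blast
qed

section \<open>Ideals as submodules of the regular module\<close>

context cring
begin

lemma regular_module: "module R (regular_module R)"
proof (rule moduleI)
  show "abelian_group (regular_module R)"
  proof (rule abelian_groupI)
    fix x assume "x \<in> carrier (regular_module R)"
    then show "\<exists>y\<in>carrier (regular_module R). y \<oplus>\<^bsub>regular_module R\<^esub> x = \<zero>\<^bsub>regular_module R\<^esub>"
      by (auto simp: regular_module_def intro: bexI[of _ "\<ominus> x"] l_neg)
  qed (auto simp: regular_module_def a_ac)
qed (auto simp: regular_module_def l_distr r_distr m_assoc is_cring)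

lemma submodule_regular: "submodule I R (regular_module R) \<longleftrightarrow> ideal I R"
proof
  interpret M: module R "regular_module R" by (rule regular_module)
  assume "submodule I R (regular_module R)"
  then have I: "I \<subseteq> carrier R" "\<zero> \<in> I" "\<And>x y. x \<in> I \<Longrightarrow> y \<in> I \<Longrightarrow> x \<oplus> y \<in> I"
    "\<And>r x. r \<in> carrier R \<Longrightarrow> x \<in> I \<Longrightarrow> r \<otimes> x \<in> I"
    unfolding M.submodule_iff by (auto simp: regular_module_def)
  have "\<ominus> x \<in> I" if "x \<in> I" for x
    using I(4)[of "\<ominus> \<one>" x] that I(1) by (auto simp: l_minus)
  then have "subgroup I (add_monoid R)"
    using I by (intro add.subgroupI) auto
  moreover have "x \<otimes> r \<in> I" if "r \<in> carrier R" "x \<in> I" for r x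
    using I(4)[OF that] m_comm[of x r] that I(1) by auto
  ultimately show "ideal I R" using I by (intro idealI ring_axioms) auto
next
  interpret M: module R "regular_module R" by (rule regular_module)
  assume "ideal I R"
  then interpret I: ideal I R .
  show "submodule I R (regular_module R)"
    unfolding M.submodule_iff using I.a_subset
    by (auto simp: regular_module_def I.I_l_closed I.I_r_closed)
qed

end

text \<open>A nonempty chain of ideals contains its union, so Zorn's lemma can be applied inside
  \<open>P\<close> itself.\<close>

lemma noetherian_ideals:
  assumes "noetherian_ring R"
  shows "chain_cond True {I. ideal I R}"
proof -
  interpret noetherian_ring R by fact
  have "\<exists>N\<in>P. \<forall>N'\<in>P. N \<subseteq> N' \<longrightarrow> N' = N" if P: "P \<subseteq> {I. ideal I R}" "P \<noteq> {}" for P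
  proof (rule subset_Zorn_nonempty[OF P(2)])
    fix C assume C: "C \<noteq> {}" "subset.chain P C"
    then have "subset.chain {I. ideal I R} C" using P by (auto simp: subset_chain_def)
    then have "\<Union>C \<in> C" using ideal_chain_is_trivial C by blast
    then show "\<Union>C \<in> P" using C by (auto simp: subset_chain_def)
  qed
  then show ?thesis unfolding chain_cond_def by simp
qed

lemma noetherian_cc:
  assumes "cring R" "noetherian_ring R"
  shows "cc True R (regular_module R) {\<zero>\<^bsub>R\<^esub>} (carrier R)"
  by (rule chain_cond_subset[OF noetherian_ideals[OF assms(2)]])
    (auto simp: interval_def cring.submodule_regular[OF assms(1)])

context module
begin

definition adjoin :: "'c set \<Rightarrow> 'c \<Rightarrow> 'c set" where
  "adjoin N x = {y. \<exists>n\<in>N. \<exists>r\<in>carrier R. y = n \<oplus>\<^bsub>M\<^esub> r \<odot>\<^bsub>M\<^esub> x}"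

lemma adjoin_submodule:
  assumes N: "submodule N R M" and x: "x \<in> carrier M"
  shows "submodule (adjoin N x) R M" "N \<subseteq> adjoin N x" "x \<in> adjoin N x"
proof -
  have c: "n \<in> carrier M" if "n \<in> N" for n using N that by (auto simp: submodule_iff)
  have I: "n \<oplus>\<^bsub>M\<^esub> r \<odot>\<^bsub>M\<^esub> x \<in> adjoin N x" if "n \<in> N" "r \<in> carrier R" for n r
    using that by (auto simp: adjoin_def)
  have z: "\<zero>\<^bsub>M\<^esub> \<in> N" using N by (auto simp: submodule_iff)
  show N': "N \<subseteq> adjoin N x"
  proof
    fix n assume "n \<in> N"
    then show "n \<in> adjoin N x" using I[of n \<zero>] c x by simp
  qed
  show "x \<in> adjoin N x" using I[OF z R.one_closed] x by simp
  show "submodule (adjoin N x) R M"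
    unfolding submodule_iff
  proof (intro conjI ballI)
    show "adjoin N x \<subseteq> carrier M" using c x by (auto simp: adjoin_def)
    show "\<zero>\<^bsub>M\<^esub> \<in> adjoin N x" using N' z by blast
  next
    fix y y' assume "y \<in> adjoin N x" "y' \<in> adjoin N x"
    then obtain n r n' r' where *: "n \<in> N" "r \<in> carrier R" "n' \<in> N" "r' \<in> carrier R"
      "y = n \<oplus>\<^bsub>M\<^esub> r \<odot>\<^bsub>M\<^esub> x" "y' = n' \<oplus>\<^bsub>M\<^esub> r' \<odot>\<^bsub>M\<^esub> x" by (auto simp: adjoin_def)
    then have "y \<oplus>\<^bsub>M\<^esub> y' = (n \<oplus>\<^bsub>M\<^esub> n') \<oplus>\<^bsub>M\<^esub> (r \<oplus> r') \<odot>\<^bsub>M\<^esub> x"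
      using c x by (simp add: smult_l_distr M.a_ac)
    then show "y \<oplus>\<^bsub>M\<^esub> y' \<in> adjoin N x" using I[of "n \<oplus>\<^bsub>M\<^esub> n'" "r \<oplus> r'"] * N by (auto simp: submodule_iff)
  next
    fix s y assume s: "s \<in> carrier R" and "y \<in> adjoin N x"
    then obtain n r where *: "n \<in> N" "r \<in> carrier R"
      "y = n \<oplus>\<^bsub>M\<^esub> r \<odot>\<^bsub>M\<^esub> x" by (auto simp: adjoin_def)
    then have "s \<odot>\<^bsub>M\<^esub> y = (s \<odot>\<^bsub>M\<^esub> n) \<oplus>\<^bsub>M\<^esub> (s \<otimes> r) \<odot>\<^bsub>M\<^esub> x"
      using c x s by (simp add: smult_r_distr smult_assoc1)
    then show "s \<odot>\<^bsub>M\<^esub> y \<in> adjoin N x" using I[of "s \<odot>\<^bsub>M\<^esub> n" "s \<otimes> r"] * s N by (auto simp: submodule_iff)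
  qed
qed

lemma adjoin_minimal:
  "submodule L R M \<Longrightarrow> N \<subseteq> L \<Longrightarrow> x \<in> L \<Longrightarrow> adjoin N x \<subseteq> L"
  by (auto simp: adjoin_def submodule_iff)

text \<open>This is the colon ideal (K : H). It serves as annihilator of H / K for submodules, and
  with a singleton \<open>H\<close> as annihilator of one element modulo \<open>K\<close>.\<close>

lemma transporter_ideal:
  assumes K: "submodule K R M" and H: "H \<subseteq> carrier M"
  shows "ideal {r \<in> carrier R. \<forall>x\<in>H. r \<odot>\<^bsub>M\<^esub> x \<in> K} R"
proof -
  interpret RR: module R "regular_module R" by (rule R.regular_module)
  have "submodule {r \<in> carrier R. \<forall>x\<in>H. r \<odot>\<^bsub>M\<^esub> x \<in> K} R (regular_module R)"
    unfolding RR.submodule_iff using K H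
    by (auto simp: regular_module_def submodule_iff smult_l_distr smult_assoc1 subset_iff)
  then show ?thesis by (simp add: R.submodule_regular)
qed

end

text \<open>The ideal p + R r is strictly larger than \<open>p\<close>, hence contains \<one>:
  \<open>s\<close> is an inverse of \<open>r\<close> in the field R / p.\<close>

lemma (in cring) maximalideal_inverse:
  assumes "maximalideal p R" "r \<in> carrier R" "r \<notin> p"
  obtains t s where "t \<in> p" "s \<in> carrier R" "\<one> = t \<oplus> s \<otimes> r"
proof -
  interpret M: module R "regular_module R" by (rule regular_module)
  interpret p: maximalideal p R by fact
  have c: "carrier (regular_module R) = carrier R" by (simp add: regular_module_def)
  have p: "submodule p R (regular_module R)" by (simp add: submodule_regular p.is_ideal)
  have r: "r \<in> carrier (regular_module R)" using assms c by simp
  note a = M.adjoin_submodule[OF p r]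
  have i: "ideal (M.adjoin p r) R" using a(1) by (simp add: submodule_regular)
  have "M.adjoin p r \<noteq> p" "M.adjoin p r \<subseteq> carrier R"
    using a(3) assms(3) ideal.Icarr[OF i] by auto
  then have "M.adjoin p r = carrier R"
    using p.I_maximal[OF i a(2)] by blast
  then have "\<one> \<in> M.adjoin p r" by simp
  then show ?thesis using that unfolding M.adjoin_def by (auto simp: regular_module_def)
qed

section \<open>Length and torsion\<close>

context module
begin

text \<open>Modulo \<open>L\<close> the element \<open>x\<close> is killed by \<open>p\<close>, so
  the field R / p acts on its class, and there \<open>r\<close> is invertible.\<close>

lemma mem_if_multiple_mem:
  assumes p: "maximalideal p R" and L: "submodule L R M" and x: "x \<in> carrier M"
    and kill: "\<And>t. t \<in> p \<Longrightarrow> t \<odot>\<^bsub>M\<^esub> x \<in> L"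
    and r: "r \<in> carrier R" "r \<notin> p" "r \<odot>\<^bsub>M\<^esub> x \<in> L"
  shows "x \<in> L"
proof -
  interpret p: maximalideal p R by fact
  obtain t s where t: "t \<in> p" "s \<in> carrier R" "\<one> = t \<oplus> s \<otimes> r"
    using R.maximalideal_inverse[OF p r(1,2)] by metis
  have "x = t \<odot>\<^bsub>M\<^esub> x \<oplus>\<^bsub>M\<^esub> s \<odot>\<^bsub>M\<^esub> (r \<odot>\<^bsub>M\<^esub> x)"
    using smult_l_distr[of t "s \<otimes> r" x] t(1,2) p.Icarr r x smult_one[of x] unfolding t(3)
    by (simp add: smult_assoc1)
  then show ?thesis using kill[OF t(1)] r(3) t(2) L unfolding submodule_iff by metis
qed

text \<open>(N + R x) / N is a quotient of the field R / p, so there is no submodule strictly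
  between \<open>N\<close> and N + R x.\<close>

lemma cc_simple:
  assumes p: "maximalideal p R" and N: "submodule N R M" and x: "x \<in> carrier M"
    and kill: "\<And>r. r \<in> p \<Longrightarrow> r \<odot>\<^bsub>M\<^esub> x \<in> N"
  shows "cc asc R M N (adjoin N x)"
proof -
  note a = adjoin_submodule[OF N x]
  have "interval R M N (adjoin N x) \<subseteq> {N, adjoin N x}"
  proof
    fix L assume "L \<in> interval R M N (adjoin N x)"
    then have L: "submodule L R M" "N \<subseteq> L" "L \<subseteq> adjoin N x" by (auto simp: interval_def)
    have "x \<in> L" if y: "y \<in> L" "y \<notin> N" for y
    proof -
      from y L obtain n r where n: "n \<in> N" "r \<in> carrier R" "y = n \<oplus>\<^bsub>M\<^esub> r \<odot>\<^bsub>M\<^esub> x"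
        by (auto simp: adjoin_def)
      have nc: "n \<in> carrier M" "n \<in> L" using n N L by (auto simp: submodule_iff)
      have rp: "r \<notin> p"
      proof
        assume "r \<in> p"
        then have "y \<in> N" using n kill N by (simp add: submodule_iff)
        then show False using y by simp
      qed
      have "r \<odot>\<^bsub>M\<^esub> x = y \<ominus>\<^bsub>M\<^esub> n" using n nc x
        by (simp add: a_minus_def M.a_ac M.r_neg2 M.r_neg)
      then have "r \<odot>\<^bsub>M\<^esub> x \<in> L" using submodule_minus[OF L(1) y(1) nc(2)] by simp
      then show "x \<in> L" using mem_if_multiple_mem[OF p L(1) x _ n(2) rp] kill L(2) by blast
    qed
    then show "L \<in> {N, adjoin N x}" using adjoin_minimal[OF L(1,2)] L by blast
  qed
  then show ?thesis by (intro chain_cond_finite) (rule finite_subset, auto)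
qed

text \<open>H / K is a vector space over R / p. Take \<open>N\<close> maximal such that N / K is
  artinian; a vector of \<open>H\<close> outside \<open>N\<close> could be adjoined to it at the
  cost of one simple quotient.\<close>

lemma dcc_of_acc:
  assumes p: "maximalideal p R" and K: "submodule K R M" and H: "submodule H R M" and KH: "K \<subseteq> H"
    and kill: "\<And>r x. r \<in> p \<Longrightarrow> x \<in> H \<Longrightarrow> r \<odot>\<^bsub>M\<^esub> x \<in> K"
    and cc: "cc True R M K H"
  shows "cc False R M K H"
proof -
  define P where "P = {N \<in> interval R M K H. cc False R M K N}"
  have "K \<in> P" using K KH cc_refl by (auto simp: P_def interval_def)
  then obtain N where N: "N \<in> P" and max: "\<And>N'. N' \<in> P \<Longrightarrow> N \<subseteq> N' \<Longrightarrow> N' = N"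
    using chain_cond_maximal[OF cc, of P] by (auto simp: P_def)
  have N': "submodule N R M" "K \<subseteq> N" "N \<subseteq> H" "cc False R M K N"
    using N by (auto simp: P_def interval_def)
  have "H \<subseteq> N"
  proof
    fix x assume x: "x \<in> H"
    then have xc: "x \<in> carrier M" using H by (auto simp: submodule_iff)
    note a = adjoin_submodule[OF N'(1) xc]
    have s: "cc False R M N (adjoin N x)"
      by (rule cc_simple[OF p N'(1) xc]) (use kill x N' in blast)
    have "K \<subseteq> adjoin N x" using N' a by blast
    have "cc False R M K (adjoin N x)"
      by (rule cc_extension[OF N'(1,2) a(2) a(1) N'(4) s])
    moreover have "adjoin N x \<subseteq> H" using adjoin_minimal[OF H N'(3) x] .
    ultimately have "adjoin N x \<in> P"
      using a \<open>K \<subseteq> adjoin N x\<close> by (simp add: P_def interval_def)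
    then show "x \<in> N" using max a by blast
  qed
  then show ?thesis using N' by (simp add: subset_antisym)
qed

text \<open>Dual to the previous argument: take \<open>N\<close> minimal such that H / N is
  noetherian. If \<open>N\<close> were larger than \<open>K\<close>, a hyperplane of N / K would
  give a smaller such submodule.\<close>

lemma acc_of_dcc:
  assumes p: "maximalideal p R" and K: "submodule K R M" and H: "submodule H R M" and KH: "K \<subseteq> H"
    and kill: "\<And>r x. r \<in> p \<Longrightarrow> x \<in> H \<Longrightarrow> r \<odot>\<^bsub>M\<^esub> x \<in> K"
    and cc: "cc False R M K H"
  shows "cc True R M K H"
proof -
  define P where "P = {N \<in> interval R M K H. cc True R M N H}"
  have "H \<in> P" using H KH cc_refl by (auto simp: P_def interval_def)
  then obtain N where N: "N \<in> P" and min: "\<And>N'. N' \<in> P \<Longrightarrow> N' \<subseteq> N \<Longrightarrow> N' = N"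
    using chain_cond_minimal[OF cc, of P] by (auto simp: P_def)
  have N': "submodule N R M" "K \<subseteq> N" "N \<subseteq> H" "cc True R M N H"
    using N by (auto simp: P_def interval_def)
  have "N \<subseteq> K"
  proof
    fix x assume x: "x \<in> N"
    then have xc: "x \<in> carrier M" using N' by (auto simp: submodule_iff)
    show "x \<in> K"
    proof (rule ccontr)
      assume xK: "x \<notin> K"
      \<comment> \<open>In the vector space N / K, a subspace maximal among those missing
        \<open>x\<close> is a complement of the line through \<open>x\<close>.\<close>
      define A where "A = {L. submodule L R M \<and> K \<subseteq> L \<and> L \<subseteq> N \<and> x \<notin> L}"
      have "A \<noteq> {}" using K N' xK by (auto simp: A_def)
      then have "\<exists>L\<in>A. \<forall>X\<in>A. L \<subseteq> X \<longrightarrow> X = L"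
      proof (rule subset_Zorn_nonempty)
        fix C assume C: "C \<noteq> {}" "subset.chain A C"
        then have C': "\<And>L. L \<in> C \<Longrightarrow> submodule L R M \<and> K \<subseteq> L \<and> L \<subseteq> N \<and> x \<notin> L"
          "\<And>L L'. L \<in> C \<Longrightarrow> L' \<in> C \<Longrightarrow> L \<subseteq> L' \<or> L' \<subseteq> L"
          by (auto simp: subset_chain_def A_def)
        have "submodule (\<Union>C) R M"
          unfolding submodule_iff
        proof (intro conjI ballI)
          show "\<Union>C \<subseteq> carrier M" using C'(1) by (meson Sup_least submodule_iff)
          show "\<zero>\<^bsub>M\<^esub> \<in> \<Union>C" using C C' by (auto simp: submodule_iff)
        next
          fix y z assume "y \<in> \<Union>C" "z \<in> \<Union>C"
          then obtain L L' where L: "L \<in> C" "y \<in> L" "L' \<in> C" "z \<in> L'" by auto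
          then consider "y \<in> L'" | "z \<in> L" using C'(2)[OF L(1,3)] by blast
          then show "y \<oplus>\<^bsub>M\<^esub> z \<in> \<Union>C"
            using L C'(1)[OF L(1)] C'(1)[OF L(3)] by cases (meson UnionI submodule_iff)+
        next
          fix r y assume "r \<in> carrier R" "y \<in> \<Union>C"
          then show "r \<odot>\<^bsub>M\<^esub> y \<in> \<Union>C" using C'(1) by (meson UnionE UnionI submodule_iff)
        qed
        then show "\<Union>C \<in> A" using C C' by (fastforce simp: A_def)
      qed
      then obtain L where L: "L \<in> A" "\<And>X. X \<in> A \<Longrightarrow> L \<subseteq> X \<Longrightarrow> X = L" by blast
      have L': "submodule L R M" "K \<subseteq> L" "L \<subseteq> N" "x \<notin> L" using L by (auto simp: A_def)
      have "N \<subseteq> adjoin L x"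
      proof
        fix y assume y: "y \<in> N"
        then have yc: "y \<in> carrier M" using N' by (auto simp: submodule_iff)
        note a = adjoin_submodule[OF L'(1) xc]
        note b = adjoin_submodule[OF L'(1) yc]
        show "y \<in> adjoin L x"
        proof (cases "y \<in> L")
          case True then show ?thesis using a by auto
        next
          case False
          then have "adjoin L y \<notin> A" using L(2)[OF _ b(2)] b by blast
          moreover have "adjoin L y \<subseteq> N" using adjoin_minimal[OF N'(1) L'(3) y] .
          ultimately have "x \<in> adjoin L y" using b L' by (auto simp: A_def)
          \<comment> \<open>Exchange: the coefficient \<open>r\<close> of \<open>y\<close> is
            outside \<open>p\<close>, as otherwise \<open>x\<close> would be in \<open>L\<close>.
            Being invertible modulo \<open>p\<close>, it brings \<open>y\<close> into L + R
            x.\<close>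
          then obtain l r where l: "l \<in> L" "r \<in> carrier R" "x = l \<oplus>\<^bsub>M\<^esub> r \<odot>\<^bsub>M\<^esub> y"
            by (auto simp: adjoin_def)
          have lc: "l \<in> carrier M" using l L' by (auto simp: submodule_iff)
          have rp: "r \<notin> p"
          proof
            assume "r \<in> p"
            then have "r \<odot>\<^bsub>M\<^esub> y \<in> L" using kill y N' L' by blast
            then have "x \<in> L" using l L' by (simp add: submodule_iff)
            then show False using L' by simp
          qed
          have "r \<odot>\<^bsub>M\<^esub> y = x \<ominus>\<^bsub>M\<^esub> l" using l lc yc
            by (simp add: a_minus_def M.a_ac M.r_neg2 M.r_neg)
          moreover have "l \<in> adjoin L x" using l a by auto
          ultimately have "r \<odot>\<^bsub>M\<^esub> y \<in> adjoin L x" using submodule_minus[OF a(1) a(3)] by simp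
          moreover have "t \<odot>\<^bsub>M\<^esub> y \<in> adjoin L x" if "t \<in> p" for t
            using kill[OF that] y N' L' a by blast
          ultimately show ?thesis using mem_if_multiple_mem[OF p a(1) yc _ l(2) rp] by blast
        qed
      qed
      moreover have "cc True R M L (adjoin L x)"
        by (rule cc_simple[OF p L'(1) xc]) (use kill x N' L' in blast)
      ultimately have LN: "cc True R M L N" by (rule cc_subinterval[rotated 2]) auto
      have "cc True R M L H"
        by (rule cc_extension[OF N'(1) L'(3) N'(3) H LN N'(4)])
      then have "L \<in> P" using L' N' by (auto simp: P_def interval_def)
      then show False using min[OF _ L'(3)] L' x by auto
    qed
  qed
  then show ?thesis using N' by (simp add: subset_antisym)
qed

text \<open>Noetherian induction on the ideal that kills the subquotient. A largest ideal
  \<open>J\<close> occurring in a counterexample is either prime, hence maximal, which is the vector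
  space case, or contains a product of two elements outside \<open>J\<close>; then the subquotient
  splits into two pieces killed by strictly larger ideals.\<close>

lemma cc_swap:
  assumes noeth: "noetherian_ring R"
    and I: "ideal I R" "\<And>p. primeideal p R \<Longrightarrow> I \<subseteq> p \<Longrightarrow> maximalideal p R"
    and K: "submodule K R M" and H: "submodule H R M" and KH: "K \<subseteq> H"
    and kill: "\<And>r x. r \<in> I \<Longrightarrow> x \<in> H \<Longrightarrow> r \<odot>\<^bsub>M\<^esub> x \<in> K"
    and cc: "cc asc R M K H"
  shows "cc asc' R M K H"
proof (rule ccontr)
  assume fail: "\<not> cc asc' R M K H"
  define bad where "bad I K H \<longleftrightarrow> submodule K R M \<and> submodule H R M \<and> K \<subseteq> H \<and>
    (\<forall>r\<in>I. \<forall>x\<in>H. r \<odot>\<^bsub>M\<^esub> x \<in> K) \<and> cc asc R M K H \<and> \<not> cc asc' R M K H" for I K H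
  \<comment> \<open>The interval varies together with the ideal, because the pieces obtained below
    are other subquotients than the given one.\<close>
  define P where "P = {J. ideal J R \<and> I \<subseteq> J \<and> (\<exists>K H. bad J K H)}"
  have "bad I K H" unfolding bad_def using K H KH kill cc fail by blast
  then have "I \<in> P" using I by (auto simp: P_def)
  then have P: "P \<subseteq> {I. ideal I R}" "P \<noteq> {}" by (auto simp: P_def)
  obtain J where J: "J \<in> P" "\<And>J'. J' \<in> P \<Longrightarrow> J \<subseteq> J' \<Longrightarrow> J' = J"
    by (rule chain_cond_maximal[OF noetherian_ideals[OF noeth] P]) blast
  then obtain K H where KH: "submodule K R M" "submodule H R M" "K \<subseteq> H"
    "\<And>r x. r \<in> J \<Longrightarrow> x \<in> H \<Longrightarrow> r \<odot>\<^bsub>M\<^esub> x \<in> K" "cc asc R M K H" "\<not> cc asc' R M K H"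
    by (auto simp: P_def bad_def)
  have J': "ideal J R" "I \<subseteq> J" using J by (auto simp: P_def)
  interpret J: ideal J R by fact
  have Hc: "x \<in> carrier M" if "x \<in> H" for x using that KH(2) by (auto simp: submodule_iff)
  have asc: "asc \<noteq> asc'" using KH(5,6) by blast
  show False
  proof (cases "primeideal J R")
    case True
    then have m: "maximalideal J R" using I J' by auto
    have "cc asc' R M K H"
    proof (cases asc)
      case True
      then have "cc False R M K H" using dcc_of_acc[OF m KH(1-4)] KH(5) by simp
      then show ?thesis using True asc by simp
    next
      case False
      then have "cc True R M K H" using acc_of_dcc[OF m KH(1-4)] KH(5) by simp
      then show ?thesis using False asc by simp
    qed
    then show False using KH by simp
  next
    case False
    have "J \<noteq> carrier R"
    proof
      assume "J = carrier R"
      then have "x \<in> K" if "x \<in> H" for x using KH(4)[OF _ that, of \<one>] Hc[OF that] by simp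
      then have "H = K" using KH by auto
      then show False using KH cc_refl by metis
    qed
    then obtain u v where uv: "u \<in> carrier R" "v \<in> carrier R" "u \<otimes> v \<in> J" "u \<notin> J" "v \<notin> J"
      using primeidealI[OF J'(1) R.is_cring] False by metis
    \<comment> \<open>\<open>v\<close> kills D / K by definition, and \<open>u\<close> kills H / D
      because u v lies in \<open>J\<close>. Hence neither annihilator is \<open>J\<close>.\<close>
    define D where "D = {x \<in> H. v \<odot>\<^bsub>M\<^esub> x \<in> K}"
    have D: "submodule D R M"
      unfolding D_def by (rule submodule_vimage[OF _ _ smult_mod_hom]) (use KH uv in \<open>simp_all add: module_axioms\<close>)
    have KD: "K \<subseteq> D" "D \<subseteq> H" using KH uv by (auto simp: D_def submodule_iff)
    define J1 where "J1 = {r \<in> carrier R. \<forall>x\<in>H. r \<odot>\<^bsub>M\<^esub> x \<in> D}"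
    define J2 where "J2 = {r \<in> carrier R. \<forall>x\<in>D. r \<odot>\<^bsub>M\<^esub> x \<in> K}"
    have id: "ideal J1 R" "ideal J2 R" unfolding J1_def J2_def
      using transporter_ideal[OF D] transporter_ideal[OF KH(1)] KD Hc by blast+
    have sub: "J \<subseteq> J1" "J \<subseteq> J2" using KH(4) KD J.Icarr unfolding J1_def J2_def by blast+
    have "v \<in> J2" using uv by (simp add: J2_def D_def)
    have "u \<in> J1"
    proof -
      have "u \<odot>\<^bsub>M\<^esub> x \<in> D" if x: "x \<in> H" for x
      proof -
        have "v \<odot>\<^bsub>M\<^esub> (u \<odot>\<^bsub>M\<^esub> x) = (u \<otimes> v) \<odot>\<^bsub>M\<^esub> x"
          using uv Hc[OF x] by (simp add: smult_assoc1 smult_comm)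
        then show ?thesis using KH(2) KH(4)[OF uv(3) x] x uv by (simp add: D_def submodule_iff)
      qed
      then show ?thesis using uv by (simp add: J1_def)
    qed
    have "J1 \<notin> P" "J2 \<notin> P" using J(2) sub uv \<open>u \<in> J1\<close> \<open>v \<in> J2\<close> by blast+
    then have "\<not> bad J1 D H" "\<not> bad J2 K D" using id sub J' by (auto simp: P_def)
    moreover have "cc asc R M D H" "cc asc R M K D"
      using cc_subinterval[OF KH(5)] KD by auto
    ultimately have "cc asc' R M D H" "cc asc' R M K D"
      using D KD KH by (auto simp: bad_def J1_def J2_def)
    then have "cc asc' R M K H" using cc_extension[OF D KD KH(2)] by blast
    then show False using KH by simp
  qed
qed

end

context module
begin

text \<open>Melkersson's criterion. The submodules \<open>V N k\<close>, which stand for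
  \<open>x\<^sup>k (N \<inter> (K : x\<^sup>k\<^sup>+\<^sup>1)) + K\<close>, lie in the artinian interval and together determine \<open>N\<close>
  among the members of a chain.\<close>

lemma dcc_of_colon:
  assumes x: "x \<in> carrier R" and K: "submodule K R M" and H: "submodule H R M" and KH: "K \<subseteq> H"
    and tors: "\<And>h. h \<in> H \<Longrightarrow> \<exists>k::nat. (x [^] k) \<odot>\<^bsub>M\<^esub> h \<in> K"
    and cc: "cc False R M K {h \<in> H. x \<odot>\<^bsub>M\<^esub> h \<in> K}"
  shows "cc False R M K H"
  unfolding chain_cond_def
proof (intro allI impI)
  fix P assume P: "P \<subseteq> interval R M K H" "P \<noteq> {}"
  define V where "V N k = {v \<in> H. x \<odot>\<^bsub>M\<^esub> v \<in> K \<and>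
    (\<exists>y\<in>N. (x [^] Suc k) \<odot>\<^bsub>M\<^esub> y \<in> K \<and> v \<ominus>\<^bsub>M\<^esub> (x [^] k) \<odot>\<^bsub>M\<^esub> y \<in> K)}" for N and k :: nat
  have Hc: "h \<in> carrier M" if "h \<in> H" for h using that H by (auto simp: submodule_iff)
  have Kc: "h \<in> carrier M" if "h \<in> K" for h using that K by (auto simp: submodule_iff)
  have xk: "x [^] k \<in> carrier R" for k :: nat using x by simp
  have Pn: "submodule N R M" "K \<subseteq> N" "N \<subseteq> H" if "N \<in> P" for N
    using that P by (auto simp: interval_def)
  note colon = submodule_vimage[OF module_axioms module_axioms smult_mod_hom _ K]
  have K0: "\<zero>\<^bsub>M\<^esub> \<in> K" using K by (auto simp: submodule_iff)
  have Ks: "r \<odot>\<^bsub>M\<^esub> a \<in> K" if "a \<in> K" "r \<in> carrier R" for a r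
    using K that by (auto simp: submodule_iff)
  have V: "V N k \<in> interval R M K {h \<in> H. x \<odot>\<^bsub>M\<^esub> h \<in> K}" if N: "N \<in> P" for N k
  proof -
    note N' = Pn[OF N]
    have "V N k = {v \<in> {h \<in> H. x \<odot>\<^bsub>M\<^esub> h \<in> K}.
        \<exists>w\<in>(\<lambda>y. (x [^] k) \<odot>\<^bsub>M\<^esub> y) ` {y \<in> N. (x [^] Suc k) \<odot>\<^bsub>M\<^esub> y \<in> K}. v \<ominus>\<^bsub>M\<^esub> w \<in> K}"
      unfolding V_def by blast
    then have "submodule (V N k) R M"
      using sum_submodule[OF colon[OF x H]
          mod_hom_image_submodule[OF module_axioms module_axioms smult_mod_hom[OF xk] colon[OF xk N'(1)]] K]
      by (simp only:)
    moreover have "K \<subseteq> V N k"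
    proof
      fix v assume v: "v \<in> K"
      have "v \<ominus>\<^bsub>M\<^esub> (x [^] k) \<odot>\<^bsub>M\<^esub> \<zero>\<^bsub>M\<^esub> = v"
        using xk Kc[OF v] by (simp add: a_minus_def minus_zero)
      moreover have "(x [^] Suc k) \<odot>\<^bsub>M\<^esub> \<zero>\<^bsub>M\<^esub> \<in> K" using xk[of "Suc k"] K0 by (simp del: nat_pow_Suc)
      ultimately show "v \<in> V N k" using v Ks[OF v x] KH K0 N'(2) unfolding V_def by auto
    qed
    ultimately show ?thesis by (auto simp: interval_def V_def)
  qed
  have mono: "V N k \<subseteq> V N' k" if "N \<subseteq> N'" for N N' k using that unfolding V_def by blast
  have anti1: "V N (Suc k) \<subseteq> V N k" if N: "N \<in> P" for N k
  proof
    fix v assume "v \<in> V N (Suc k)"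
    \<comment> \<open>If \<open>y\<close> is a witness for index k + 1, then x y is one for index
      \<open>k\<close>.\<close>
    then obtain y where *: "v \<in> H" "x \<odot>\<^bsub>M\<^esub> v \<in> K" "y \<in> N"
      "(x [^] Suc (Suc k)) \<odot>\<^bsub>M\<^esub> y \<in> K" "v \<ominus>\<^bsub>M\<^esub> (x [^] Suc k) \<odot>\<^bsub>M\<^esub> y \<in> K"
      unfolding V_def by blast
    have yc: "y \<in> carrier M" using * Pn[OF N] Hc by auto
    have "x \<odot>\<^bsub>M\<^esub> y \<in> N" using * Pn[OF N] x by (auto simp: submodule_iff)
    moreover have eq: "(x [^] Suc j) \<odot>\<^bsub>M\<^esub> y = (x [^] j) \<odot>\<^bsub>M\<^esub> (x \<odot>\<^bsub>M\<^esub> y)" for j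
      using x yc by (simp add: smult_assoc1)
    ultimately show "v \<in> V N k" using *(1,2,4,5) unfolding V_def eq by blast
  qed
  have anti: "V N k \<subseteq> V N j" if "N \<in> P" "j \<le> k" for N j k
    using lift_Suc_antimono_le[of "V N"] anti1[OF that(1)] that(2) by blast
  \<comment> \<open>One minimal choice over all \<open>N\<close> and all \<open>k\<close> together.
    As \<open>V N k\<close> shrinks when \<open>N\<close> shrinks and when \<open>k\<close> grows,
    the pair \<open>N0\<close>, \<open>k0\<close> fixes its value for all \<open>N\<close> below
    \<open>N0\<close> and all indices from \<open>k0\<close> on.\<close>
  define Q where "Q = {V N k | N k. N \<in> P}"
  have "Q \<subseteq> interval R M K {h \<in> H. x \<odot>\<^bsub>M\<^esub> h \<in> K}" "Q \<noteq> {}" using V P unfolding Q_def by blast+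
  then obtain W where W: "W \<in> Q" "\<And>W'. W' \<in> Q \<Longrightarrow> W' \<subseteq> W \<Longrightarrow> W' = W"
    by (rule chain_cond_minimal[OF cc]) blast
  obtain N0 k0 where N0: "N0 \<in> P" "W = V N0 k0" using W by (auto simp: Q_def)
  have A: "V N k = V N0 k0" if "N \<in> P" "N \<subseteq> N0" "k0 \<le> k" for N k
  proof -
    have "V N k \<subseteq> V N0 k0" using mono[OF that(2)] anti[OF that(1,3)] by blast
    moreover have "V N k \<in> Q" using that by (auto simp: Q_def)
    ultimately show ?thesis using W N0 by simp
  qed
  \<comment> \<open>The finitely many smaller indices are settled one after the other, each time
    passing to a smaller member of \<open>P\<close>.\<close>
  have B: "\<exists>N1\<in>P. N1 \<subseteq> N0 \<and> (\<forall>N\<in>P. N \<subseteq> N1 \<longrightarrow> (\<forall>j<m. V N j = V N1 j))" for m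
  proof (induction m)
    case 0 then show ?case using N0 by auto
  next
    case (Suc m)
    obtain N1 where "N1 \<in> P"
      and n1: "N1 \<subseteq> N0 \<and> (\<forall>N\<in>P. N \<subseteq> N1 \<longrightarrow> (\<forall>j<m. V N j = V N1 j))"
      by (rule bexE[OF Suc.IH])
    note N1 = this(1) conjunct1[OF n1] conjunct2[OF n1, rule_format]
    define Q' where "Q' = {V N m | N. N \<in> P \<and> N \<subseteq> N1}"
    have "Q' \<subseteq> interval R M K {h \<in> H. x \<odot>\<^bsub>M\<^esub> h \<in> K}" "Q' \<noteq> {}" using V N1 unfolding Q'_def by blast+
    then obtain W' where W': "W' \<in> Q'" "\<And>W. W \<in> Q' \<Longrightarrow> W \<subseteq> W' \<Longrightarrow> W = W'"
      by (rule chain_cond_minimal[OF cc]) blast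
    then obtain N2 where N2: "N2 \<in> P" "N2 \<subseteq> N1" "W' = V N2 m" by (auto simp: Q'_def)
    have "V N j = V N2 j" if "N \<in> P" "N \<subseteq> N2" "j < Suc m" for N j
    proof (cases "j = m")
      case True
      have "V N m \<in> Q'" using that N2 by (auto simp: Q'_def)
      then show ?thesis using W'(2) mono[OF that(2)] N2 True by simp
    next
      case False
      then have "j < m" using that by simp
      then show ?thesis using N1(3)[of N j] N1(3)[of N2 j] that N2 by auto
    qed
    then show ?case using N2 N1 by blast
  qed
  obtain N1 where "N1 \<in> P"
    and n1: "N1 \<subseteq> N0 \<and> (\<forall>N\<in>P. N \<subseteq> N1 \<longrightarrow> (\<forall>j<k0. V N j = V N1 j))"
    by (rule bexE[OF B])
  note N1 = this(1) conjunct1[OF n1] conjunct2[OF n1, rule_format]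
  have eq: "V N j = V N1 j" if "N \<in> P" "N \<subseteq> N1" for N j
  proof (cases "j < k0")
    case True
    then show ?thesis using N1(3)[OF that] by blast
  next
    case False
    then have j: "k0 \<le> j" by simp
    have "N \<subseteq> N0" using subset_trans[OF that(2) N1(2)] .
    then show ?thesis using A[OF that(1) _ j] A[OF N1(1,2) j] by simp
  qed
  have "N = N1" if N: "N \<in> P" "N \<subseteq> N1" for N
  proof
    note N' = Pn[OF N(1)]
    \<comment> \<open>Induction on the power of \<open>x\<close> that carries \<open>y\<close> into
      \<open>K\<close>: equality of the \<open>V\<close> at index \<open>k\<close> provides
      \<open>z\<close> in \<open>N\<close> with the same multiple by x^k modulo \<open>K\<close>,
      and y - z needs one power less.\<close>
    have "y \<in> N" if "y \<in> N1" "(x [^] k) \<odot>\<^bsub>M\<^esub> y \<in> K" for k :: nat and y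
      using that
    proof (induction k arbitrary: y)
      case 0
      then have "y \<in> K" using Pn[OF N1(1)] Hc by auto
      then show ?case using N' by auto
    next
      case (Suc k)
      have yH: "y \<in> H" using Suc Pn[OF N1(1)] by auto
      then have "(x [^] k) \<odot>\<^bsub>M\<^esub> y \<in> H" using H xk by (auto simp: submodule_iff)
      moreover have "x \<odot>\<^bsub>M\<^esub> ((x [^] k) \<odot>\<^bsub>M\<^esub> y) = (x [^] Suc k) \<odot>\<^bsub>M\<^esub> y"
        using x Hc[OF yH] smult_comm[OF x xk[of k] Hc[OF yH]] by (simp add: smult_assoc1)
      moreover have "(x [^] k) \<odot>\<^bsub>M\<^esub> y \<ominus>\<^bsub>M\<^esub> (x [^] k) \<odot>\<^bsub>M\<^esub> y \<in> K"
        using Hc[OF yH] xk K0 by (simp add: a_minus_def M.r_neg)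
      ultimately have "(x [^] k) \<odot>\<^bsub>M\<^esub> y \<in> V N1 k"
        using Suc.prems unfolding V_def by auto
      then have "(x [^] k) \<odot>\<^bsub>M\<^esub> y \<in> V N k" using eq[OF N] by simp
      then obtain z where z: "z \<in> N" "(x [^] k) \<odot>\<^bsub>M\<^esub> y \<ominus>\<^bsub>M\<^esub> (x [^] k) \<odot>\<^bsub>M\<^esub> z \<in> K"
        unfolding V_def by blast
      have zc: "z \<in> carrier M" using z N' Hc by auto
      have "(x [^] k) \<odot>\<^bsub>M\<^esub> (y \<ominus>\<^bsub>M\<^esub> z) \<in> K"
        using z zc Hc[OF yH] xk by (simp add: smult_minus)
      moreover have "y \<ominus>\<^bsub>M\<^esub> z \<in> N1"
        using submodule_minus[OF Pn(1)[OF N1(1)] Suc.prems(1)] z N by auto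
      ultimately have "y \<ominus>\<^bsub>M\<^esub> z \<in> N" using Suc.IH by blast
      then have "(y \<ominus>\<^bsub>M\<^esub> z) \<oplus>\<^bsub>M\<^esub> z \<in> N" using z N' by (auto simp: submodule_iff)
      then show ?case using minus_add_cancel[OF Hc[OF yH] zc] by simp
    qed
    then show "N1 \<subseteq> N" using tors Pn[OF N1(1)] by blast
  qed (use N in simp)
  then show "\<exists>N\<in>P. \<forall>N'\<in>P. (if False then N \<subseteq> N' else N' \<subseteq> N) \<longrightarrow> N' = N"
    using N1 by auto
qed

text \<open>Generators are removed one at a time. Within the part of \<open>H\<close> that
  \<open>A\<close> carries into \<open>K\<close>, the elements also carried there by
  \<open>x\<close> satisfy the condition; the principal case extends it to that whole part, and then
  the induction hypothesis applies.\<close>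

lemma dcc_of_colon_finite:
  assumes "finite A" "A \<subseteq> carrier R" and K: "submodule K R M" and H: "submodule H R M" and KH: "K \<subseteq> H"
    and tors: "\<And>x h. x \<in> A \<Longrightarrow> h \<in> H \<Longrightarrow> \<exists>k::nat. (x [^] k) \<odot>\<^bsub>M\<^esub> h \<in> K"
    and cc: "cc False R M K {h \<in> H. \<forall>x\<in>A. x \<odot>\<^bsub>M\<^esub> h \<in> K}"
  shows "cc False R M K H"
  using assms(1,2) tors cc
proof (induction A)
  case empty then show ?case by simp
next
  case (insert x A)
  let ?H = "{h \<in> H. \<forall>x\<in>A. x \<odot>\<^bsub>M\<^esub> h \<in> K}"
  have xA: "x \<in> carrier R" "A \<subseteq> carrier R" using insert.prems(1) by auto
  have H': "submodule ?H R M"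
    using K H xA(2) by (auto simp: submodule_iff smult_r_distr subset_iff smult_comm)
  have KH': "K \<subseteq> ?H"
    using K KH xA(2) by (auto simp: submodule_iff subset_iff)
  have "{h \<in> H. \<forall>y\<in>insert x A. y \<odot>\<^bsub>M\<^esub> h \<in> K} = {h \<in> ?H. x \<odot>\<^bsub>M\<^esub> h \<in> K}" by auto
  then have c: "cc False R M K {h \<in> ?H. x \<odot>\<^bsub>M\<^esub> h \<in> K}" using insert.prems(3) by simp
  have c': "cc False R M K ?H"
    by (rule dcc_of_colon[OF xA(1) K H' KH' _ c]) (use insert.prems(2)[of x] in blast)
  show ?case by (rule insert.IH[OF xA(2) _ c']) (use insert.prems(2) in blast)
qed

end

text \<open>These products generate the power I^k as an ideal. Annihilation by I^k can be tested on
  them, so the power itself is never formed.\<close>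

fun ideal_prods :: "('a, 'x) ring_scheme \<Rightarrow> 'a set \<Rightarrow> nat \<Rightarrow> 'a set" where
  "ideal_prods R I 0 = {\<one>\<^bsub>R\<^esub>}"
| "ideal_prods R I (Suc k) = {x \<otimes>\<^bsub>R\<^esub> y | x y. x \<in> I \<and> y \<in> ideal_prods R I k}"

context cring
begin

lemma ideal_prods_closed: "I \<subseteq> carrier R \<Longrightarrow> ideal_prods R I k \<subseteq> carrier R"
  by (induction k) auto

lemma ideal_prods_add:
  assumes "I \<subseteq> carrier R" "z \<in> ideal_prods R I (k + l)"
  shows "\<exists>w\<in>ideal_prods R I k. \<exists>w'\<in>ideal_prods R I l. z = w \<otimes> w'"
  using assms(2)
proof (induction k arbitrary: z)
  case 0
  then have "z \<in> ideal_prods R I l" "z \<in> carrier R"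
    using ideal_prods_closed[OF assms(1), of l] by auto
  then show ?case by (auto intro!: bexI[of _ z])
next
  case (Suc k)
  then obtain x y where xy: "z = x \<otimes> y" "x \<in> I" "y \<in> ideal_prods R I (k + l)" by auto
  then obtain w w' where w: "w \<in> ideal_prods R I k" "w' \<in> ideal_prods R I l" "y = w \<otimes> w'"
    using Suc.IH by blast
  have "x \<in> carrier R" "w \<in> carrier R" "w' \<in> carrier R"
    using xy w assms(1) ideal_prods_closed[OF assms(1)] by blast+
  then have "z = (x \<otimes> w) \<otimes> w'" using xy w by (simp add: m_assoc)
  moreover have "x \<otimes> w \<in> ideal_prods R I (Suc k)" using xy w by auto
  ultimately show ?case using w by blast
qed

lemma nat_pow_ideal_prods: "I \<subseteq> carrier R \<Longrightarrow> x \<in> I \<Longrightarrow> x [^] k \<in> ideal_prods R I k"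
proof (induction k)
  case (Suc k)
  then have "x [^] Suc k = x \<otimes> x [^] k" using nat_pow_Suc2 by blast
  then show ?case using Suc by auto
qed simp

text \<open>For \<open>S = {1}\<close> this is a prime over \<open>J\<close> not containing \<open>I\<close>; for the complement \<open>S\<close> of a
  prime \<open>p\<close> it is in addition contained in \<open>p\<close>.\<close>

lemma prime_avoiding:
  assumes noeth: "noetherian_ring R" and I: "I \<subseteq> carrier R" and J: "ideal J R"
    and S: "S \<subseteq> carrier R" "\<one> \<in> S" "\<And>s t. s \<in> S \<Longrightarrow> t \<in> S \<Longrightarrow> s \<otimes> t \<in> S"
    and av: "\<And>s k. s \<in> S \<Longrightarrow> \<exists>w\<in>ideal_prods R I k. s \<otimes> w \<notin> J"
  obtains p where "primeideal p R" "J \<subseteq> p" "p \<inter> S = {}" "\<not> I \<subseteq> p"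
proof -
  interpret M: module R "regular_module R" by (rule regular_module)
  \<comment> \<open>The ideals into which no s I^k is contained. A maximal one is prime; the case k
    = 0 makes it disjoint from \<open>S\<close>, and s = \<one>, k = 1 prevents it from containing
    \<open>I\<close>.\<close>
  define P where "P = {L. ideal L R \<and> J \<subseteq> L \<and> (\<forall>s\<in>S. \<forall>k. \<exists>w\<in>ideal_prods R I k. s \<otimes> w \<notin> L)}"
  have P: "P \<subseteq> {L. ideal L R}" "P \<noteq> {}" using J av by (auto simp: P_def)
  obtain p where p: "p \<in> P" "\<And>p'. p' \<in> P \<Longrightarrow> p \<subseteq> p' \<Longrightarrow> p' = p"
    by (rule chain_cond_maximal[OF noetherian_ideals[OF noeth] P]) blast
  have p': "ideal p R" "J \<subseteq> p" using p by (auto simp: P_def)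
  have av': "\<exists>w\<in>ideal_prods R I k. s \<otimes> w \<notin> p" if "s \<in> S" for s k
    using p(1) that by (auto simp: P_def)
  interpret p: ideal p R by fact
  have Iw: "w \<in> carrier R" if "w \<in> ideal_prods R I k" for w k
    using that ideal_prods_closed[OF I] by auto
  have disj: "p \<inter> S = {}"
  proof -
    have "s \<notin> p" if "s \<in> S" for s using av'[OF that, of 0] that S by auto
    then show ?thesis by blast
  qed
  have nI: "\<not> I \<subseteq> p"
  proof
    assume "I \<subseteq> p"
    moreover obtain w where "w \<in> ideal_prods R I 1" "\<one> \<otimes> w \<notin> p" using av'[OF S(2), of 1] by blast
    ultimately show False using I by auto
  qed
  have c: "carrier (regular_module R) = carrier R" "add (regular_module R) = add R"
      "smult (regular_module R) = mult R"
    by (simp_all add: regular_module_def)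
  have sp: "submodule p R (regular_module R)" by (simp add: submodule_regular p')
  have big: "\<exists>s\<in>S. \<exists>k. \<forall>w\<in>ideal_prods R I k. \<exists>j\<in>p. \<exists>r\<in>carrier R. s \<otimes> w = j \<oplus> r \<otimes> u"
    if u: "u \<in> carrier R" "u \<notin> p" for u
  proof -
    have uc: "u \<in> carrier (regular_module R)" using u c by simp
    note a = M.adjoin_submodule[OF sp uc]
    have "M.adjoin p u \<notin> P" using p(2)[of "M.adjoin p u"] a u by blast
    then have "\<exists>s\<in>S. \<exists>k. \<forall>w\<in>ideal_prods R I k. s \<otimes> w \<in> M.adjoin p u"
      using a p' by (auto simp: P_def submodule_regular)
    then show ?thesis by (simp add: M.adjoin_def c)
  qed
  have "primeideal p R"
  proof (rule primeidealI[OF p'(1) is_cring])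
    show "carrier R \<noteq> p" using S disj by auto
    fix u v assume uv: "u \<in> carrier R" "v \<in> carrier R" "u \<otimes> v \<in> p"
    show "u \<in> p \<or> v \<in> p"
    proof (rule ccontr)
      assume n: "\<not> (u \<in> p \<or> v \<in> p)"
      obtain s k where s: "s \<in> S" "\<And>w. w \<in> ideal_prods R I k \<Longrightarrow> \<exists>j\<in>p. \<exists>r\<in>carrier R. s \<otimes> w = j \<oplus> r \<otimes> u"
        using big[of u] uv n by blast
      obtain t l where t: "t \<in> S" "\<And>w. w \<in> ideal_prods R I l \<Longrightarrow> \<exists>j\<in>p. \<exists>r\<in>carrier R. t \<otimes> w = j \<oplus> r \<otimes> v"
        using big[of v] uv n by blast
      have stc: "s \<in> carrier R" "t \<in> carrier R" using s t S by auto
      \<comment> \<open>p + R u absorbs s I^k and p + R v absorbs t I^l. In the product of the two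
        expressions every term has a factor in \<open>p\<close> or the factor u v.\<close>
      have "(s \<otimes> t) \<otimes> z \<in> p" if "z \<in> ideal_prods R I (k + l)" for z
      proof -
        obtain w w' where w: "w \<in> ideal_prods R I k" "w' \<in> ideal_prods R I l" "z = w \<otimes> w'"
          using ideal_prods_add[OF I \<open>z \<in> _\<close>] by blast
        obtain j r where j: "j \<in> p" "r \<in> carrier R" "s \<otimes> w = j \<oplus> r \<otimes> u" using s w by blast
        obtain j' r' where j': "j' \<in> p" "r' \<in> carrier R" "t \<otimes> w' = j' \<oplus> r' \<otimes> v" using t w by blast
        have cc: "j \<in> carrier R" "j' \<in> carrier R" "w \<in> carrier R" "w' \<in> carrier R"
          using j j' w Iw p.Icarr by auto
        have "(s \<otimes> t) \<otimes> z = (s \<otimes> w) \<otimes> (t \<otimes> w')"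
          using w cc stc by (simp add: m_ac)
        also have "\<dots> = j \<otimes> (j' \<oplus> r' \<otimes> v) \<oplus> (r \<otimes> u \<otimes> j' \<oplus> r \<otimes> r' \<otimes> (u \<otimes> v))"
          unfolding j(3) j'(3) using cc j j' uv by (simp add: l_distr r_distr m_ac a_ac)
        also have "\<dots> \<in> p"
          using cc j j' uv by (intro p.a_closed) (auto intro: p.I_l_closed p.I_r_closed)
        finally show ?thesis .
      qed
      then show False using av'[OF S(3)[OF s(1) t(1)], of "k + l"] by blast
    qed
  qed
  then show ?thesis using that p' disj nI by blast
qed

lemma maximalideal_exists:
  assumes noeth: "noetherian_ring R" and J: "ideal J R" "J \<noteq> carrier R"
  obtains p where "maximalideal p R" "J \<subseteq> p"
proof -
  define P where "P = {L. ideal L R \<and> J \<subseteq> L \<and> L \<noteq> carrier R}"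
  have P: "P \<subseteq> {L. ideal L R}" "P \<noteq> {}" using J by (auto simp: P_def)
  obtain p where p: "p \<in> P" "\<And>p'. p' \<in> P \<Longrightarrow> p \<subseteq> p' \<Longrightarrow> p' = p"
    by (rule chain_cond_maximal[OF noetherian_ideals[OF noeth] P]) blast
  have "maximalideal p R"
  proof (rule maximalidealI)
    show "ideal p R" "carrier R \<noteq> p" using p by (auto simp: P_def)
    fix L assume L: "ideal L R" "p \<subseteq> L" "L \<subseteq> carrier R"
    show "L = p \<or> L = carrier R"
    proof (rule disjCI)
      assume "L \<noteq> carrier R"
      then have "L \<in> P" using L p(1) by (auto simp: P_def)
      then show "L = p" using p(2) L by blast
    qed
  qed
  then show ?thesis using that p by (auto simp: P_def)
qed

end

section \<open>Torsion with respect to powers of an ideal\<close>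

context module
begin

text \<open>This is T_k = (0 : I^k).\<close>

definition tors :: "'a set \<Rightarrow> nat \<Rightarrow> 'c set" where
  "tors I k = {m \<in> carrier M. \<forall>w\<in>ideal_prods R I k. w \<odot>\<^bsub>M\<^esub> m = \<zero>\<^bsub>M\<^esub>}"

lemma tors_0: "tors I 0 = {\<zero>\<^bsub>M\<^esub>}"
  by (auto simp: tors_def)

lemma tors_submodule:
  assumes "I \<subseteq> carrier R"
  shows "submodule (tors I k) R M"
proof -
  have "w \<in> carrier R" if "w \<in> ideal_prods R I k" for w
    using R.ideal_prods_closed[OF assms] that by auto
  then show ?thesis
    by (auto simp: submodule_iff tors_def smult_r_distr smult_comm)
qed

text \<open>Commuting the factors of a product gives the recursion T_(k+1) = (T_k : I). It
  identifies T_(k+1) / T_k as the part of M / T_k killed by \<open>I\<close>, which is the form that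
  Melkersson's criterion asks for.\<close>

lemma tors_Suc:
  assumes "I \<subseteq> carrier R"
  shows "tors I (Suc k) = {m \<in> carrier M. \<forall>x\<in>I. x \<odot>\<^bsub>M\<^esub> m \<in> tors I k}"
proof -
  have "w \<in> carrier R" if "w \<in> ideal_prods R I k" for w
    using R.ideal_prods_closed[OF assms] that by auto
  moreover have "x \<in> carrier R" if "x \<in> I" for x using assms that by auto
  ultimately have "(x \<otimes> w) \<odot>\<^bsub>M\<^esub> m = w \<odot>\<^bsub>M\<^esub> (x \<odot>\<^bsub>M\<^esub> m)"
    if "x \<in> I" "w \<in> ideal_prods R I k" "m \<in> carrier M" for x w m
    using that by (simp add: smult_assoc1 smult_comm)
  then have eq: "(\<forall>x\<in>I. \<forall>w\<in>ideal_prods R I k. (x \<otimes> w) \<odot>\<^bsub>M\<^esub> m = \<zero>\<^bsub>M\<^esub>) \<longleftrightarrow>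
      (\<forall>x\<in>I. \<forall>w\<in>ideal_prods R I k. w \<odot>\<^bsub>M\<^esub> (x \<odot>\<^bsub>M\<^esub> m) = \<zero>\<^bsub>M\<^esub>)" if "m \<in> carrier M" for m
    using that by simp
  have "(\<forall>w\<in>ideal_prods R I (Suc k). w \<odot>\<^bsub>M\<^esub> m = \<zero>\<^bsub>M\<^esub>) \<longleftrightarrow>
      (\<forall>x\<in>I. \<forall>w\<in>ideal_prods R I k. (x \<otimes> w) \<odot>\<^bsub>M\<^esub> m = \<zero>\<^bsub>M\<^esub>)" for m
    by auto
  then have "(\<forall>w\<in>ideal_prods R I (Suc k). w \<odot>\<^bsub>M\<^esub> m = \<zero>\<^bsub>M\<^esub>) \<longleftrightarrow> (\<forall>x\<in>I. x \<odot>\<^bsub>M\<^esub> m \<in> tors I k)"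
    if "m \<in> carrier M" for m
    using eq[OF that] that assms unfolding tors_def by (simp del: ideal_prods.simps add: subset_iff)
  then show ?thesis
    unfolding tors_def[of I "Suc k"] by (intro Collect_cong conj_cong refl) blast
qed

lemma tors_mono:
  assumes "I \<subseteq> carrier R" "j \<le> k"
  shows "tors I j \<subseteq> tors I k"
proof -
  have "tors I k \<subseteq> tors I (Suc k)" for k
    using tors_submodule[OF assms(1), of k] assms by (auto simp: tors_Suc[OF assms(1)] submodule_iff)
  then show ?thesis using lift_Suc_mono_le[of "tors I"] assms by blast
qed

text \<open>The elements carrying \<open>m\<close> into \<open>K\<close> form an ideal, which
  contains Idl A once it contains \<open>A\<close>.\<close>

lemma colon_generators:
  assumes "A \<subseteq> carrier R" "I = Idl A" "submodule K R M" "m \<in> carrier M"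
  shows "(\<forall>x\<in>A. x \<odot>\<^bsub>M\<^esub> m \<in> K) \<longleftrightarrow> (\<forall>x\<in>I. x \<odot>\<^bsub>M\<^esub> m \<in> K)"
proof
  assume *: "\<forall>x\<in>A. x \<odot>\<^bsub>M\<^esub> m \<in> K"
  let ?T = "{r \<in> carrier R. \<forall>x\<in>{m}. r \<odot>\<^bsub>M\<^esub> x \<in> K}"
  have "Idl A \<subseteq> ?T"
    by (rule R.genideal_minimal[OF transporter_ideal]) (use assms * in auto)
  then show "\<forall>x\<in>I. x \<odot>\<^bsub>M\<^esub> m \<in> K" using assms by auto
qed (use R.genideal_self[OF assms(1)] assms in auto)

lemma ideal_finite_generators:
  assumes "noetherian_ring R" "ideal I R"
  obtains A where "finite A" "A \<subseteq> carrier R" "A \<subseteq> I" "I = Idl A"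
proof -
  interpret noetherian_ring R by fact
  obtain A where "A \<subseteq> carrier R" "finite A" "I = Idl A" using finetely_gen[OF assms(2)] by blast
  then show ?thesis using that R.genideal_self by blast
qed

text \<open>Multiplications by finitely many generators of \<open>I\<close> map T_(k+1) into T_k and
  have common kernel T_1, so T_(k+1) / T_1 embeds into a finite power of T_k.\<close>

lemma tors_acc:
  assumes noeth: "noetherian_ring R" and I: "ideal I R"
    and cc: "cc True R M {\<zero>\<^bsub>M\<^esub>} (tors I 1)"
  shows "cc True R M {\<zero>\<^bsub>M\<^esub>} (tors I k)"
proof (induction k)
  case 0
  then show ?case by (simp add: tors_0 cc_refl)
next
  case (Suc k)
  interpret I: ideal I R by fact
  have Ic: "I \<subseteq> carrier R" using I.Icarr by blast
  obtain A where A: "finite A" "A \<subseteq> carrier R" "A \<subseteq> I" "I = Idl A"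
    using ideal_finite_generators[OF noeth I] .
  let ?D = "{h \<in> tors I (Suc k). \<forall>x\<in>A. x \<odot>\<^bsub>M\<^esub> h \<in> {\<zero>\<^bsub>M\<^esub>}}"
  have z: "\<zero>\<^bsub>M\<^esub> \<in> tors I j" for j using tors_submodule[OF Ic, of j] by (simp add: submodule_iff)
  have "submodule ?D R M \<and> cc True R M ?D (tors I (Suc k))"
  proof (rule cc_vimage_family[OF A(1) module_axioms module_axioms _ _ _ tors_submodule[OF Ic] _ _ Suc])
    show "(\<lambda>y. x \<odot>\<^bsub>M\<^esub> y) \<in> mod_hom R M M" if "x \<in> A" for x
      using smult_mod_hom that A(2) by blast
    show "(\<lambda>y. x \<odot>\<^bsub>M\<^esub> y) ` tors I (Suc k) \<subseteq> tors I k" if "x \<in> A" for x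
      using that A(3) unfolding tors_Suc[OF Ic] by blast
  qed (use z in \<open>simp_all add: tors_submodule[OF Ic] submodule_zero\<close>)
  moreover have "tors I 1 = ?D"
    using colon_generators[OF A(2,4) submodule_zero] tors_mono[OF Ic, of 1 "Suc k"] 
    unfolding One_nat_def
    by (auto simp: tors_Suc[OF Ic, of 0] tors_0 dest: subsetD) (auto simp: tors_def)
  ultimately have "cc True R M (tors I 1) (tors I (Suc k))" by simp
  then show ?case
    using cc_extension[OF tors_submodule[OF Ic] _ tors_mono[OF Ic] tors_submodule[OF Ic] cc, of "Suc k"] z by simp
qed

end

section \<open>Dimension and support\<close>

text \<open>For an ideal \<open>I\<close> this expresses dim R / I \<le> 1 by primes of
  \<open>R\<close>. The improper ideal satisfies it vacuously, in agreement with the dimension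
  -\<infinity> of the zero ring.\<close>

definition short_primes :: "('a, 'x) ring_scheme \<Rightarrow> 'a set \<Rightarrow> bool" where
  "short_primes R I \<longleftrightarrow> \<not> (\<exists>p q r. primeideal p R \<and> primeideal q R \<and> primeideal r R \<and>
    I \<subseteq> p \<and> p \<subset> q \<and> q \<subset> r)"

context ideal
begin

text \<open>An ideal containing \<open>I\<close> is a union of cosets of \<open>I\<close>, so
  membership can be read off the coset.\<close>

lemma quotient_mem_image:
  assumes "ideal p R" "I \<subseteq> p" "r \<in> carrier R"
  shows "I +> r \<in> (+>) I ` p \<longleftrightarrow> r \<in> p"
proof
  assume "I +> r \<in> (+>) I ` p"
  then obtain s where s: "s \<in> p" "I +> r = I +> s" by auto
  have "r \<in> I +> r" using a_rcos_self[OF assms(3)] .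
  then obtain i where "i \<in> I" "r = i \<oplus> s" unfolding s(2) by (auto simp: a_r_coset_def')
  then show "r \<in> p" using assms(2) s additive_subgroup.a_closed[OF ideal.axioms(1)[OF assms(1)]] by blast
qed auto

lemma quotient_carrier: "carrier (R Quot I) = (+>) I ` carrier R"
  by (auto simp: FactRing_def A_RCOSETS_def')

lemma quotient_prime_image:
  assumes "cring R" "primeideal p R" "I \<subseteq> p"
  shows "primeideal ((+>) I ` p) (R Quot I)"
proof -
  interpret R: cring R by fact
  interpret p: primeideal p R by fact
  note mem = quotient_mem_image[OF p.is_ideal assms(3)]
  show ?thesis
  proof (rule primeidealI)
    show "ideal ((+>) I ` p) (R Quot I)"
      using ring_ideal_imp_quot_ideal[OF is_ideal p.is_ideal] .
    show "cring (R Quot I)" using quotient_is_cring[OF assms(1)] .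
    obtain r where "r \<in> carrier R" "r \<notin> p" using p.I_notcarr p.Icarr by blast
    then show "carrier (R Quot I) \<noteq> (+>) I ` p"
      using mem[of r] quotient_carrier by blast
  next
    fix X Y assume "X \<in> carrier (R Quot I)" "Y \<in> carrier (R Quot I)"
      and XY: "X \<otimes>\<^bsub>R Quot I\<^esub> Y \<in> (+>) I ` p"
    then obtain a b where ab: "a \<in> carrier R" "b \<in> carrier R" "X = I +> a" "Y = I +> b"
      unfolding quotient_carrier by blast
    have "I +> (a \<otimes> b) = X \<otimes>\<^bsub>R Quot I\<^esub> Y"
      using ring_hom_mult[OF rcos_ring_hom] ab by simp
    then have "a \<otimes> b \<in> p" using XY mem[of "a \<otimes> b"] ab by simp
    then show "X \<in> (+>) I ` p \<or> Y \<in> (+>) I ` p" using p.I_prime ab by blast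
  qed
qed

text \<open>Images and preimages along R -> R / I match primes over \<open>I\<close> with primes of
  the quotient and keep inclusions strict.\<close>

lemma krull_dim_quotient_le_1_iff:
  assumes "cring R"
  shows "krull_dim (R Quot I) \<le> 1 \<longleftrightarrow> short_primes R I"
proof
  interpret R: cring R by fact
  assume dim: "krull_dim (R Quot I) \<le> 1"
  show "short_primes R I"
    unfolding short_primes_def
  proof (intro notI, elim exE conjE)
    fix p q r assume *: "primeideal p R" "primeideal q R" "primeideal r R" "I \<subseteq> p" "p \<subset> q" "q \<subset> r"
    define f where "f X = (+>) I ` X" for X
    \<comment> \<open>Dimension counts inclusions, so three primes make a chain of length 2, indexed
      by 0, 1, 2.\<close>
    define c where "c i = (if i = 0 then f p else if i = 1 then f q else f r)" for i :: nat
    have strict: "f X \<subset> f Y" if XY: "primeideal X R" "I \<subseteq> X" "X \<subset> Y" "primeideal Y R" for X Y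
    proof -
      have id: "ideal X R" "ideal Y R" using XY primeideal.axioms(1) by auto
      obtain y where "y \<in> Y" "y \<notin> X" using XY by blast
      then have "I +> y \<in> f Y" "I +> y \<notin> f X"
        using quotient_mem_image[OF id(1) XY(2)] ideal.Icarr[OF id(2)] by (auto simp: f_def)
      then show ?thesis using XY by (auto simp: f_def)
    qed
    have I: "I \<subseteq> q" "I \<subseteq> r" using * by auto
    have "\<forall>i\<le>2. primeideal (c i) (R Quot I)"
      using quotient_prime_image[OF assms *(1,4)] quotient_prime_image[OF assms *(2) I(1)]
        quotient_prime_image[OF assms *(3) I(2)] by (auto simp: c_def f_def)
    moreover have "\<forall>i<2. c i \<subset> c (Suc i)"
      using strict[OF *(1,4,5,2)] strict[OF *(2) I(1) *(6,3)] by (auto simp: c_def less_2_cases_iff)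
    ultimately have "ereal (real 2) \<le> krull_dim (R Quot I)"
      unfolding krull_dim_def by (intro Sup_upper) blast
    then have "ereal (real 2) \<le> 1" using dim by (rule order_trans)
    then show False by simp
  qed
next
  interpret R: cring R by fact
  assume short: "short_primes R I"
  show "krull_dim (R Quot I) \<le> 1"
    unfolding krull_dim_def
  proof (rule Sup_least)
    fix x assume "x \<in> {ereal (real n) | n. \<exists>p. (\<forall>i\<le>n. primeideal (p i) (R Quot I)) \<and> (\<forall>i<n. p i \<subset> p (Suc i))}"
    then obtain n p where x: "x = ereal (real n)" and p: "\<And>i. i \<le> n \<Longrightarrow> primeideal (p i) (R Quot I)"
      "\<And>i. i < n \<Longrightarrow> p i \<subset> p (Suc i)" by auto
    have "n \<le> 1"
    proof (rule ccontr)
      assume "\<not> n \<le> 1"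
      \<comment> \<open>Contraction along the projection; of a chain of length at least 2 just the
        first three primes are contracted.\<close>
      define g where "g X = {r \<in> carrier R. I +> r \<in> X}" for X
      have g: "primeideal (g X) R" if "primeideal X (R Quot I)" for X
        unfolding g_def using ring_hom_ring.primeideal_vimage[OF rcos_ring_hom_ring assms that] .
      have strict: "g X \<subset> g Y" if XY: "X \<subset> Y" "primeideal Y (R Quot I)" for X Y
      proof -
        obtain z where z: "z \<in> Y" "z \<notin> X" using XY by blast
        then have "z \<in> carrier (R Quot I)"
          using ideal.Icarr[OF primeideal.axioms(1)[OF XY(2)]] by blast
        then obtain r where "r \<in> carrier R" "z = I +> r" unfolding quotient_carrier by blast
        then have "r \<in> g Y" "r \<notin> g X" using z by (auto simp: g_def)
        then show ?thesis using XY by (auto simp: g_def)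
      qed
      have "I \<subseteq> g (p 0)"
      proof
        fix r assume r: "r \<in> I"
        have "I +> r = \<zero>\<^bsub>R Quot I\<^esub>" using a_rcos_const[OF r] by (simp add: FactRing_def)
        then show "r \<in> g (p 0)"
          using additive_subgroup.zero_closed[OF ideal.axioms(1)[OF primeideal.axioms(1)[OF p(1)[of 0]]]] r Icarr
          by (simp add: g_def)
      qed
      moreover have "p 0 \<subset> p 1" "p 1 \<subset> p 2"
        using p(2)[of 0] p(2)[of 1] \<open>\<not> n \<le> 1\<close> by (simp_all add: numeral_2_eq_2)
      then have "g (p 0) \<subset> g (p 1)" "g (p 1) \<subset> g (p 2)"
        using strict p(1)[of 1] p(1)[of 2] \<open>\<not> n \<le> 1\<close> by simp_all
      moreover have "primeideal (g (p 0)) R" "primeideal (g (p 1)) R" "primeideal (g (p 2)) R"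
        using g p(1) \<open>\<not> n \<le> 1\<close> by auto
      ultimately show False using short unfolding short_primes_def by blast
    qed
    then show "x \<le> 1" by (simp add: x)
  qed
qed

end

context module
begin

lemma Ann_ideal: "ideal (Ann R M) R"
  using transporter_ideal[OF submodule_zero, of "carrier M"] by (simp add: Ann_def)

lemma dim_bar_le_1_iff: "dim_bar R M \<le> 1 \<longleftrightarrow> short_primes R (Ann R M)"
  unfolding dim_bar_def by (rule ideal.krull_dim_quotient_le_1_iff[OF Ann_ideal R.is_cring])

text \<open>The fraction m / 1 is nonzero exactly when no element outside \<open>p\<close> kills
  \<open>m\<close>. If all such fractions vanish, any two fractions are equal and the localization
  has one class.\<close>

lemma Supp_iff:
  "p \<in> Supp R M \<longleftrightarrow>
    primeideal p R \<and> (\<exists>m\<in>carrier M. \<forall>s\<in>carrier R - p. s \<odot>\<^bsub>M\<^esub> m \<noteq> \<zero>\<^bsub>M\<^esub>)"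
proof (cases "primeideal p R")
  case True
  interpret p: primeideal p R by fact
  let ?S = "carrier R - p"
  have one: "\<one> \<in> ?S"
    using p.I_notcarr p.one_imp_carrier by auto
  have mult: "s \<otimes> t \<in> ?S" if "s \<in> ?S" "t \<in> ?S" for s t using p.I_prime that by auto
  have "localization ?S M \<noteq> {localization_zero R ?S M} \<longleftrightarrow>
    (\<exists>m\<in>carrier M. \<forall>s\<in>?S. s \<odot>\<^bsub>M\<^esub> m \<noteq> \<zero>\<^bsub>M\<^esub>)"
  proof
    assume "\<exists>m\<in>carrier M. \<forall>s\<in>?S. s \<odot>\<^bsub>M\<^esub> m \<noteq> \<zero>\<^bsub>M\<^esub>"
    then obtain m where m: "m \<in> carrier M" "\<And>s. s \<in> ?S \<Longrightarrow> s \<odot>\<^bsub>M\<^esub> m \<noteq> \<zero>\<^bsub>M\<^esub>" by blast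
    have "(m, \<one>) \<in> fraction_rel ?S M `` {(m, \<one>)}"
      using m one by (auto simp: fraction_rel_def)
    moreover have "(m, \<one>) \<notin> localization_zero R ?S M"
      using m(1) m(2)[symmetric] by (auto simp: localization_zero_def fraction_rel_def)
    ultimately have "fraction_rel ?S M `` {(m, \<one>)} \<noteq> localization_zero R ?S M" by metis
    moreover have "fraction_rel ?S M `` {(m, \<one>)} \<in> localization ?S M"
      unfolding localization_def by (rule quotientI) (use m one in auto)
    ultimately show "localization ?S M \<noteq> {localization_zero R ?S M}" by (metis singletonD)
  next
    assume ne: "localization ?S M \<noteq> {localization_zero R ?S M}"
    show "\<exists>m\<in>carrier M. \<forall>s\<in>?S. s \<odot>\<^bsub>M\<^esub> m \<noteq> \<zero>\<^bsub>M\<^esub>"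
    proof (rule ccontr)
      assume "\<not> ?thesis"
      then have k: "\<exists>s\<in>?S. s \<odot>\<^bsub>M\<^esub> m = \<zero>\<^bsub>M\<^esub>" if "m \<in> carrier M" for m using that by blast
      \<comment> \<open>If \<open>u\<close> kills the one numerator and \<open>v\<close> the other,
        u v kills both cross products, whatever the denominators.\<close>
      have full: "fraction_rel ?S M `` {(x, s)} = carrier M \<times> ?S" if x: "x \<in> carrier M" "s \<in> ?S" for x s
      proof -
        have "\<exists>u\<in>?S. u \<odot>\<^bsub>M\<^esub> (t \<odot>\<^bsub>M\<^esub> x) = u \<odot>\<^bsub>M\<^esub> (s \<odot>\<^bsub>M\<^esub> y)" if y: "y \<in> carrier M" "t \<in> ?S" for y t
        proof -
          obtain u v where u: "u \<in> ?S" "u \<odot>\<^bsub>M\<^esub> x = \<zero>\<^bsub>M\<^esub>" and v: "v \<in> ?S" "v \<odot>\<^bsub>M\<^esub> y = \<zero>\<^bsub>M\<^esub>"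
            using k x y by meson
          have c: "u \<in> carrier R" "v \<in> carrier R" "s \<in> carrier R" "t \<in> carrier R" using u v x y by auto
          have "(u \<otimes> v) \<odot>\<^bsub>M\<^esub> (t \<odot>\<^bsub>M\<^esub> x) = v \<odot>\<^bsub>M\<^esub> (t \<odot>\<^bsub>M\<^esub> (u \<odot>\<^bsub>M\<^esub> x))"
            using c x by (simp add: smult_assoc1[symmetric] m_ac)
          moreover have "(u \<otimes> v) \<odot>\<^bsub>M\<^esub> (s \<odot>\<^bsub>M\<^esub> y) = u \<odot>\<^bsub>M\<^esub> (s \<odot>\<^bsub>M\<^esub> (v \<odot>\<^bsub>M\<^esub> y))"
            using c y by (simp add: smult_assoc1[symmetric] m_ac)
          ultimately have "(u \<otimes> v) \<odot>\<^bsub>M\<^esub> (t \<odot>\<^bsub>M\<^esub> x) = (u \<otimes> v) \<odot>\<^bsub>M\<^esub> (s \<odot>\<^bsub>M\<^esub> y)"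
            using u v c by simp
          then show ?thesis using mult[OF u(1) v(1)] by blast
        qed
        then show ?thesis using x by (auto simp: fraction_rel_def)
      qed
      have z: "(\<zero>\<^bsub>M\<^esub>, \<one>) \<in> carrier M \<times> ?S" using one by simp
      have "localization ?S M = {carrier M \<times> ?S}"
      proof
        show "localization ?S M \<subseteq> {carrier M \<times> ?S}"
          unfolding localization_def using full by (auto simp: quotient_def)
        have "carrier M \<times> ?S = fraction_rel ?S M `` {(\<zero>\<^bsub>M\<^esub>, \<one>)}" using full one by simp
        then show "{carrier M \<times> ?S} \<subseteq> localization ?S M"
          using quotientI[OF z, of "fraction_rel ?S M"] unfolding localization_def by simp
      qed
      moreover have "localization_zero R ?S M = carrier M \<times> ?S"
        unfolding localization_zero_def using full one by simp
      ultimately show False using ne by simp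
    qed
  qed
  then show ?thesis using True by (simp add: Supp_def)
qed (simp add: Supp_def)

text \<open>If no power of \<open>I\<close> killed \<open>m\<close>, some prime over Ann(m) would
  not contain \<open>I\<close>. Nothing outside that prime kills \<open>m\<close>, so it would lie
  in the support.\<close>

lemma torsion_of_Supp:
  assumes noeth: "noetherian_ring R" and I: "ideal I R" and S: "Supp R M \<subseteq> zero_locus R I"
    and m: "m \<in> carrier M"
  shows "\<exists>k. m \<in> tors I k"
proof (rule ccontr)
  assume n: "\<nexists>k. m \<in> tors I k"
  have Ic: "I \<subseteq> carrier R" using ideal.Icarr[OF I] by blast
  let ?J = "{r \<in> carrier R. \<forall>x\<in>{m}. r \<odot>\<^bsub>M\<^esub> x \<in> {\<zero>\<^bsub>M\<^esub>}}"
  have J: "ideal ?J R" by (rule transporter_ideal[OF submodule_zero]) (use m in simp)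
  have "\<exists>w\<in>ideal_prods R I k. s \<otimes> w \<notin> ?J" if "s \<in> {\<one>}" for s k
    using n m that R.ideal_prods_closed[OF Ic, of k] by (auto simp: tors_def subset_iff)
  then obtain p where p: "primeideal p R" "?J \<subseteq> p" "\<not> I \<subseteq> p"
    by (rule R.prime_avoiding[OF noeth Ic J, of "{\<one>}", rotated 3]) auto
  have "p \<in> Supp R M"
    unfolding Supp_iff using p m by (auto simp: subset_iff)
  then show False using S p by (auto simp: zero_locus_def)
qed

text \<open>The ideals b n = Ann(M / T_n) increase; \<open>n\<close> is where they stop. For a prime
  \<open>p\<close> over I + b n, no s I^k with \<open>s\<close> outside \<open>p\<close> kills
  \<open>M\<close>, since that would put \<open>s\<close> into b k. Avoidance then yields a prime
  \<open>q\<close> over Ann M, strictly below \<open>p\<close>. A maximal ideal strictly above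
  \<open>p\<close> would complete a forbidden chain.\<close>

lemma primes_maximal:
  assumes noeth: "noetherian_ring R" and I: "ideal I R" and short: "short_primes R (Ann R M)"
  obtains n where "\<And>p. primeideal p R \<Longrightarrow> I \<subseteq> p \<Longrightarrow>
    {r \<in> carrier R. \<forall>x\<in>carrier M. r \<odot>\<^bsub>M\<^esub> x \<in> tors I n} \<subseteq> p \<Longrightarrow> maximalideal p R"
proof -
  have Ic: "I \<subseteq> carrier R" using ideal.Icarr[OF I] by blast
  define b where "b n = {r \<in> carrier R. \<forall>x\<in>carrier M. r \<odot>\<^bsub>M\<^esub> x \<in> tors I n}" for n
  have bi: "ideal (b n) R" for n unfolding b_def by (rule transporter_ideal[OF tors_submodule[OF Ic]]) simp
  have P: "range b \<subseteq> {L. ideal L R}" "range b \<noteq> {}" using bi by auto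
  obtain B where B: "B \<in> range b" "\<And>N. N \<in> range b \<Longrightarrow> B \<subseteq> N \<Longrightarrow> N = B"
    by (rule chain_cond_maximal[OF noetherian_ideals[OF noeth] P]) blast
  then obtain n where n: "B = b n" by auto
  have bmono: "b i \<subseteq> b j" if "i \<le> j" for i j
    using tors_mono[OF Ic that] unfolding b_def by blast
  \<comment> \<open>Valid also for \<open>k\<close> beyond \<open>n\<close>, so that the exponent of
    \<open>I\<close> in the avoidance argument may be arbitrary.\<close>
  have bn: "b k \<subseteq> b n" for k
  proof -
    have "b (max n k) = b n" using B(2)[of "b (max n k)"] bmono[of n "max n k"] n by simp
    then show ?thesis using bmono[of k "max n k"] by simp
  qed
  have "maximalideal p R" if p: "primeideal p R" "I \<subseteq> p" "b n \<subseteq> p" for p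
  proof -
    interpret p: primeideal p R by fact
    let ?S = "carrier R - p"
    have av: "\<exists>w\<in>ideal_prods R I k. s \<otimes> w \<notin> Ann R M" if s: "s \<in> ?S" for s k
    proof (rule ccontr)
      assume "\<not> ?thesis"
      then have a: "s \<otimes> w \<in> Ann R M" if "w \<in> ideal_prods R I k" for w using that by blast
      have "s \<odot>\<^bsub>M\<^esub> x \<in> tors I k" if x: "x \<in> carrier M" for x
      proof -
        have "w \<odot>\<^bsub>M\<^esub> (s \<odot>\<^bsub>M\<^esub> x) = \<zero>\<^bsub>M\<^esub>" if w: "w \<in> ideal_prods R I k" for w
        proof -
          have wc: "w \<in> carrier R" "s \<in> carrier R" using w R.ideal_prods_closed[OF Ic] s by auto
          have "w \<odot>\<^bsub>M\<^esub> (s \<odot>\<^bsub>M\<^esub> x) = (s \<otimes> w) \<odot>\<^bsub>M\<^esub> x"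
            using wc x by (simp add: smult_assoc1 smult_comm)
          then show ?thesis using a[OF w] x by (simp add: Ann_def)
        qed
        then show ?thesis using s x by (simp add: tors_def)
      qed
      then have "s \<in> b k" using s by (simp add: b_def)
      then show False using bn[of k] p s by blast
    qed
    have one: "\<one> \<in> ?S" using p.I_notcarr p.one_imp_carrier by auto
    obtain q where q: "primeideal q R" "Ann R M \<subseteq> q" "q \<inter> ?S = {}" "\<not> I \<subseteq> q"
      by (rule R.prime_avoiding[OF noeth Ic Ann_ideal _ one _ av]) (use p.I_prime in auto)
    \<comment> \<open>Disjointness from the complement of \<open>p\<close> puts \<open>q\<close>
      inside \<open>p\<close>; the inclusion is strict because \<open>p\<close> contains
      \<open>I\<close> and \<open>q\<close> does not.\<close>
    have qp: "q \<subset> p"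
      using q(3,4) p(2) ideal.Icarr[OF primeideal.axioms(1)[OF q(1)]] by blast
    obtain m where m: "maximalideal m R" "p \<subseteq> m"
      using R.maximalideal_exists[OF noeth p.is_ideal] p.I_notcarr by metis
    have "m = p"
      using short R.maximalideal_prime[OF m(1)] p(1) q qp m(2) unfolding short_primes_def by blast
    then show ?thesis using m by simp
  qed
  then show ?thesis using that unfolding b_def by blast
qed

lemma tors_quotient_dcc:
  assumes noeth: "noetherian_ring R" and I: "ideal I R"
    and tors: "\<And>m. m \<in> carrier M \<Longrightarrow> \<exists>k. m \<in> tors I k"
    and cc: "cc True R M {\<zero>\<^bsub>M\<^esub>} (tors I 1)"
    and max: "\<And>p. primeideal p R \<Longrightarrow> I \<subseteq> p \<Longrightarrow>
      {r \<in> carrier R. \<forall>x\<in>carrier M. r \<odot>\<^bsub>M\<^esub> x \<in> tors I n} \<subseteq> p \<Longrightarrow> maximalideal p R"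
  shows "cc False R M (tors I n) (carrier M)"
proof -
  have Ic: "I \<subseteq> carrier R" using ideal.Icarr[OF I] by blast
  obtain A where A: "finite A" "A \<subseteq> carrier R" "A \<subseteq> I" "I = Idl A"
    using ideal_finite_generators[OF noeth I] .
  note T = tors_submodule[OF Ic]
  let ?J = "{r \<in> carrier R. \<forall>x\<in>tors I (Suc n). r \<odot>\<^bsub>M\<^esub> x \<in> tors I n}"
  have Tc: "tors I k \<subseteq> carrier M" for k by (auto simp: tors_def)
  have "cc True R M (tors I n) (tors I (Suc n))"
    by (rule cc_subinterval[OF tors_acc[OF noeth I cc]]) (use T in \<open>auto simp: submodule_iff\<close>)
  then have "cc False R M (tors I n) (tors I (Suc n))"
  proof (rule cc_swap[OF noeth transporter_ideal[OF T Tc], rotated -1])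
    fix p assume p: "primeideal p R" "?J \<subseteq> p"
    \<comment> \<open>\<open>?J\<close> annihilates T_(n+1) / T_n. It contains \<open>I\<close> by
      the recursion for the torsion, and also the ideal named in \<open>max\<close>, which carries
      all of \<open>M\<close> into T_n.\<close>
    have "I \<subseteq> ?J" using Ic unfolding tors_Suc[OF Ic] by blast
    then show "maximalideal p R" using p Tc by (intro max) blast+
  qed (use T tors_mono[OF Ic] in auto)
  moreover have "tors I (Suc n) = {h \<in> carrier M. \<forall>x\<in>A. x \<odot>\<^bsub>M\<^esub> h \<in> tors I n}"
    unfolding tors_Suc[OF Ic] using colon_generators[OF A(2,4) T] by blast
  ultimately have c: "cc False R M (tors I n) {h \<in> carrier M. \<forall>x\<in>A. x \<odot>\<^bsub>M\<^esub> h \<in> tors I n}" by simp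
  show ?thesis
  proof (rule dcc_of_colon_finite[OF A(1,2) T carrier_is_submodule Tc _ c])
    fix x h assume x: "x \<in> A" and h: "h \<in> carrier M"
    obtain k where "h \<in> tors I k" using tors[OF h] by blast
    then have "(x [^] k) \<odot>\<^bsub>M\<^esub> h = \<zero>\<^bsub>M\<^esub>"
      using R.nat_pow_ideal_prods[OF Ic, of x k] x A(3) by (auto simp: tors_def)
    then have "(x [^] k) \<odot>\<^bsub>M\<^esub> h \<in> tors I n" using T[of n] by (simp add: submodule_iff)
    then show "\<exists>k::nat. (x [^] k) \<odot>\<^bsub>M\<^esub> h \<in> tors I n" by blast
  qed
qed

end

section \<open>Finitely generated quotients\<close>

context module
begin

text \<open>A predicate on pairs instead of a span operation: spans of finite sets are then built
  from zero by repeated \<open>adjoin\<close>.\<close>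

definition spanned :: "'c set \<Rightarrow> 'c set \<Rightarrow> bool" where
  "spanned A S \<longleftrightarrow> submodule S R M \<and> A \<subseteq> S \<and> (\<forall>H. submodule H R M \<longrightarrow> A \<subseteq> H \<longrightarrow> S \<subseteq> H)"

lemma spanned_empty: "spanned {} {\<zero>\<^bsub>M\<^esub>}"
  using submodule_zero by (auto simp: spanned_def submodule_iff)

lemma spanned_insert:
  assumes "spanned A S" "x \<in> carrier M"
  shows "spanned (insert x A) (adjoin S x)"
proof -
  have S: "submodule S R M" "A \<subseteq> S" "\<And>H. submodule H R M \<Longrightarrow> A \<subseteq> H \<Longrightarrow> S \<subseteq> H"
    using assms(1) by (auto simp: spanned_def)
  note a = adjoin_submodule[OF S(1) assms(2)]
  show ?thesis
    unfolding spanned_def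
  proof (intro conjI allI impI)
    show "submodule (adjoin S x) R M" by (rule a(1))
    show "insert x A \<subseteq> adjoin S x" using a S by auto
    fix H assume H: "submodule H R M" "insert x A \<subseteq> H"
    then show "adjoin S x \<subseteq> H" using adjoin_minimal[OF H(1) S(3)] by simp
  qed
qed

lemma fg_iff_spanned:
  "finitely_generated_module R M \<longleftrightarrow> (\<exists>A. finite A \<and> A \<subseteq> carrier M \<and> spanned A (carrier M))"
proof -
  have "carrier M = \<Inter>{H. submodule H R M \<and> A \<subseteq> H} \<longleftrightarrow> spanned A (carrier M)"
    if A: "A \<subseteq> carrier M" for A
  proof
    assume *: "carrier M = \<Inter>{H. submodule H R M \<and> A \<subseteq> H}"
    have "carrier M \<subseteq> H" if "submodule H R M" "A \<subseteq> H" for H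
      by (subst *) (use that in auto)
    then show "spanned A (carrier M)" using A carrier_is_submodule by (simp add: spanned_def)
  next
    assume "spanned A (carrier M)"
    then show "carrier M = \<Inter>{H. submodule H R M \<and> A \<subseteq> H}"
      using A carrier_is_submodule unfolding spanned_def by blast
  qed
  then show ?thesis
    unfolding finitely_generated_module_def by (intro iff_exI conj_cong refl)
qed

text \<open>A maximal finitely generated submodule of \<open>H\<close> must be \<open>H\<close>,
  since any further element could be adjoined.\<close>

lemma submodule_fg:
  assumes cc: "cc True R M {\<zero>\<^bsub>M\<^esub>} H" and H: "submodule H R M"
  obtains A where "finite A" "A \<subseteq> H" "spanned A H"
proof -
  have Hc: "H \<subseteq> carrier M" using H by (auto simp: submodule_iff)
  define P where "P = {S. S \<subseteq> H \<and> (\<exists>A. finite A \<and> A \<subseteq> H \<and> spanned A S)}"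
  have "\<zero>\<^bsub>M\<^esub> \<in> H" using H by (simp add: submodule_iff)
  then have "{\<zero>\<^bsub>M\<^esub>} \<in> P" unfolding P_def using spanned_empty by blast
  then have P2: "P \<noteq> {}" by blast
  have P1: "P \<subseteq> interval R M {\<zero>\<^bsub>M\<^esub>} H"
    by (auto simp: P_def interval_def spanned_def submodule_iff)
  obtain S where S: "S \<in> P" "\<And>S'. S' \<in> P \<Longrightarrow> S \<subseteq> S' \<Longrightarrow> S' = S"
    by (rule chain_cond_maximal[OF cc P1 P2]) blast
  obtain A where A: "finite A" "A \<subseteq> H" "spanned A S" "S \<subseteq> H" using S(1) by (auto simp: P_def)
  have "x \<in> S" if x: "x \<in> H" for x
  proof -
    have xc: "x \<in> carrier M" using x Hc by auto
    have sS: "submodule S R M" using A(3) by (simp add: spanned_def)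
    note a = adjoin_submodule[OF sS xc]
    have "adjoin S x \<in> P"
      using spanned_insert[OF A(3) xc] A x adjoin_minimal[OF H A(4) x] finite_insert
      unfolding P_def by blast
    then show ?thesis using S(2) a by blast
  qed
  then have "S = H" using A(4) by blast
  then show ?thesis using that A by blast
qed

text \<open>Over a noetherian ring each adjoined generator adds one cyclic layer (S + R x) / S, a
  quotient of the ring; finitely many layers build up the module.\<close>

lemma fg_iff_cc:
  assumes noeth: "noetherian_ring R"
  shows "finitely_generated_module R M \<longleftrightarrow> cc True R M {\<zero>\<^bsub>M\<^esub>} (carrier M)"
proof
  assume "cc True R M {\<zero>\<^bsub>M\<^esub>} (carrier M)"
  then show "finitely_generated_module R M"
    unfolding fg_iff_spanned using submodule_fg[OF _ carrier_is_submodule] by metis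
next
  assume "finitely_generated_module R M"
  then obtain A where A: "finite A" "A \<subseteq> carrier M" "spanned A (carrier M)"
    unfolding fg_iff_spanned by blast
  interpret RR: module R "regular_module R" by (rule R.regular_module)
  have "\<exists>S. spanned A S \<and> cc True R M {\<zero>\<^bsub>M\<^esub>} S" using A(1,2)
  proof (induction A)
    case empty then show ?case using spanned_empty cc_refl by blast
  next
    case (insert x A)
    then obtain S where S: "spanned A S" "cc True R M {\<zero>\<^bsub>M\<^esub>} S" by blast
    have x: "x \<in> carrier M" using insert by auto
    have sS: "submodule S R M" using S by (simp add: spanned_def)
    note a = adjoin_submodule[OF sS x]
    have Sc: "s \<in> carrier M" if "s \<in> S" for s using sS that by (auto simp: submodule_iff)
    have c: "carrier (regular_module R) = carrier R" "\<zero>\<^bsub>regular_module R\<^esub> = \<zero>"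
      by (simp_all add: regular_module_def)
    have "cc True R M S (adjoin S x)"
    proof (rule cc_congruent[OF RR.module_axioms module_axioms, where f = "\<lambda>r. r \<odot>\<^bsub>M\<^esub> x"
          and H = "carrier R" and K = "{\<zero>}"])
      show "(\<lambda>r. r \<odot>\<^bsub>M\<^esub> x) \<in> mod_hom R (regular_module R) M"
        by (rule mod_homI) (use x in \<open>simp_all add: regular_module_def smult_l_distr smult_assoc1\<close>)
      show "submodule {\<zero>} R (regular_module R)" "submodule (carrier R) R (regular_module R)"
        using RR.submodule_zero RR.carrier_is_submodule c by simp_all
      show "cc True R (regular_module R) {\<zero>} (carrier R)" using noetherian_cc[OF R.is_cring noeth] .
    next
      fix y assume "y \<in> adjoin S x"
      then obtain s r where s: "s \<in> S" "r \<in> carrier R" "y = s \<oplus>\<^bsub>M\<^esub> r \<odot>\<^bsub>M\<^esub> x"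
        unfolding adjoin_def by blast
      then have "y \<ominus>\<^bsub>M\<^esub> r \<odot>\<^bsub>M\<^esub> x = s" using Sc x by (simp add: a_minus_def M.a_assoc M.r_neg)
      then show "\<exists>r\<in>carrier R. y \<ominus>\<^bsub>M\<^esub> r \<odot>\<^bsub>M\<^esub> x \<in> S"
        using s(1,2) by (intro bexI[of _ r]) simp_all
    next
      fix r assume "r \<in> {\<zero>}"
      then show "r \<odot>\<^bsub>M\<^esub> x \<in> S" using x sS by (simp add: submodule_iff)
    qed (use a sS in auto)
    moreover have "{\<zero>\<^bsub>M\<^esub>} \<subseteq> S" using sS by (simp add: submodule_iff)
    ultimately have "cc True R M {\<zero>\<^bsub>M\<^esub>} (adjoin S x)"
      using cc_extension[OF sS _ a(2) a(1) S(2)] by blast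
    then show ?case using spanned_insert[OF S(1) x] by blast
  qed
  then obtain S where S: "spanned A S" "cc True R M {\<zero>\<^bsub>M\<^esub>} S" by blast
  have "S = carrier M" using S(1) A(2,3) submodule_iff[of S] unfolding spanned_def by blast
  then show "cc True R M {\<zero>\<^bsub>M\<^esub>} (carrier M)" using S by simp
qed

lemma coset_eq:
  assumes "submodule B R M" "x \<in> carrier M" "y \<in> carrier M"
  shows "B +>\<^bsub>M\<^esub> x = B +>\<^bsub>M\<^esub> y \<longleftrightarrow> x \<ominus>\<^bsub>M\<^esub> y \<in> B"
proof -
  have ab: "abelian_subgroup B M"
    by (rule abelian_subgroupI3)
      (use submodule.axioms(1)[OF assms(1)] in \<open>simp_all add: additive_subgroup_def M.abelian_group_axioms\<close>)
  have "B +>\<^bsub>M\<^esub> x = B +>\<^bsub>M\<^esub> y \<longleftrightarrow> x \<in> B +>\<^bsub>M\<^esub> y"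
    using abelian_subgroup.a_rcos_self[OF ab assms(2)]
      abelian_subgroup.a_repr_independence'[OF ab _ assms(3)] by metis
  then show ?thesis
    using abelian_subgroup.a_rcos_module[OF ab assms(3,2)] by (simp add: a_minus_def)
qed

lemma quotient_module_simps:
  assumes B: "submodule B R M"
  shows "carrier (quotient_module M B) = (\<lambda>x. B +>\<^bsub>M\<^esub> x) ` carrier M"
    and "\<zero>\<^bsub>quotient_module M B\<^esub> = B +>\<^bsub>M\<^esub> \<zero>\<^bsub>M\<^esub>"
    and "\<And>x y. x \<in> carrier M \<Longrightarrow> y \<in> carrier M \<Longrightarrow>
      (B +>\<^bsub>M\<^esub> x) \<oplus>\<^bsub>quotient_module M B\<^esub> (B +>\<^bsub>M\<^esub> y) = B +>\<^bsub>M\<^esub> (x \<oplus>\<^bsub>M\<^esub> y)"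
    and "\<And>r x. r \<in> carrier R \<Longrightarrow> x \<in> carrier M \<Longrightarrow>
      r \<odot>\<^bsub>quotient_module M B\<^esub> (B +>\<^bsub>M\<^esub> x) = B +>\<^bsub>M\<^esub> (r \<odot>\<^bsub>M\<^esub> x)"
proof -
  have Bc: "b \<in> carrier M" if "b \<in> B" for b using that B by (auto simp: submodule_iff)
  have B0: "\<zero>\<^bsub>M\<^esub> \<in> B" using B by (auto simp: submodule_iff)
  show "carrier (quotient_module M B) = (\<lambda>x. B +>\<^bsub>M\<^esub> x) ` carrier M"
    by (auto simp: quotient_module_def A_RCOSETS_def')
  have "B +>\<^bsub>M\<^esub> \<zero>\<^bsub>M\<^esub> = B" using Bc by (force simp: a_r_coset_def')
  then show "\<zero>\<^bsub>quotient_module M B\<^esub> = B +>\<^bsub>M\<^esub> \<zero>\<^bsub>M\<^esub>" by (simp add: quotient_module_def)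
  fix x assume x: "x \<in> carrier M"
  have ab: "abelian_subgroup B M"
    by (rule abelian_subgroupI3)
      (use submodule.axioms(1)[OF B] in \<open>simp_all add: additive_subgroup_def M.abelian_group_axioms\<close>)
  show "(B +>\<^bsub>M\<^esub> x) \<oplus>\<^bsub>quotient_module M B\<^esub> (B +>\<^bsub>M\<^esub> y) = B +>\<^bsub>M\<^esub> (x \<oplus>\<^bsub>M\<^esub> y)" if "y \<in> carrier M" for y
    using abelian_subgroup.a_rcos_sum[OF ab x that] by (simp add: quotient_module_def)
  show "r \<odot>\<^bsub>quotient_module M B\<^esub> (B +>\<^bsub>M\<^esub> x) = B +>\<^bsub>M\<^esub> (r \<odot>\<^bsub>M\<^esub> x)" if r: "r \<in> carrier R" for r
  proof -
    \<comment> \<open>The scalar multiple of a coset is defined as a union over its elements; all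
      cosets in that union agree.\<close>
    have "B +>\<^bsub>M\<^esub> (r \<odot>\<^bsub>M\<^esub> (b \<oplus>\<^bsub>M\<^esub> x)) = B +>\<^bsub>M\<^esub> (r \<odot>\<^bsub>M\<^esub> x)" if b: "b \<in> B" for b
    proof -
      have "r \<odot>\<^bsub>M\<^esub> (b \<oplus>\<^bsub>M\<^esub> x) \<ominus>\<^bsub>M\<^esub> r \<odot>\<^bsub>M\<^esub> x = r \<odot>\<^bsub>M\<^esub> b"
        using r x Bc[OF b] by (simp add: smult_r_distr a_minus_def M.a_assoc M.r_neg)
      moreover have "r \<odot>\<^bsub>M\<^esub> b \<in> B" using r b B by (simp add: submodule_iff)
      ultimately show ?thesis using coset_eq[OF B] r x Bc[OF b] by simp
    qed
    then show ?thesis using B0 by (auto simp: quotient_module_def a_r_coset_def')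
  qed
qed

lemma quotient_module:
  assumes B: "submodule B R M"
  shows "module R (quotient_module M B)"
proof -
  note q = quotient_module_simps[OF B]
  show ?thesis
  proof (rule moduleI)
    show "abelian_group (quotient_module M B)"
    proof (rule abelian_groupI)
      fix X assume "X \<in> carrier (quotient_module M B)"
      then obtain x where x: "x \<in> carrier M" "X = B +>\<^bsub>M\<^esub> x" unfolding q(1) by blast
      have "(B +>\<^bsub>M\<^esub> (\<ominus>\<^bsub>M\<^esub> x)) \<oplus>\<^bsub>quotient_module M B\<^esub> X = \<zero>\<^bsub>quotient_module M B\<^esub>"
        using x q(2,3) by (simp add: M.l_neg)
      then show "\<exists>Y\<in>carrier (quotient_module M B). Y \<oplus>\<^bsub>quotient_module M B\<^esub> X = \<zero>\<^bsub>quotient_module M B\<^esub>"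
        using x unfolding q(1) by blast
    qed (auto simp: q M.a_ac)
  qed (auto simp: q R.is_cring smult_l_distr smult_r_distr smult_assoc1)
qed

text \<open>The graph of the projection serves in both directions, once as a relation from cosets to
  elements and once reversed.\<close>

lemma cc_quotient_iff:
  assumes B: "submodule B R M"
  shows "cc asc R (quotient_module M B) {\<zero>\<^bsub>quotient_module M B\<^esub>} (carrier (quotient_module M B)) \<longleftrightarrow>
    cc asc R M B (carrier M)"
proof -
  let ?Q = "quotient_module M B"
  interpret Q: module R ?Q by (rule quotient_module[OF B])
  note q = quotient_module_simps[OF B]
  have Bc: "B \<subseteq> carrier M" using B by (auto simp: submodule_iff)
  have ker: "B +>\<^bsub>M\<^esub> x = \<zero>\<^bsub>?Q\<^esub> \<longleftrightarrow> x \<in> B" if "x \<in> carrier M" for x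
    unfolding q(2) using coset_eq[OF B that M.zero_closed] that by (simp add: a_minus_def minus_zero)
  show ?thesis
  proof
    assume c: "cc asc R ?Q {\<zero>\<^bsub>?Q\<^esub>} (carrier ?Q)"
    show "cc asc R M B (carrier M)"
      by (rule cc_linear[OF Q.module_axioms module_axioms Q.submodule_zero Q.carrier_is_submodule _
            carrier_is_submodule c, where \<rho> = "\<lambda>X x. X = B +>\<^bsub>M\<^esub> x"])
        (use q ker in auto)
  next
    assume c: "cc asc R M B (carrier M)"
    show "cc asc R ?Q {\<zero>\<^bsub>?Q\<^esub>} (carrier ?Q)"
      by (rule cc_linear[OF module_axioms Q.module_axioms B carrier_is_submodule Bc
            Q.carrier_is_submodule c, where \<rho> = "\<lambda>x X. X = B +>\<^bsub>M\<^esub> x"])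
        (simp_all add: q image_iff subsetD[OF Bc] ker[unfolded q(2)])
  qed
qed

text \<open>Here the quotient construction is left behind: with \<open>Z\<close> the cocycles and
  \<open>B\<close> the coboundaries, finite generation of Ext becomes a chain condition inside the
  cochain module.\<close>

lemma fg_subquotient_iff:
  assumes noeth: "noetherian_ring R" and Z: "submodule Z R M" and B: "submodule B R M" and BZ: "B \<subseteq> Z"
  shows "finitely_generated_module R (quotient_module (M\<lparr>carrier := Z\<rparr>) B) \<longleftrightarrow> cc True R M B Z"
proof -
  let ?N = "M\<lparr>carrier := Z\<rparr>"
  interpret N: module R ?N by (rule submodule.submodule_is_module[OF Z module_axioms])
  have sub: "submodule H R ?N \<longleftrightarrow> submodule H R M \<and> H \<subseteq> Z" for H
    using Z by (auto simp: N.submodule_iff submodule_iff)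
  have BN: "submodule B R ?N" using B BZ sub by simp
  interpret Q: module R "quotient_module ?N B" by (rule N.quotient_module[OF BN])
  have "interval R ?N B Z = interval R M B Z" by (auto simp: interval_def sub)
  then show ?thesis
    unfolding Q.fg_iff_cc[OF noeth] N.cc_quotient_iff[OF BN] by simp
qed

end

section \<open>Free modules and modules of homomorphisms\<close>

lemma hom_module_carrier:
  "f \<in> carrier (hom_module R F M) \<longleftrightarrow> f \<in> mod_hom R F M \<and> f \<in> extensional (carrier F)"
  by (simp add: hom_module_def)

lemma hom_module_simps:
  "x \<in> carrier F \<Longrightarrow> (f \<oplus>\<^bsub>hom_module R F M\<^esub> g) x = f x \<oplus>\<^bsub>M\<^esub> g x"
  "x \<in> carrier F \<Longrightarrow> (r \<odot>\<^bsub>hom_module R F M\<^esub> f) x = r \<odot>\<^bsub>M\<^esub> f x"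
  "x \<in> carrier F \<Longrightarrow> \<zero>\<^bsub>hom_module R F M\<^esub> x = \<zero>\<^bsub>M\<^esub>"
  "f \<oplus>\<^bsub>hom_module R F M\<^esub> g \<in> extensional (carrier F)"
  "r \<odot>\<^bsub>hom_module R F M\<^esub> f \<in> extensional (carrier F)"
  "\<zero>\<^bsub>hom_module R F M\<^esub> \<in> extensional (carrier F)"
  by (simp_all add: hom_module_def)

lemma restrict_mod_hom:
  assumes "module R F" "f \<in> mod_hom R F M"
  shows "restrict f (carrier F) \<in> carrier (hom_module R F M)"
proof -
  interpret F: module R F by fact
  show ?thesis
    unfolding hom_module_carrier using mod_homD[OF assms(2)] by (auto intro!: mod_homI)
qed

lemma mod_hom_compose:
  "f \<in> mod_hom R L M \<Longrightarrow> g \<in> mod_hom R M N \<Longrightarrow> (\<lambda>x. g (f x)) \<in> mod_hom R L N"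
  by (rule mod_homI) (simp_all add: mod_homD)

lemma hom_module:
  assumes "module R F" "module R M"
  shows "module R (hom_module R F M)"
proof -
  interpret F: module R F by fact
  interpret M: module R M by fact
  let ?H = "hom_module R F M"
  note ext = hom_module_simps(4-6)
  have mh: "f \<in> mod_hom R F M" and E: "f \<in> extensional (carrier F)" if "f \<in> carrier ?H" for f
    using that by (simp_all add: hom_module_carrier)
  note D = mod_homD(1)[OF mh] and hom = mod_homD(2,3)[OF mh]
  have add: "f \<oplus>\<^bsub>?H\<^esub> g \<in> carrier ?H" if "f \<in> carrier ?H" "g \<in> carrier ?H" for f g
    unfolding hom_module_carrier using that
    by (auto intro!: mod_homI simp: ext hom_module_simps(1-3) D hom M.M.a_ac M.smult_r_distr)
  have smult: "r \<odot>\<^bsub>?H\<^esub> f \<in> carrier ?H" if "r \<in> carrier R" "f \<in> carrier ?H" for r f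
    unfolding hom_module_carrier using that
    by (auto intro!: mod_homI simp: ext hom_module_simps(1-3) D hom M.smult_r_distr M.smult_comm)
  have zero: "\<zero>\<^bsub>?H\<^esub> \<in> carrier ?H"
    unfolding hom_module_carrier by (auto intro!: mod_homI simp: ext hom_module_simps(1-3))
  show ?thesis
  proof (rule moduleI)
    show "abelian_group ?H"
    proof (rule abelian_groupI)
      fix f assume f: "f \<in> carrier ?H"
      have "((\<ominus>\<^bsub>R\<^esub> \<one>\<^bsub>R\<^esub>) \<odot>\<^bsub>?H\<^esub> f) \<oplus>\<^bsub>?H\<^esub> f = \<zero>\<^bsub>?H\<^esub>"
        by (rule extensionalityI[where A = "carrier F"])
          (use f in \<open>simp_all add: ext hom_module_simps(1-3) D M.smult_l_minus M.M.l_neg\<close>)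
      then show "\<exists>g\<in>carrier ?H. g \<oplus>\<^bsub>?H\<^esub> f = \<zero>\<^bsub>?H\<^esub>" using smult[OF _ f, of "\<ominus>\<^bsub>R\<^esub> \<one>\<^bsub>R\<^esub>"] by auto
    qed (auto intro!: extensionalityI[where A = "carrier F"] add zero simp: ext E hom_module_simps(1-3) D M.M.a_ac)
  qed (auto intro!: extensionalityI[where A = "carrier F"] smult
      simp: F.R.is_cring ext E hom_module_simps(1-3) D M.smult_l_distr M.smult_r_distr M.smult_assoc1)
qed

lemma (in cring) free_module: "module R (free_module R n)"
proof (rule moduleI)
  let ?F = "free_module R n"
  show "abelian_group ?F"
  proof (rule abelian_groupI)
    fix x assume x: "x \<in> carrier ?F"
    have "(\<lambda>i\<in>{..<n}. \<ominus> x i) \<oplus>\<^bsub>?F\<^esub> x = \<zero>\<^bsub>?F\<^esub>"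
      using x by (auto simp: free_module_def l_neg PiE_iff intro!: restrict_ext)
    then show "\<exists>y\<in>carrier ?F. y \<oplus>\<^bsub>?F\<^esub> x = \<zero>\<^bsub>?F\<^esub>"
      using x by (intro bexI[of _ "\<lambda>i\<in>{..<n}. \<ominus> x i"]) (auto simp: free_module_def PiE_iff)
  qed (auto simp: free_module_def PiE_iff a_ac extensional_def fun_eq_iff)
qed (auto simp: free_module_def PiE_iff extensional_def fun_eq_iff is_cring l_distr r_distr m_assoc)

text \<open>The linear combination with coefficients \<open>x\<close> of the first \<open>k\<close>
  vectors \<open>v\<close>; recursion on the number of terms matches the inductions in which it is
  used.\<close>

primrec lc :: "('a, 'm, 'y) module_scheme \<Rightarrow> (nat \<Rightarrow> 'm) \<Rightarrow> nat \<Rightarrow> (nat \<Rightarrow> 'a) \<Rightarrow> 'm" where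
  "lc M v 0 x = \<zero>\<^bsub>M\<^esub>"
| "lc M v (Suc k) x = lc M v k x \<oplus>\<^bsub>M\<^esub> x k \<odot>\<^bsub>M\<^esub> v k"

definition free_basis :: "('a, 'x) ring_scheme \<Rightarrow> nat \<Rightarrow> nat \<Rightarrow> nat \<Rightarrow> 'a" where
  "free_basis R n j = (\<lambda>i\<in>{..<n}. if i = j then \<one>\<^bsub>R\<^esub> else \<zero>\<^bsub>R\<^esub>)"

lemma (in cring) free_basis_closed: "free_basis R n j \<in> carrier (free_module R n)"
  by (auto simp: free_basis_def free_module_def)

context module
begin

lemma lc_submodule:
  assumes "submodule S R M" "\<And>i. i < k \<Longrightarrow> v i \<in> S" "\<And>i. i < k \<Longrightarrow> x i \<in> carrier R"
  shows "lc M v k x \<in> S"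
  using assms(2,3)
proof (induction k)
  case 0 then show ?case using assms(1) by (simp add: submodule_iff)
next
  case (Suc k)
  then have "lc M v k x \<in> S" "x k \<odot>\<^bsub>M\<^esub> v k \<in> S" using assms(1) by (auto simp: submodule_iff)
  then show ?case using assms(1) by (auto simp: submodule_iff)
qed

lemmas lc_closed = lc_submodule[OF carrier_is_submodule]

lemma lc_mod_hom:
  assumes v: "\<And>i. i < n \<Longrightarrow> v i \<in> carrier M"
  shows "lc M v n \<in> mod_hom R (free_module R n) M"
proof (rule mod_homI)
  fix x assume x: "x \<in> carrier (free_module R n)"
  then have xc: "x i \<in> carrier R" if "i < n" for i using that by (auto simp: free_module_def)
  show "lc M v n x \<in> carrier M" using lc_closed v xc by blast
  have "lc M v k (r \<odot>\<^bsub>free_module R n\<^esub> x) = r \<odot>\<^bsub>M\<^esub> lc M v k x" if "r \<in> carrier R" "k \<le> n" for r k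
    using that
  proof (induction k)
    case (Suc k)
    have "lc M v k x \<in> carrier M" by (rule lc_closed) (use v xc Suc in auto)
    then show ?case using Suc v xc by (simp add: free_module_def smult_r_distr smult_assoc1)
  qed simp
  then show "lc M v n (r \<odot>\<^bsub>free_module R n\<^esub> x) = r \<odot>\<^bsub>M\<^esub> lc M v n x" if "r \<in> carrier R" for r
    using that by blast
  fix y assume y: "y \<in> carrier (free_module R n)"
  then have yc: "y i \<in> carrier R" if "i < n" for i using that by (auto simp: free_module_def)
  have "lc M v k (x \<oplus>\<^bsub>free_module R n\<^esub> y) = lc M v k x \<oplus>\<^bsub>M\<^esub> lc M v k y" if "k \<le> n" for k
    using that
  proof (induction k)
    case (Suc k)
    have "lc M v k x \<in> carrier M" "lc M v k y \<in> carrier M"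
      by (rule lc_closed; use v xc yc Suc in auto)+
    then show ?case using Suc v xc yc by (simp add: free_module_def smult_l_distr M.a_ac)
  qed simp
  then show "lc M v n (x \<oplus>\<^bsub>free_module R n\<^esub> y) = lc M v n x \<oplus>\<^bsub>M\<^esub> lc M v n y" by blast
qed

lemma lc_basis:
  assumes "\<And>i. i < n \<Longrightarrow> v i \<in> carrier M" "j < n"
  shows "lc M v n (free_basis R n j) = v j"
proof -
  have "lc M v k (free_basis R n j) = (if j < k then v j else \<zero>\<^bsub>M\<^esub>)" if "k \<le> n" for k
    using that
  proof (induction k)
    case (Suc k)
    then show ?case using assms by (auto simp: free_basis_def less_Suc_eq)
  qed simp
  then show ?thesis using assms(2) by auto
qed

end

lemma mod_hom_lc:
  assumes "module R M" "module R N" "f \<in> mod_hom R M N"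
    "\<And>i. i < k \<Longrightarrow> v i \<in> carrier M" "\<And>i. i < k \<Longrightarrow> x i \<in> carrier R"
  shows "f (lc M v k x) = lc N (\<lambda>i. f (v i)) k x"
  using assms(4,5)
proof (induction k)
  case 0 then show ?case using mod_hom_zero[OF assms(1-3)] by simp
next
  case (Suc k)
  interpret M: module R M by fact
  have "lc M v k x \<in> carrier M" by (rule M.lc_closed) (use Suc in auto)
  then show ?case using Suc mod_homD[OF assms(3)] by simp
qed

lemma (in cring) lc_free_basis:
  assumes "x \<in> carrier (free_module R n)"
  shows "lc (free_module R n) (free_basis R n) n x = x"
proof -
  interpret F: module R "free_module R n" by (rule free_module)
  have "lc (free_module R n) (free_basis R n) k x = (\<lambda>i\<in>{..<n}. if i < k then x i else \<zero>)" if "k \<le> n" for k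
    using that
  proof (induction k)
    case 0 then show ?case by (simp add: free_module_def)
  next
    case (Suc k)
    then show ?case using assms
      by (auto simp: free_module_def free_basis_def PiE_iff fun_eq_iff less_Suc_eq)
  qed
  then show ?thesis using assms by (auto simp: free_module_def PiE_iff extensional_def fun_eq_iff)
qed

lemma mod_hom_free:
  assumes "cring R" "module R M" "f \<in> mod_hom R (free_module R n) M" "x \<in> carrier (free_module R n)"
  shows "f x = lc M (\<lambda>i. f (free_basis R n i)) n x"
proof -
  interpret R: cring R by fact
  have "f (lc (free_module R n) (free_basis R n) n x) = lc M (\<lambda>i. f (free_basis R n i)) n x"
    by (rule mod_hom_lc[OF R.free_module assms(2,3) R.free_basis_closed])
      (use assms(4) in \<open>auto simp: free_module_def\<close>)
  then show ?thesis by (simp add: R.lc_free_basis[OF assms(4)])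
qed

text \<open>Projectivity of R^n: preimages \<open>v i\<close> of the images of the basis vectors are
  chosen, and the lift sends \<open>x\<close> to the combination of the \<open>v i\<close> with
  coefficients \<open>x\<close>.\<close>

lemma free_module_lift:
  assumes "cring R" "module R M" "module R N" "f \<in> mod_hom R (free_module R n) N"
    "g \<in> mod_hom R M N" "f ` carrier (free_module R n) \<subseteq> g ` carrier M"
  obtains h where "h \<in> mod_hom R (free_module R n) M"
    "\<And>x. x \<in> carrier (free_module R n) \<Longrightarrow> g (h x) = f x"
proof -
  interpret R: cring R by fact
  interpret M: module R M by fact
  have "\<forall>i. \<exists>m\<in>carrier M. g m = f (free_basis R n i)"
    using assms(6) R.free_basis_closed[of n] by (metis imageE image_subset_iff)
  then obtain v where v: "\<And>i. v i \<in> carrier M" "\<And>i. g (v i) = f (free_basis R n i)" by metis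
  have "g (lc M v n x) = f x" if x: "x \<in> carrier (free_module R n)" for x
  proof -
    have "g (lc M v n x) = lc N (\<lambda>i. g (v i)) n x"
      by (rule mod_hom_lc[OF assms(2,3,5) v(1)]) (use x in \<open>auto simp: free_module_def\<close>)
    then show ?thesis using mod_hom_free[OF assms(1,3,4) x] v(2) by simp
  qed
  then show ?thesis using that M.lc_mod_hom[of n v] v by blast
qed

text \<open>Hom(F, T) as a subset of Hom(F, M). For free \<open>F\<close> the interval above it
  plays the part of Hom(F, M / T), with no passage to cosets.\<close>

definition homs_into ::
  "('a, 'x) ring_scheme \<Rightarrow> ('a, 'n, 'z) module_scheme \<Rightarrow> ('a, 'm, 'y) module_scheme \<Rightarrow> 'm set \<Rightarrow> ('n \<Rightarrow> 'm) set"
  where "homs_into R F M T = {f \<in> carrier (hom_module R F M). \<forall>x\<in>carrier F. f x \<in> T}"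

lemma homs_into_submodule:
  assumes "module R F" "module R M" "submodule T R M"
  shows "submodule (homs_into R F M T) R (hom_module R F M)"
proof -
  interpret M: module R M by fact
  interpret H: module R "hom_module R F M" by (rule hom_module[OF assms(1,2)])
  show ?thesis
    using assms(3) unfolding H.submodule_iff M.submodule_iff
    by (auto simp: homs_into_def hom_module_simps)
qed

text \<open>Evaluation at the basis vectors embeds Hom(F, L) / Hom(F, T) into the n-th power of L /
  T.\<close>

lemma cc_homs_into:
  fixes n :: nat
  assumes "module R M" "submodule T R M" "submodule L R M" "T \<subseteq> L" "cc asc R M T L"
  defines "F \<equiv> free_module R n"
  shows "cc asc R (hom_module R F M) (homs_into R F M T) (homs_into R F M L)"
proof -
  interpret M: module R M by fact
  have F: "module R F" unfolding F_def by (rule M.R.free_module)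
  interpret H: module R "hom_module R F M" by (rule hom_module[OF F assms(1)])
  have b: "free_basis R n i \<in> carrier F" for i unfolding F_def by (rule M.R.free_basis_closed)
  have "submodule {h \<in> homs_into R F M L. \<forall>i\<in>{..<n}. h (free_basis R n i) \<in> T} R (hom_module R F M) \<and>
    cc asc R (hom_module R F M) {h \<in> homs_into R F M L. \<forall>i\<in>{..<n}. h (free_basis R n i) \<in> T} (homs_into R F M L)"
  proof (rule cc_vimage_family[where f = "\<lambda>i h. h (free_basis R n i)", OF _ H.module_axioms assms(1) _
        homs_into_submodule[OF F assms(1,3)] assms(2-4) _ assms(5)])
    show "(\<lambda>h. h (free_basis R n i)) \<in> mod_hom R (hom_module R F M) M" for i
      by (rule mod_homI) (auto simp: hom_module_simps b hom_module_carrier mod_homD)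
  qed (use b in \<open>auto simp: homs_into_def\<close>)
  moreover have "{h \<in> homs_into R F M L. \<forall>i\<in>{..<n}. h (free_basis R n i) \<in> T} = homs_into R F M T"
  proof -
    have "f x \<in> T" if f: "f \<in> mod_hom R F M" "\<forall>i\<in>{..<n}. f (free_basis R n i) \<in> T" and x: "x \<in> carrier F" for f x
      using M.lc_submodule[OF assms(2), of n "\<lambda>i. f (free_basis R n i)" x] x f
        mod_hom_free[OF M.R.is_cring assms(1) f(1)[unfolded F_def] x[unfolded F_def]]
      by (auto simp: F_def free_module_def)
    then show ?thesis using b assms(4) by (auto simp: homs_into_def hom_module_carrier)
  qed
  ultimately show ?thesis by simp
qed

section \<open>Resolutions by free modules of finite rank\<close>

lemma (in module) free_cover:
  assumes "finite A" "A \<subseteq> carrier M" "spanned A S"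
  obtains n f where "f \<in> mod_hom R (free_module R n) M" "f ` carrier (free_module R n) = S"
proof -
  obtain xs where xs: "set xs = A" using finite_list[OF assms(1)] by blast
  define n where "n = length xs"
  have v: "xs ! i \<in> carrier M" "xs ! i \<in> A" if "i < n" for i
    using that xs assms(2) n_def nth_mem by blast+
  define f where "f = lc M (\<lambda>i. xs ! i) n"
  interpret F: module R "free_module R n" by (rule R.free_module)
  have f: "f \<in> mod_hom R (free_module R n) M" unfolding f_def by (rule lc_mod_hom) (rule v)
  have S: "submodule S R M" "A \<subseteq> S" "\<And>H. submodule H R M \<Longrightarrow> A \<subseteq> H \<Longrightarrow> S \<subseteq> H"
    using assms(3) by (auto simp: spanned_def)
  have "f x \<in> S" if "x \<in> carrier (free_module R n)" for x
    unfolding f_def by (rule lc_submodule[OF S(1)]) (use v S that in \<open>auto simp: free_module_def\<close>)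
  moreover have "A \<subseteq> f ` carrier (free_module R n)"
  proof
    fix a assume "a \<in> A"
    then obtain i where i: "i < n" "a = xs ! i" using xs unfolding n_def by (metis in_set_conv_nth)
    then have "f (free_basis R n i) = a" unfolding f_def using lc_basis[of n "\<lambda>i. xs ! i" i] v by simp
    then show "a \<in> f ` carrier (free_module R n)" using R.free_basis_closed by blast
  qed
  then have "S \<subseteq> f ` carrier (free_module R n)"
    using S(3) mod_hom_image_submodule[OF F.module_axioms module_axioms f F.carrier_is_submodule] by blast
  ultimately have "f ` carrier (free_module R n) = S" by blast
  then show ?thesis using that f by blast
qed

text \<open>The basis spans, and finite spans are noetherian. This makes all kernels met in a
  resolution finitely generated.\<close>

lemma free_module_acc:
  assumes "cring R" "noetherian_ring R"
  shows "cc True R (free_module R n) {\<zero>\<^bsub>free_module R n\<^esub>} (carrier (free_module R n))"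
proof -
  interpret R: cring R by fact
  interpret F: module R "free_module R n" by (rule R.free_module)
  let ?A = "free_basis R n ` {..<n}"
  have A: "finite ?A" "?A \<subseteq> carrier (free_module R n)" using R.free_basis_closed by auto
  have "F.spanned ?A (carrier (free_module R n))"
    unfolding F.spanned_def
  proof (intro conjI allI impI subsetI)
    fix H x assume H: "submodule H R (free_module R n)" "?A \<subseteq> H" and x: "x \<in> carrier (free_module R n)"
    have "lc (free_module R n) (free_basis R n) n x \<in> H"
      by (rule F.lc_submodule[OF H(1)]) (use H(2) x in \<open>auto simp: free_module_def\<close>)
    then show "x \<in> H" using R.lc_free_basis[OF x] by simp
  qed (use A F.carrier_is_submodule in auto)
  then show ?thesis using F.fg_iff_cc[OF assms(2)] F.fg_iff_spanned A by blast
qed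

lemma (in module) module_ker_submodule:
  assumes "module R N" "f \<in> mod_hom R M N"
  shows "submodule (module_ker M N f) R M"
proof -
  interpret N: module R N by fact
  show ?thesis
    unfolding submodule_iff module_ker_def
    using mod_homD[OF assms(2)] mod_hom_zero[OF module_axioms assms] by auto
qed

text \<open>Every kernel is a submodule of a noetherian free module and so the image of another free
  module of finite rank; dependent choice strings these covers together.\<close>

lemma (in module) free_resolution_exists:
  assumes noeth: "noetherian_ring R" and fg: "finitely_generated_module R M"
  shows "\<exists>n d e. free_resolution R M n d e"
proof -
  obtain A where A: "finite A" "A \<subseteq> carrier M" "spanned A (carrier M)"
    using fg unfolding fg_iff_spanned by blast
  obtain n0 e where e: "e \<in> mod_hom R (free_module R n0) M" "e ` carrier (free_module R n0) = carrier M"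
    by (rule free_cover[OF A])
  have cover: "\<exists>k f. f \<in> mod_hom R (free_module R k) (free_module R m) \<and> f ` carrier (free_module R k) = S"
    if S: "submodule S R (free_module R m)" for m S
  proof -
    interpret F: module R "free_module R m" by (rule R.free_module)
    have Sc: "S \<subseteq> carrier (free_module R m)" using S by (simp add: F.submodule_iff)
    have "cc True R (free_module R m) {\<zero>\<^bsub>free_module R m\<^esub>} S"
      by (rule cc_subinterval[OF free_module_acc[OF R.is_cring noeth] _ Sc]) simp
    then obtain A where A: "finite A" "A \<subseteq> S" "F.spanned A S" by (rule F.submodule_fg[OF _ S])
    show ?thesis
      by (rule F.free_cover[OF A(1) _ A(3)]) (use A(2) Sc in blast)+
  qed
  \<comment> \<open>A state (m, k, f) stands for a map \<open>f\<close> from R^k to R^m.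
    \<open>P\<close> ties stage 0 to the augmentation, and \<open>Q\<close> makes consecutive maps
    composable and exact.\<close>
  define P where "P i s = (case s of (m, k, f) \<Rightarrow> f \<in> mod_hom R (free_module R k) (free_module R m) \<and>
    (i = 0 \<longrightarrow> m = n0 \<and> f ` carrier (free_module R k) = module_ker (free_module R n0) M e))"
    for i :: nat and s :: "nat \<times> nat \<times> ((nat \<Rightarrow> 'a) \<Rightarrow> (nat \<Rightarrow> 'a))"
  define Q where "Q s t = (case s of (m, k, f) \<Rightarrow> case t of (m', k', f') \<Rightarrow> m' = k \<and>
    f' ` carrier (free_module R k') = module_ker (free_module R k) (free_module R m) f)"
    for s t :: "nat \<times> nat \<times> ((nat \<Rightarrow> 'a) \<Rightarrow> (nat \<Rightarrow> 'a))"
  have "\<exists>s. P 0 s"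
  proof -
    interpret F: module R "free_module R n0" by (rule R.free_module)
    obtain k f where "f \<in> mod_hom R (free_module R k) (free_module R n0)"
      "f ` carrier (free_module R k) = module_ker (free_module R n0) M e"
      using cover[OF F.module_ker_submodule[OF module_axioms e(1)]] by blast
    then have "P 0 (n0, k, f)" by (simp add: P_def)
    then show ?thesis by blast
  qed
  moreover have "\<exists>t. P (Suc i) t \<and> Q s t" if "P i s" for i s
  proof -
    obtain m k f where s: "s = (m, k, f)" by (cases s)
    then have f: "f \<in> mod_hom R (free_module R k) (free_module R m)" using that by (simp add: P_def)
    interpret F: module R "free_module R k" by (rule R.free_module)
    obtain k' f' where "f' \<in> mod_hom R (free_module R k') (free_module R k)"
      "f' ` carrier (free_module R k') = module_ker (free_module R k) (free_module R m) f"
      using cover[OF F.module_ker_submodule[OF R.free_module f]] by blast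
    then have "P (Suc i) (k, k', f') \<and> Q s (k, k', f')" by (simp add: P_def Q_def s)
    then show ?thesis by blast
  qed
  ultimately have "\<exists>s. \<forall>i. P i (s i) \<and> Q (s i) (s (Suc i))" by (rule dependent_nat_choice)
  then obtain s where s: "\<And>i. P i (s i)" "\<And>i. Q (s i) (s (Suc i))" by blast
  define n where "n i = fst (s i)" for i
  define d where "d i = snd (snd (s i))" for i
  have k: "fst (snd (s i)) = n (Suc i)" for i
    using s(2)[of i] by (auto simp: Q_def n_def split: prod.splits)
  have s': "s i = (n i, n (Suc i), d i)" for i using k[of i] by (simp add: n_def d_def prod_eq_iff)
  have "n 0 = n0" using s(1)[of 0] by (simp add: P_def s')
  have "free_resolution R M n d e"
    unfolding free_resolution_def
    using e s(1)[of 0] s(1) s(2) \<open>n 0 = n0\<close> by (simp add: P_def Q_def s')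
  then show ?thesis by blast
qed

section \<open>The complex computing Ext\<close>

text \<open>The arguments run for an arbitrary resolution; the one selected inside
  \<open>Ext\<close> is substituted only at the end.\<close>

locale resolved_module = N: module R N for R (structure) and N :: "('a, 'n, 'z) module_scheme" +
  fixes n :: "nat \<Rightarrow> nat" and d :: "nat \<Rightarrow> (nat \<Rightarrow> 'a) \<Rightarrow> (nat \<Rightarrow> 'a)" and e :: "(nat \<Rightarrow> 'a) \<Rightarrow> 'n"
  assumes res: "free_resolution R N n d e"
begin

abbreviation F :: "nat \<Rightarrow> ('a, nat \<Rightarrow> 'a) module" where "F i \<equiv> free_module R (n i)"
abbreviation C :: "nat \<Rightarrow> ('a, 'm, 'y) module_scheme \<Rightarrow> ('a, (nat \<Rightarrow> 'a) \<Rightarrow> 'm) module"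
  where "C i M \<equiv> hom_module R (F i) M"
abbreviation Z :: "nat \<Rightarrow> ('a, 'm, 'y) module_scheme \<Rightarrow> ((nat \<Rightarrow> 'a) \<Rightarrow> 'm) set"
  where "Z i M \<equiv> ext_cocycles R n d i M"
abbreviation B :: "nat \<Rightarrow> ('a, 'm, 'y) module_scheme \<Rightarrow> ((nat \<Rightarrow> 'a) \<Rightarrow> 'm) set"
  where "B i M \<equiv> ext_coboundaries R n d i M"
abbreviation \<delta> :: "nat \<Rightarrow> ((nat \<Rightarrow> 'a) \<Rightarrow> 'm) \<Rightarrow> ((nat \<Rightarrow> 'a) \<Rightarrow> 'm)"
  where "\<delta> i \<equiv> coboundary_map R n d i"

lemma F: "module R (F i)"
  by (rule N.R.free_module)

lemma resD:
  shows e_hom: "e \<in> mod_hom R (F 0) N"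
    and e_surj: "e ` carrier (F 0) = carrier N"
    and d_hom: "d i \<in> mod_hom R (F (Suc i)) (F i)"
    and d_0: "d 0 ` carrier (F (Suc 0)) = module_ker (F 0) N e"
    and d_Suc: "d (Suc i) ` carrier (F (Suc (Suc i))) = module_ker (F (Suc i)) (F i) (d i)"
  using res unfolding free_resolution_def by simp_all

lemma d_closed: "x \<in> carrier (F (Suc i)) \<Longrightarrow> d i x \<in> carrier (F i)"
  by (rule mod_homD(1)[OF d_hom])

lemma d_d: "x \<in> carrier (F (Suc (Suc i))) \<Longrightarrow> d i (d (Suc i) x) = \<zero>\<^bsub>F i\<^esub>"
  using d_Suc[of i] by (auto simp: module_ker_def)

lemma \<delta>_apply: "x \<in> carrier (F (Suc i)) \<Longrightarrow> \<delta> i f x = f (d i x)"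
  by (simp add: coboundary_map_def)

lemma C: "module R M \<Longrightarrow> module R (C i M)"
  by (rule hom_module[OF F])

lemma CD:
  assumes "f \<in> carrier (C i M)"
  shows "x \<in> carrier (F i) \<Longrightarrow> f x \<in> carrier M" and "f \<in> mod_hom R (F i) M"
    and "f \<in> extensional (carrier (F i))"
proof -
  show f: "f \<in> mod_hom R (F i) M" "f \<in> extensional (carrier (F i))"
    using assms by (auto simp: hom_module_carrier)
  show "f x \<in> carrier M" if "x \<in> carrier (F i)" by (rule mod_homD(1)[OF f(1) that])
qed

lemma C_eqI:
  assumes "f \<in> carrier (C i M)" "g \<in> carrier (C i M)" "\<And>x. x \<in> carrier (F i) \<Longrightarrow> f x = g x"
  shows "f = g"
  using CD(3)[OF assms(1)] CD(3)[OF assms(2)] assms(3) by (rule extensionalityI)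

lemma \<delta>_closed: "f \<in> carrier (C i M) \<Longrightarrow> \<delta> i f \<in> carrier (C (Suc i) M)"
  unfolding coboundary_map_def
  by (rule restrict_mod_hom[OF F]) (rule mod_hom_compose[OF d_hom CD(2)])

lemma \<delta>_hom:
  assumes "module R M"
  shows "\<delta> i \<in> mod_hom R (C i M) (C (Suc i) M)"
proof -
  interpret Ci: module R "C i M" by (rule C[OF assms])
  interpret Cs: module R "C (Suc i) M" by (rule C[OF assms])
  show ?thesis
  proof (rule mod_homI)
    fix f g assume "f \<in> carrier (C i M)" "g \<in> carrier (C i M)"
    then show "\<delta> i (f \<oplus>\<^bsub>C i M\<^esub> g) = \<delta> i f \<oplus>\<^bsub>C (Suc i) M\<^esub> \<delta> i g"
      by (intro C_eqI[of _ "Suc i" M]) (simp_all add: \<delta>_closed \<delta>_apply hom_module_simps d_closed)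
  next
    fix r f assume "r \<in> carrier R" "f \<in> carrier (C i M)"
    then show "\<delta> i (r \<odot>\<^bsub>C i M\<^esub> f) = r \<odot>\<^bsub>C (Suc i) M\<^esub> \<delta> i f"
      by (intro C_eqI[of _ "Suc i" M]) (simp_all add: \<delta>_closed \<delta>_apply hom_module_simps d_closed)
  qed (rule \<delta>_closed)
qed

lemma \<delta>_\<delta>:
  assumes "module R M" "f \<in> carrier (C i M)"
  shows "\<delta> (Suc i) (\<delta> i f) = \<zero>\<^bsub>C (Suc (Suc i)) M\<^esub>"
proof -
  interpret Cs: module R "C (Suc (Suc i)) M" by (rule C[OF assms(1)])
  show ?thesis
    by (rule C_eqI[of _ "Suc (Suc i)" M])
      (use assms in \<open>simp_all add: \<delta>_closed \<delta>_apply hom_module_simps d_closed d_d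
        mod_hom_zero[OF F assms(1) CD(2)]\<close>)
qed

lemma Z_iff: "f \<in> Z i M \<longleftrightarrow> f \<in> carrier (C i M) \<and> \<delta> i f = \<zero>\<^bsub>C (Suc i) M\<^esub>"
  by (simp add: ext_cocycles_def module_ker_def)

lemma Z_apply: "f \<in> Z i M \<Longrightarrow> x \<in> carrier (F (Suc i)) \<Longrightarrow> f (d i x) = \<zero>\<^bsub>M\<^esub>"
  by (metis Z_iff \<delta>_apply hom_module_simps(3))

lemma Z_I:
  assumes "module R M" "f \<in> carrier (C i M)" "\<And>x. x \<in> carrier (F (Suc i)) \<Longrightarrow> f (d i x) = \<zero>\<^bsub>M\<^esub>"
  shows "f \<in> Z i M"
proof -
  interpret Cs: module R "C (Suc i) M" by (rule C[OF assms(1)])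
  have "\<delta> i f = \<zero>\<^bsub>C (Suc i) M\<^esub>"
    by (rule C_eqI[of _ "Suc i" M]) (use assms in \<open>simp_all add: \<delta>_closed \<delta>_apply hom_module_simps\<close>)
  then show ?thesis using assms by (simp add: Z_iff)
qed

lemma Z_submodule: "module R M \<Longrightarrow> submodule (Z i M) R (C i M)"
  unfolding ext_cocycles_def by (rule module.module_ker_submodule[OF C C \<delta>_hom])

lemma B_submodule:
  assumes "module R M"
  shows "submodule (B i M) R (C i M)"
proof (cases i)
  case 0
  then show ?thesis using module.submodule_zero[OF C[OF assms]] by simp
next
  case (Suc j)
  then show ?thesis
    using mod_hom_image_submodule[OF C[OF assms] C[OF assms] \<delta>_hom[OF assms]
        module.carrier_is_submodule[OF C[OF assms]]] by simp
qed

lemma B_Z: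
  assumes "module R M"
  shows "B i M \<subseteq> Z i M"
proof (cases i)
  case 0
  interpret Cz: module R "C 0 M" by (rule C[OF assms])
  show ?thesis using module.submodule_iff[OF C[OF assms]] Z_submodule[OF assms, of i] 0 by auto
next
  case (Suc j)
  then show ?thesis using \<delta>_\<delta>[OF assms] \<delta>_closed by (auto simp: Z_iff)
qed

lemma ext_fg_iff:
  assumes "module R M" "noetherian_ring R"
  shows "finitely_generated_module R (ext_of_resolution R n d i M) \<longleftrightarrow> cc True R (C i M) (B i M) (Z i M)"
  unfolding ext_of_resolution_def
  by (rule module.fg_subquotient_iff[OF C[OF assms(1)] assms(2) Z_submodule[OF assms(1)]
        B_submodule[OF assms(1)] B_Z[OF assms(1)]])

text \<open>Multiplication by \<open>r\<close> on the resolution is null-homotopic. With \<open>s\<close> the homotopy, \<open>h\<close>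
  below is \<open>s \<circ> d (i - 1)\<close>.\<close>

lemma annihilator_homotopy:
  assumes M: "module R M" and r: "r \<in> carrier R" "\<And>y. y \<in> carrier N \<Longrightarrow> r \<odot>\<^bsub>N\<^esub> y = \<zero>\<^bsub>N\<^esub>"
  shows "\<exists>h \<in> mod_hom R (F i) (F i).
    (\<forall>x\<in>carrier (F i). r \<odot>\<^bsub>F i\<^esub> x \<ominus>\<^bsub>F i\<^esub> h x \<in> d i ` carrier (F (Suc i))) \<and>
    (\<forall>y\<in>carrier (F (Suc i)). h (d i y) = \<zero>\<^bsub>F i\<^esub>) \<and>
    (\<forall>z\<in>carrier (C i M). (\<lambda>x\<in>carrier (F i). z (h x)) \<in> B i M)"
proof (induction i)
  case 0
  interpret F0: module R "F 0" by (rule F)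
  interpret M: module R M by fact
  \<comment> \<open>In degree 0 there is no earlier map and h = 0. What remains is that
    \<open>r\<close> carries F 0 into the kernel of \<open>e\<close>, because \<open>r\<close> kills
    \<open>N\<close>, and this kernel is the image of d 0.\<close>
  have "r \<odot>\<^bsub>F 0\<^esub> x \<in> d 0 ` carrier (F (Suc 0))" if "x \<in> carrier (F 0)" for x
    unfolding d_0 module_ker_def using that r mod_homD(1,3)[OF e_hom] by simp
  moreover have "(\<lambda>x. \<zero>\<^bsub>F 0\<^esub>) \<in> mod_hom R (F 0) (F 0)" by (intro mod_homI) auto
  moreover have "(\<lambda>x\<in>carrier (F 0). z \<zero>\<^bsub>F 0\<^esub>) \<in> B 0 M" if "z \<in> carrier (C 0 M)" for z
    using mod_hom_zero[OF F M CD(2)[OF that]] by (simp add: hom_module_def)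
  ultimately show ?case using r(1)
    by (intro bexI[of _ "\<lambda>x. \<zero>\<^bsub>F 0\<^esub>"]) (auto simp: a_minus_def F0.minus_zero)
next
  case (Suc i)
  interpret Fi: module R "F i" by (rule F)
  interpret Fs: module R "F (Suc i)" by (rule F)
  obtain h where h: "h \<in> mod_hom R (F i) (F i)"
    "\<And>x. x \<in> carrier (F i) \<Longrightarrow> r \<odot>\<^bsub>F i\<^esub> x \<ominus>\<^bsub>F i\<^esub> h x \<in> d i ` carrier (F (Suc i))"
    "\<And>y. y \<in> carrier (F (Suc i)) \<Longrightarrow> h (d i y) = \<zero>\<^bsub>F i\<^esub>"
    using Suc by auto
  have "(\<lambda>x. r \<odot>\<^bsub>F i\<^esub> x \<ominus>\<^bsub>F i\<^esub> h x) \<in> mod_hom R (F i) (F i)"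
  proof (rule mod_homI)
    fix x y assume xy: "x \<in> carrier (F i)" "y \<in> carrier (F i)"
    then have "h x \<in> carrier (F i)" "h y \<in> carrier (F i)" using mod_homD(1)[OF h(1)] by auto
    then show "r \<odot>\<^bsub>F i\<^esub> (x \<oplus>\<^bsub>F i\<^esub> y) \<ominus>\<^bsub>F i\<^esub> h (x \<oplus>\<^bsub>F i\<^esub> y) =
        (r \<odot>\<^bsub>F i\<^esub> x \<ominus>\<^bsub>F i\<^esub> h x) \<oplus>\<^bsub>F i\<^esub> (r \<odot>\<^bsub>F i\<^esub> y \<ominus>\<^bsub>F i\<^esub> h y)"
      using xy r(1) mod_homD(2)[OF h(1) xy]
      by (simp add: a_minus_def Fi.smult_r_distr Fi.M.minus_add Fi.M.a_ac)
  next
    fix s x assume sx: "s \<in> carrier R" "x \<in> carrier (F i)"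
    then have "h x \<in> carrier (F i)" using mod_homD(1)[OF h(1)] by auto
    then show "r \<odot>\<^bsub>F i\<^esub> (s \<odot>\<^bsub>F i\<^esub> x) \<ominus>\<^bsub>F i\<^esub> h (s \<odot>\<^bsub>F i\<^esub> x) = s \<odot>\<^bsub>F i\<^esub> (r \<odot>\<^bsub>F i\<^esub> x \<ominus>\<^bsub>F i\<^esub> h x)"
      using sx r(1) mod_homD(3)[OF h(1) sx] Fi.smult_comm[OF r(1) sx]
      by (simp add: Fi.smult_minus)
  qed (use r(1) mod_homD(1)[OF h(1)] in simp)
  \<comment> \<open>The image of r - h lies in that of d i, so the map factors through d i because F
    i is free. This \<open>s\<close> is the next component of the homotopy.\<close>
  then obtain s where s: "s \<in> mod_hom R (F i) (F (Suc i))"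
    "\<And>x. x \<in> carrier (F i) \<Longrightarrow> d i (s x) = r \<odot>\<^bsub>F i\<^esub> x \<ominus>\<^bsub>F i\<^esub> h x"
    by (rule free_module_lift[OF N.R.is_cring F F _ d_hom]) (use h(2) in blast)+
  let ?h = "\<lambda>y. s (d i y)"
  have "?h \<in> mod_hom R (F (Suc i)) (F (Suc i))" by (rule mod_hom_compose[OF d_hom s(1)])
  moreover have "r \<odot>\<^bsub>F (Suc i)\<^esub> y \<ominus>\<^bsub>F (Suc i)\<^esub> ?h y \<in> d (Suc i) ` carrier (F (Suc (Suc i)))"
    if y: "y \<in> carrier (F (Suc i))" for y
  proof -
    have c: "?h y \<in> carrier (F (Suc i))" "d i y \<in> carrier (F i)"
      using y d_closed mod_homD(1)[OF s(1)] by auto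
    \<comment> \<open>By the choice of \<open>s\<close> this difference equals h (d i y), which
      vanishes; this is why the induction carries the clause that \<open>h\<close> kills the image
      of d i.\<close>
    have "d i (r \<odot>\<^bsub>F (Suc i)\<^esub> y \<ominus>\<^bsub>F (Suc i)\<^esub> ?h y) = r \<odot>\<^bsub>F i\<^esub> d i y \<ominus>\<^bsub>F i\<^esub> d i (?h y)"
      using mod_hom_minus[OF F F d_hom] mod_homD(3)[OF d_hom] r(1) y c by simp
    also have "\<dots> = \<zero>\<^bsub>F i\<^esub>"
      using s(2)[OF c(2)] h(3)[OF y] c r(1) by (simp add: a_minus_def Fi.minus_zero Fi.M.r_neg)
    finally show ?thesis unfolding d_Suc module_ker_def using y c r(1) by simp
  qed
  moreover have "?h (d (Suc i) y) = \<zero>\<^bsub>F (Suc i)\<^esub>" if "y \<in> carrier (F (Suc (Suc i)))" for y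
    using d_d[OF that] mod_hom_zero[OF F F s(1)] by simp
  moreover have "(\<lambda>x\<in>carrier (F (Suc i)). z (?h x)) \<in> B (Suc i) M" if z: "z \<in> carrier (C (Suc i) M)" for z
  proof -
    have zs: "restrict (\<lambda>x. z (s x)) (carrier (F i)) \<in> carrier (C i M)"
      by (rule restrict_mod_hom[OF F mod_hom_compose[OF s(1) CD(2)[OF z]]])
    \<comment> \<open>Since the new map is \<open>s\<close> after d i, composing \<open>z\<close>
      with it gives the coboundary of \<open>z\<close> after \<open>s\<close>.\<close>
    have "(\<lambda>x\<in>carrier (F (Suc i)). z (?h x)) = \<delta> i (restrict (\<lambda>x. z (s x)) (carrier (F i)))"
      by (auto simp: coboundary_map_def d_closed intro!: restrict_ext)
    then show ?thesis using zs by simp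
  qed
  ultimately show ?case by (intro bexI[of _ ?h] conjI ballI)
qed

text \<open>r x - h x lies in the image of d i, on which a cocycle vanishes. So r z equals
  \<open>z\<close> after \<open>h\<close>, a coboundary; thus elements killing \<open>N\<close> kill
  Ext.\<close>

lemma annihilator_Z_B:
  assumes M: "module R M" and r: "r \<in> carrier R" "\<And>y. y \<in> carrier N \<Longrightarrow> r \<odot>\<^bsub>N\<^esub> y = \<zero>\<^bsub>N\<^esub>"
    and z: "z \<in> Z i M"
  shows "r \<odot>\<^bsub>C i M\<^esub> z \<in> B i M"
proof -
  interpret M: module R M by fact
  interpret Fi: module R "F i" by (rule F)
  interpret Ci: module R "C i M" by (rule C[OF M])
  obtain h where h: "h \<in> mod_hom R (F i) (F i)"
    "\<And>x. x \<in> carrier (F i) \<Longrightarrow> r \<odot>\<^bsub>F i\<^esub> x \<ominus>\<^bsub>F i\<^esub> h x \<in> d i ` carrier (F (Suc i))"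
    "\<And>z. z \<in> carrier (C i M) \<Longrightarrow> (\<lambda>x\<in>carrier (F i). z (h x)) \<in> B i M"
    using annihilator_homotopy[OF M r, of i] by blast
  have zC: "z \<in> carrier (C i M)" using z by (simp add: Z_iff)
  have "r \<odot>\<^bsub>C i M\<^esub> z = (\<lambda>x\<in>carrier (F i). z (h x))"
  proof (rule C_eqI[of _ i M])
    show "(\<lambda>x\<in>carrier (F i). z (h x)) \<in> carrier (C i M)"
      by (rule restrict_mod_hom[OF F mod_hom_compose[OF h(1) CD(2)[OF zC]]])
    fix x assume x: "x \<in> carrier (F i)"
    have hx: "h x \<in> carrier (F i)" using mod_homD(1)[OF h(1) x] .
    obtain y where y: "y \<in> carrier (F (Suc i))" "r \<odot>\<^bsub>F i\<^esub> x \<ominus>\<^bsub>F i\<^esub> h x = d i y" using h(2)[OF x] by blast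
    have "z (r \<odot>\<^bsub>F i\<^esub> x \<ominus>\<^bsub>F i\<^esub> h x) = \<zero>\<^bsub>M\<^esub>" using Z_apply[OF z y(1)] y(2) by simp
    then have "r \<odot>\<^bsub>M\<^esub> z x \<ominus>\<^bsub>M\<^esub> z (h x) = \<zero>\<^bsub>M\<^esub>"
      using mod_hom_minus[OF F M CD(2)[OF zC], of "r \<odot>\<^bsub>F i\<^esub> x" "h x"] mod_homD(3)[OF CD(2)[OF zC] r(1) x] x hx r(1)
      by simp
    then have "r \<odot>\<^bsub>M\<^esub> z x = z (h x)"
      using M.minus_add_cancel[of "r \<odot>\<^bsub>M\<^esub> z x" "z (h x)"] CD(1)[OF zC] x hx r(1) by simp
    then show "(r \<odot>\<^bsub>C i M\<^esub> z) x = (\<lambda>x\<in>carrier (F i). z (h x)) x" using x by (simp add: hom_module_simps)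
  qed (use zC r(1) in simp)
  then show ?thesis using h(3)[OF zC] by simp
qed

end

section \<open>Exact sequences\<close>

context resolved_module
begin

text \<open>The cochain map induced by \<open>g\<close>. The restriction to F i keeps the result
  extensional, as membership in \<open>C i\<close> demands.\<close>

definition push :: "nat \<Rightarrow> ('m \<Rightarrow> 'k) \<Rightarrow> ((nat \<Rightarrow> 'a) \<Rightarrow> 'm) \<Rightarrow> ((nat \<Rightarrow> 'a) \<Rightarrow> 'k)" where
  "push i g z = (\<lambda>x\<in>carrier (F i). g (z x))"

lemma push_apply: "x \<in> carrier (F i) \<Longrightarrow> push i g z x = g (z x)"
  by (simp add: push_def)

context
  fixes L :: "('a, 'm, 'y) module_scheme" and M :: "('a, 'k, 'w) module_scheme" and g
  assumes L: "module R L" and M: "module R M" and g: "g \<in> mod_hom R L M"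
begin

lemma push_closed: "z \<in> carrier (C i L) \<Longrightarrow> push i g z \<in> carrier (C i M)"
  unfolding push_def by (rule restrict_mod_hom[OF F mod_hom_compose[OF CD(2) g]])

lemma push_hom: "push i g \<in> mod_hom R (C i L) (C i M)"
proof -
  interpret CL: module R "C i L" by (rule C[OF L])
  interpret CM: module R "C i M" by (rule C[OF M])
  show ?thesis
  proof (rule mod_homI)
    fix z w assume "z \<in> carrier (C i L)" "w \<in> carrier (C i L)"
    then show "push i g (z \<oplus>\<^bsub>C i L\<^esub> w) = push i g z \<oplus>\<^bsub>C i M\<^esub> push i g w"
      by (intro C_eqI[of _ i M])
        (simp_all add: push_closed push_apply hom_module_simps mod_homD(2)[OF g] CD(1))
  next
    fix r z assume "r \<in> carrier R" "z \<in> carrier (C i L)"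
    then show "push i g (r \<odot>\<^bsub>C i L\<^esub> z) = r \<odot>\<^bsub>C i M\<^esub> push i g z"
      by (intro C_eqI[of _ i M])
        (simp_all add: push_closed push_apply hom_module_simps mod_homD(3)[OF g] CD(1))
  qed (rule push_closed)
qed

lemma push_\<delta>: "z \<in> carrier (C i L) \<Longrightarrow> push (Suc i) g (\<delta> i z) = \<delta> i (push i g z)"
  by (rule C_eqI[of _ "Suc i" M]) (simp_all add: push_closed \<delta>_closed push_apply \<delta>_apply d_closed)

lemma push_zero: "push i g \<zero>\<^bsub>C i L\<^esub> = \<zero>\<^bsub>C i M\<^esub>"
  by (rule mod_hom_zero[OF C[OF L] C[OF M] push_hom])

lemma push_Z: "z \<in> Z i L \<Longrightarrow> push i g z \<in> Z i M"
  using push_\<delta>[of z i] push_zero[of "Suc i"] push_closed by (simp add: Z_iff)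

lemma push_B: "z \<in> B i L \<Longrightarrow> push i g z \<in> B i M"
proof (cases i)
  case 0
  then show "z \<in> B i L \<Longrightarrow> push i g z \<in> B i M" using push_zero[of 0] by simp
next
  case (Suc j)
  assume "z \<in> B i L"
  then obtain w where "w \<in> carrier (C j L)" "z = \<delta> j w" using Suc by auto
  then show ?thesis using Suc push_\<delta>[of w j] push_closed[of w j] by auto
qed

lemma push_inj:
  assumes "inj_on g (carrier L)" "z \<in> carrier (C i L)" "push i g z = \<zero>\<^bsub>C i M\<^esub>"
  shows "z = \<zero>\<^bsub>C i L\<^esub>"
proof -
  interpret CL: module R "C i L" by (rule C[OF L])
  interpret L: module R L by (rule L)
  show ?thesis
  proof (rule C_eqI[of _ i L])
    fix x assume x: "x \<in> carrier (F i)"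
    have "g (z x) = g \<zero>\<^bsub>L\<^esub>"
      using push_apply[OF x, of g z] assms(3) x mod_hom_zero[OF L M g] by (simp add: hom_module_simps)
    then have "z x = \<zero>\<^bsub>L\<^esub>" using inj_onD[OF assms(1)] CD(1)[OF assms(2) x] by simp
    then show "z x = \<zero>\<^bsub>C i L\<^esub> x" using x by (simp add: hom_module_simps)
  qed (use assms in simp_all)
qed

text \<open>F i is free, so a homomorphism with values in the image of \<open>g\<close> lifts along
  \<open>g\<close>.\<close>

lemma push_lift:
  assumes "z \<in> carrier (C i M)" "\<And>x. x \<in> carrier (F i) \<Longrightarrow> z x \<in> g ` carrier L"
  obtains w where "w \<in> carrier (C i L)" "push i g w = z"
proof -
  obtain w where w: "w \<in> mod_hom R (F i) L" "\<And>x. x \<in> carrier (F i) \<Longrightarrow> g (w x) = z x"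
    by (rule free_module_lift[OF N.R.is_cring L M CD(2)[OF assms(1)] g]) (use assms(2) in blast)+
  have wc: "restrict w (carrier (F i)) \<in> carrier (C i L)" by (rule restrict_mod_hom[OF F w(1)])
  have "push i g (restrict w (carrier (F i))) = z"
    by (rule C_eqI[of _ i M]) (use wc w assms(1) push_closed in \<open>simp_all add: push_apply\<close>)
  then show ?thesis using that wc by blast
qed

text \<open>A coboundary is lifted by lifting the cochain it comes from; the lift is then again a
  coboundary.\<close>

lemma push_surj_B:
  assumes "g ` carrier L = carrier M" "z \<in> B i M"
  obtains w where "w \<in> B i L" "push i g w = z"
proof (cases i)
  case 0
  then show ?thesis using that[of "\<zero>\<^bsub>C 0 L\<^esub>"] push_zero[of 0] assms(2) by simp
next
  case (Suc j)
  then obtain y where y: "y \<in> carrier (C j M)" "z = \<delta> j y" using assms(2) by auto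
  obtain w where w: "w \<in> carrier (C j L)" "push j g w = y"
    by (rule push_lift[OF y(1)]) (use assms(1) CD(1)[OF y(1)] in auto)
  then have "\<delta> j w \<in> B i L" "push i g (\<delta> j w) = z" using Suc y push_\<delta>[of w j] by auto
  then show ?thesis using that by blast
qed

end

context
  fixes L :: "('a, 'm, 'y) module_scheme" and M :: "('a, 'k, 'w) module_scheme"
    and P :: "('a, 'l, 'v) module_scheme" and f g
  assumes L: "module R L" and M: "module R M" and P: "module R P"
    and f: "f \<in> mod_hom R L M" "inj_on f (carrier L)"
    and g: "g \<in> mod_hom R M P" "g ` carrier M = carrier P"
    and exact: "f ` carrier L = module_ker M P g"
begin

lemma push_exact:
  assumes "z \<in> carrier (C i M)" "push i g z = \<zero>\<^bsub>C i P\<^esub>"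
  obtains w where "w \<in> carrier (C i L)" "push i f w = z"
proof (rule push_lift[OF L M f(1) assms(1)])
  fix x assume x: "x \<in> carrier (F i)"
  then have "g (z x) = \<zero>\<^bsub>P\<^esub>" using push_apply[OF x, of g z] assms(2) by (simp add: hom_module_simps)
  then show "z x \<in> f ` carrier L" unfolding exact module_ker_def using CD(1)[OF assms(1) x] by simp
qed (rule that)

lemma push_comp:
  assumes "w \<in> carrier (C i L)"
  shows "push i g (push i f w) = \<zero>\<^bsub>C i P\<^esub>"
proof -
  interpret CP: module R "C i P" by (rule C[OF P])
  have "g (f y) = \<zero>\<^bsub>P\<^esub>" if "y \<in> carrier L" for y using exact that by (auto simp: module_ker_def)
  then show ?thesis
    by (intro C_eqI[of _ i P])
      (use assms in \<open>simp_all add: push_closed[OF L M f(1)] push_closed[OF M P g(1)] push_apply hom_module_simps CD(1)\<close>)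
qed

text \<open>Exactness of Ext^i(N, L) -> Ext^i(N, M) -> Ext^i(N, P) in the middle. With
  \<open>D\<close> the cocycles whose image in \<open>P\<close> is a coboundary, Z / D embeds into
  the right-hand term and D / B is the image of the left-hand one.\<close>

lemma ext_extension:
  assumes ccL: "cc asc R (C i L) (B i L) (Z i L)" and ccP: "cc asc R (C i P) (B i P) (Z i P)"
  shows "cc asc R (C i M) (B i M) (Z i M)"
proof -
  interpret CL: module R "C i L" by (rule C[OF L])
  interpret CM: module R "C i M" by (rule C[OF M])
  interpret CP: module R "C i P" by (rule C[OF P])
  note G = push_hom[OF M P g(1), of i] and Fp = push_hom[OF L M f(1), of i]
  note ZM = Z_submodule[OF M, of i] and BM = B_submodule[OF M, of i]
  define D where "D = {z \<in> Z i M. push i g z \<in> B i P}"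
  have D: "submodule D R (C i M)"
    unfolding D_def by (rule submodule_vimage[OF C[OF M] C[OF P] G ZM B_submodule[OF P]])
  have DZ: "D \<subseteq> Z i M" by (auto simp: D_def)
  have BD: "B i M \<subseteq> D" using B_Z[OF M] push_B[OF M P g(1)] by (auto simp: D_def)
  have Zc: "z \<in> carrier (C i M)" if "z \<in> Z i M" for z using that by (simp add: Z_iff)
  have LZc: "z \<in> carrier (C i L)" if "z \<in> Z i L" for z using that by (simp add: Z_iff)
  have ZD: "cc asc R (C i M) D (Z i M)"
    by (rule cc_linear[OF C[OF P] C[OF M] B_submodule[OF P] Z_submodule[OF P] B_Z[OF P] ZM ccP,
          where \<rho> = "\<lambda>w z. w = push i g z"])
      (use push_Z[OF M P g(1)] in \<open>simp_all add: mod_homD(2,3)[OF G] Zc D_def\<close>)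
  have DB: "cc asc R (C i M) (B i M) D"
  proof (rule cc_congruent[OF C[OF L] C[OF M] Fp B_submodule[OF L] Z_submodule[OF L] B_Z[OF L] BM D ccL])
    fix z assume z: "z \<in> D"
    then have zc: "z \<in> carrier (C i M)" "z \<in> Z i M" using DZ Zc by auto
    \<comment> \<open>\<open>z\<close> is corrected by a coboundary with the same image in
      \<open>P\<close>. The difference comes from a cochain of \<open>L\<close>, which is a cocycle
      because \<open>f\<close> is injective.\<close>
    obtain w where w: "w \<in> B i M" "push i g w = push i g z"
      by (rule push_surj_B[OF M P g(1,2), of "push i g z" i]) (use z in \<open>auto simp: D_def\<close>)
    have wc: "w \<in> carrier (C i M)" "w \<in> Z i M" using w B_Z[OF M] Zc by auto
    have 0: "push i g (z \<ominus>\<^bsub>C i M\<^esub> w) = \<zero>\<^bsub>C i P\<^esub>"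
      using mod_hom_minus[OF C[OF M] C[OF P] G zc(1) wc(1)] w(2) mod_homD(1)[OF G zc(1)]
      by (simp add: a_minus_def CP.M.r_neg)
    obtain l where l: "l \<in> carrier (C i L)" "push i f l = z \<ominus>\<^bsub>C i M\<^esub> w"
      by (rule push_exact[OF CM.minus_closed[OF zc(1) wc(1)] 0])
    have "z \<ominus>\<^bsub>C i M\<^esub> w \<in> Z i M" using CM.submodule_minus[OF ZM] zc wc by blast
    then have "push (Suc i) f (\<delta> i l) = \<zero>\<^bsub>C (Suc i) M\<^esub>"
      using push_\<delta>[OF L M f(1) l(1)] l(2) by (simp add: Z_iff)
    then have "l \<in> Z i L"
      using push_inj[OF L M f(1,2) \<delta>_closed[OF l(1)]] l(1) by (simp add: Z_iff)
    moreover have "z \<ominus>\<^bsub>C i M\<^esub> push i f l = w"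
      unfolding l(2) using zc wc by (simp add: a_minus_def CM.M.minus_add CM.M.a_assoc[symmetric] CM.M.r_neg)
    ultimately show "\<exists>l\<in>Z i L. z \<ominus>\<^bsub>C i M\<^esub> push i f l \<in> B i M" using w by auto
  qed (rule push_B[OF L M f(1)])
  show ?thesis by (rule CM.cc_extension[OF D BD DZ ZM DB ZD])
qed

text \<open>Exactness of Ext^i(N, M) -> Ext^i(N, P) -> Ext^(i+1)(N, L) in the middle. With
  \<open>D\<close> the cocycles that lift to cocycles of \<open>M\<close>, D / B is a quotient of
  the left-hand term and Z / D embeds into the right-hand one.\<close>

lemma ext_quotient:
  assumes ccM: "cc asc R (C i M) (B i M) (Z i M)"
    and ccL: "cc asc R (C (Suc i) L) (B (Suc i) L) (Z (Suc i) L)"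
  shows "cc asc R (C i P) (B i P) (Z i P)"
proof -
  interpret CL: module R "C (Suc i) L" by (rule C[OF L])
  interpret CM: module R "C i M" by (rule C[OF M])
  interpret CS: module R "C (Suc i) M" by (rule C[OF M])
  interpret CP: module R "C i P" by (rule C[OF P])
  note G = push_hom[OF M P g(1), of i] and Fp = push_hom[OF L M f(1), of "Suc i"]
  note ZM = Z_submodule[OF M, of i] and ZP = Z_submodule[OF P, of i]
  define D where "D = push i g ` Z i M"
  have D: "submodule D R (C i P)"
    unfolding D_def by (rule mod_hom_image_submodule[OF C[OF M] C[OF P] G ZM])
  have DZ: "D \<subseteq> Z i P" using push_Z[OF M P g(1)] by (auto simp: D_def)
  have BD: "B i P \<subseteq> D"
  proof
    fix z assume "z \<in> B i P"
    then obtain w where "w \<in> B i M" "push i g w = z" by (rule push_surj_B[OF M P g(1,2)])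
    then show "z \<in> D" using B_Z[OF M] by (auto simp: D_def)
  qed
  have Zc: "z \<in> carrier (C i M)" if "z \<in> Z i M" for z using that by (simp add: Z_iff)
  have LZc: "z \<in> carrier (C (Suc i) L)" if "z \<in> Z (Suc i) L" for z using that by (simp add: Z_iff)
  have DB: "cc asc R (C i P) (B i P) D"
    by (rule cc_linear[OF C[OF M] C[OF P] B_submodule[OF M] ZM B_Z[OF M] D ccM,
          where \<rho> = "\<lambda>w z. z = push i g w"])
      (use push_B[OF M P g(1)] in \<open>auto simp: mod_homD(2,3)[OF G] Zc D_def\<close>)
  \<comment> \<open>The connecting homomorphism: lift \<open>z\<close> to a cochain
    \<open>w\<close>, take its coboundary, pull it back along \<open>f\<close>. As a relation it
    makes no choice of lifts.\<close>
  let ?\<rho> = "\<lambda>l z. \<exists>w\<in>carrier (C i M). push i g w = z \<and> \<delta> i w = push (Suc i) f l"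
  have ZD: "cc asc R (C i P) D (Z i P)"
  proof (rule cc_linear[OF C[OF L] C[OF P] B_submodule[OF L] Z_submodule[OF L] B_Z[OF L] ZP ccL,
        where \<rho> = ?\<rho>])
    fix l z l' z' assume *: "l \<in> Z (Suc i) L" "l' \<in> Z (Suc i) L" "?\<rho> l z" "?\<rho> l' z'"
    then obtain w w' where w: "w \<in> carrier (C i M)" "push i g w = z" "\<delta> i w = push (Suc i) f l"
      "w' \<in> carrier (C i M)" "push i g w' = z'" "\<delta> i w' = push (Suc i) f l'" by blast
    have "push i g (w \<oplus>\<^bsub>C i M\<^esub> w') = z \<oplus>\<^bsub>C i P\<^esub> z'" using w mod_homD(2)[OF G] by simp
    moreover have "\<delta> i (w \<oplus>\<^bsub>C i M\<^esub> w') = push (Suc i) f (l \<oplus>\<^bsub>C (Suc i) L\<^esub> l')"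
      using w mod_homD(2)[OF \<delta>_hom[OF M]] mod_homD(2)[OF Fp] LZc * by simp
    ultimately show "?\<rho> (l \<oplus>\<^bsub>C (Suc i) L\<^esub> l') (z \<oplus>\<^bsub>C i P\<^esub> z')" using w by blast
  next
    fix r l z assume *: "r \<in> carrier R" "l \<in> Z (Suc i) L" "?\<rho> l z"
    then obtain w where w: "w \<in> carrier (C i M)" "push i g w = z" "\<delta> i w = push (Suc i) f l" by blast
    have "push i g (r \<odot>\<^bsub>C i M\<^esub> w) = r \<odot>\<^bsub>C i P\<^esub> z" using w *(1) mod_homD(3)[OF G] by simp
    moreover have "\<delta> i (r \<odot>\<^bsub>C i M\<^esub> w) = push (Suc i) f (r \<odot>\<^bsub>C (Suc i) L\<^esub> l)"
      using w mod_homD(3)[OF \<delta>_hom[OF M]] mod_homD(3)[OF Fp] LZc * by simp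
    ultimately show "?\<rho> (r \<odot>\<^bsub>C (Suc i) L\<^esub> l) (r \<odot>\<^bsub>C i P\<^esub> z)" using w *(1) CM.smult_closed by blast
  next
    fix z assume z: "z \<in> Z i P"
    then have zc: "z \<in> carrier (C i P)" by (simp add: Z_iff)
    \<comment> \<open>The coboundary of the lift \<open>w\<close> dies in \<open>P\<close> because
      \<open>z\<close> is a cocycle, so it comes from some \<open>l\<close>; injectivity of
      \<open>f\<close> on cochains makes \<open>l\<close> a cocycle.\<close>
    obtain w where w: "w \<in> carrier (C i M)" "push i g w = z"
      by (rule push_lift[OF M P g(1) zc]) (use g(2) CD(1)[OF zc] in auto)
    have "push (Suc i) g (\<delta> i w) = \<zero>\<^bsub>C (Suc i) P\<^esub>"
      using push_\<delta>[OF M P g(1) w(1)] w(2) z by (simp add: Z_iff)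
    then obtain l where l: "l \<in> carrier (C (Suc i) L)" "push (Suc i) f l = \<delta> i w"
      by (rule push_exact[OF \<delta>_closed[OF w(1)]])
    have "push (Suc (Suc i)) f (\<delta> (Suc i) l) = \<zero>\<^bsub>C (Suc (Suc i)) M\<^esub>"
      using push_\<delta>[OF L M f(1) l(1)] l(2) \<delta>_\<delta>[OF M w(1)] by simp
    then have "l \<in> Z (Suc i) L"
      using push_inj[OF L M f(1,2) \<delta>_closed[OF l(1)]] l(1) by (simp add: Z_iff)
    then show "\<exists>l\<in>Z (Suc i) L. ?\<rho> l z" using w l by (intro bexI[of _ l] bexI[of _ w]) simp_all
  next
    fix l z assume "l \<in> B (Suc i) L" "?\<rho> l z"
    then obtain w l' where w: "w \<in> carrier (C i M)" "push i g w = z" "\<delta> i w = push (Suc i) f (\<delta> i l')"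
      "l' \<in> carrier (C i L)" by auto
    \<comment> \<open>If the value in \<open>L\<close> is the coboundary of l', subtracting the
      image of l' turns \<open>w\<close> into a cocycle over the same \<open>z\<close>.\<close>
    let ?u = "push i f l'"
    have u: "?u \<in> carrier (C i M)" using push_closed[OF L M f(1) w(4)] .
    have "\<delta> i (w \<ominus>\<^bsub>C i M\<^esub> ?u) = \<zero>\<^bsub>C (Suc i) M\<^esub>"
      using mod_hom_minus[OF C[OF M] C[OF M] \<delta>_hom[OF M] w(1) u] w(3) push_\<delta>[OF L M f(1) w(4)]
        \<delta>_closed[OF u] by (simp add: a_minus_def CS.M.r_neg)
    then have "w \<ominus>\<^bsub>C i M\<^esub> ?u \<in> Z i M" using w u by (simp add: Z_iff)
    moreover have "push i g (w \<ominus>\<^bsub>C i M\<^esub> ?u) = z"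
      using mod_hom_minus[OF C[OF M] C[OF P] G w(1) u] push_comp[OF w(4)] w(2) mod_homD(1)[OF G w(1)]
      by (simp add: a_minus_def CP.minus_zero)
    ultimately show "z \<in> D" unfolding D_def by blast
  qed
  show ?thesis by (rule CP.cc_extension[OF D BD DZ ZP DB ZD])
qed

end

end

section \<open>Cofinite modules\<close>

lemma Ann_mono_inj:
  assumes "module R L" "module R M" "f \<in> mod_hom R L M" "inj_on f (carrier L)"
  shows "Ann R M \<subseteq> Ann R L"
proof
  interpret L: module R L by fact
  interpret M: module R M by fact
  fix r assume r: "r \<in> Ann R M"
  then have rc: "r \<in> carrier R" by (simp add: Ann_def)
  have "r \<odot>\<^bsub>L\<^esub> x = \<zero>\<^bsub>L\<^esub>" if x: "x \<in> carrier L" for x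
  proof -
    have "f (r \<odot>\<^bsub>L\<^esub> x) = f \<zero>\<^bsub>L\<^esub>"
      using r mod_homD(1,3)[OF assms(3)] x rc mod_hom_zero[OF assms(1-3)] by (simp add: Ann_def)
    then show ?thesis using inj_onD[OF assms(4)] x rc by simp
  qed
  then show "r \<in> Ann R L" using rc by (simp add: Ann_def)
qed

lemma Ann_mono_surj:
  assumes "module R M" "module R P" "g \<in> mod_hom R M P" "g ` carrier M = carrier P"
  shows "Ann R M \<subseteq> Ann R P"
proof
  interpret M: module R M by fact
  fix r assume r: "r \<in> Ann R M"
  then have rc: "r \<in> carrier R" by (simp add: Ann_def)
  have "r \<odot>\<^bsub>P\<^esub> y = \<zero>\<^bsub>P\<^esub>" if y: "y \<in> carrier P" for y
  proof -
    obtain x where x: "x \<in> carrier M" "y = g x" using y assms(4) by auto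
    then have "r \<odot>\<^bsub>P\<^esub> y = g (r \<odot>\<^bsub>M\<^esub> x)" using mod_homD(3)[OF assms(3) rc] by simp
    then show ?thesis using r x mod_hom_zero[OF assms(1-3)] by (simp add: Ann_def)
  qed
  then show "r \<in> Ann R P" using rc by (simp add: Ann_def)
qed

lemma Supp_mono_inj:
  assumes "module R L" "module R M" "f \<in> mod_hom R L M" "inj_on f (carrier L)"
  shows "Supp R L \<subseteq> Supp R M"
proof
  interpret L: module R L by fact
  interpret M: module R M by fact
  fix p assume "p \<in> Supp R L"
  then obtain m where m: "primeideal p R" "m \<in> carrier L"
    "\<And>s. s \<in> carrier R - p \<Longrightarrow> s \<odot>\<^bsub>L\<^esub> m \<noteq> \<zero>\<^bsub>L\<^esub>" unfolding L.Supp_iff by blast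
  have "s \<odot>\<^bsub>M\<^esub> f m \<noteq> \<zero>\<^bsub>M\<^esub>" if s: "s \<in> carrier R - p" for s
  proof
    assume "s \<odot>\<^bsub>M\<^esub> f m = \<zero>\<^bsub>M\<^esub>"
    then have "f (s \<odot>\<^bsub>L\<^esub> m) = f \<zero>\<^bsub>L\<^esub>"
      using mod_homD(3)[OF assms(3)] s m(2) mod_hom_zero[OF assms(1-3)] by simp
    then have "s \<odot>\<^bsub>L\<^esub> m = \<zero>\<^bsub>L\<^esub>" using inj_onD[OF assms(4)] s m(2) by simp
    then show False using m(3)[OF s] by simp
  qed
  then show "p \<in> Supp R M" unfolding M.Supp_iff using m mod_homD(1)[OF assms(3)] by blast
qed

lemma Supp_mono_surj:
  assumes "module R M" "module R P" "g \<in> mod_hom R M P" "g ` carrier M = carrier P"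
  shows "Supp R P \<subseteq> Supp R M"
proof
  interpret M: module R M by fact
  interpret P: module R P by fact
  fix p assume "p \<in> Supp R P"
  then obtain y where y: "primeideal p R" "y \<in> carrier P"
    "\<And>s. s \<in> carrier R - p \<Longrightarrow> s \<odot>\<^bsub>P\<^esub> y \<noteq> \<zero>\<^bsub>P\<^esub>" unfolding P.Supp_iff by blast
  obtain x where x: "x \<in> carrier M" "y = g x" using y(2) assms(4) by auto
  have "s \<odot>\<^bsub>M\<^esub> x \<noteq> \<zero>\<^bsub>M\<^esub>" if s: "s \<in> carrier R - p" for s
    using y(3)[OF s] mod_homD(3)[OF assms(3), of s x] s x mod_hom_zero[OF assms(1-3)] by auto
  then show "p \<in> Supp R M" unfolding M.Supp_iff using y(1) x(1) by blast
qed

lemma short_primes_mono: "short_primes R I \<Longrightarrow> I \<subseteq> J \<Longrightarrow> short_primes R J"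
  unfolding short_primes_def by (meson order_trans)

lemma (in module) annihilated_off_Supp:
  assumes "primeideal p R" "p \<notin> Supp R M" "m \<in> carrier M"
  obtains s where "s \<in> carrier R - p" "s \<odot>\<^bsub>M\<^esub> m = \<zero>\<^bsub>M\<^esub>"
proof -
  have "\<not> (\<forall>s\<in>carrier R - p. s \<odot>\<^bsub>M\<^esub> m \<noteq> \<zero>\<^bsub>M\<^esub>)"
    using assms by (simp add: Supp_iff)
  then show ?thesis using that by blast
qed

locale exact_sequence = L: module R L + M: module R M + P: module R P
  for R (structure) and L :: "('a, 'm, 'y) module_scheme" and M :: "('a, 'k, 'w) module_scheme"
    and P :: "('a, 'l, 'v) module_scheme" +
  fixes f g
  assumes f: "f \<in> mod_hom R L M" "inj_on f (carrier L)"
    and g: "g \<in> mod_hom R M P" "g ` carrier M = carrier P"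
    and exact: "f ` carrier L = module_ker M P g"
begin

text \<open>If \<open>s\<close> kills g m, then s m comes from some \<open>l\<close> of
  \<open>L\<close>; if \<open>t\<close> kills \<open>l\<close>, then t s kills \<open>m\<close>, and
  t s stays outside the prime.\<close>

lemma Supp_extension: "Supp R M \<subseteq> Supp R L \<union> Supp R P"
proof
  fix p assume "p \<in> Supp R M"
  then obtain m where m: "primeideal p R" "m \<in> carrier M"
    "\<And>s. s \<in> carrier R - p \<Longrightarrow> s \<odot>\<^bsub>M\<^esub> m \<noteq> \<zero>\<^bsub>M\<^esub>" unfolding M.Supp_iff by blast
  interpret p: primeideal p R by (rule m(1))
  show "p \<in> Supp R L \<union> Supp R P"
  proof (rule ccontr)
    assume "p \<notin> Supp R L \<union> Supp R P"
    then have n: "p \<notin> Supp R L" "p \<notin> Supp R P" by auto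
    have "g m \<in> carrier P" using mod_homD(1)[OF g(1) m(2)] .
    then obtain s where s: "s \<in> carrier R - p" "s \<odot>\<^bsub>P\<^esub> g m = \<zero>\<^bsub>P\<^esub>"
      by (rule P.annihilated_off_Supp[OF m(1) n(2)])
    then have "s \<odot>\<^bsub>M\<^esub> m \<in> module_ker M P g"
      using mod_homD(3)[OF g(1)] m(2) by (simp add: module_ker_def)
    then obtain l where l: "l \<in> carrier L" "s \<odot>\<^bsub>M\<^esub> m = f l" using exact by blast
    obtain t where t: "t \<in> carrier R - p" "t \<odot>\<^bsub>L\<^esub> l = \<zero>\<^bsub>L\<^esub>"
      by (rule L.annihilated_off_Supp[OF m(1) n(1) l(1)])
    have "(t \<otimes> s) \<odot>\<^bsub>M\<^esub> m = f (t \<odot>\<^bsub>L\<^esub> l)"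
      using mod_homD(3)[OF f(1), of t l] l t s m(2) by (simp add: M.smult_assoc1)
    also have "\<dots> = \<zero>\<^bsub>M\<^esub>"
      using t mod_hom_zero[OF L.module_axioms M.module_axioms f(1)] by simp
    finally show False using m(3)[of "t \<otimes> s"] s t p.I_prime[of t s] by auto
  qed
qed

text \<open>The product of Ann L and Ann P kills \<open>M\<close>: the second factor carries
  \<open>M\<close> into the image of \<open>L\<close>, where the first acts as zero.\<close>

lemma Ann_extension:
  assumes "primeideal p R" "Ann R M \<subseteq> p"
  shows "Ann R L \<subseteq> p \<or> Ann R P \<subseteq> p"
proof (rule ccontr)
  interpret p: primeideal p R by fact
  assume "\<not> ?thesis"
  then obtain u v where uv: "u \<in> Ann R L" "u \<notin> p" "v \<in> Ann R P" "v \<notin> p" by blast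
  then have c: "u \<in> carrier R" "v \<in> carrier R" by (auto simp: Ann_def)
  have "(u \<otimes> v) \<odot>\<^bsub>M\<^esub> m = \<zero>\<^bsub>M\<^esub>" if m: "m \<in> carrier M" for m
  proof -
    have "v \<odot>\<^bsub>M\<^esub> m \<in> module_ker M P g"
      using mod_homD(3)[OF g(1) c(2) m] mod_homD(1)[OF g(1) m] uv(3) m c
      by (simp add: module_ker_def Ann_def)
    then obtain l where l: "l \<in> carrier L" "v \<odot>\<^bsub>M\<^esub> m = f l" using exact by blast
    have "(u \<otimes> v) \<odot>\<^bsub>M\<^esub> m = f (u \<odot>\<^bsub>L\<^esub> l)"
      using mod_homD(3)[OF f(1) c(1) l(1)] l c m by (simp add: M.smult_assoc1)
    then show ?thesis
      using uv(1) l mod_hom_zero[OF L.module_axioms M.module_axioms f(1)] by (simp add: Ann_def)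
  qed
  then have "u \<otimes> v \<in> Ann R M" using c by (simp add: Ann_def)
  then show False using assms(2) p.I_prime[OF c] uv by blast
qed

text \<open>The least prime of a chain over Ann M contains one of the two outer annihilators, so the
  whole chain lies over that one.\<close>

lemma short_primes_extension:
  assumes "short_primes R (Ann R L)" "short_primes R (Ann R P)"
  shows "short_primes R (Ann R M)"
  unfolding short_primes_def
proof (intro notI, elim exE conjE)
  fix p q r assume *: "primeideal p R" "primeideal q R" "primeideal r R" "Ann R M \<subseteq> p" "p \<subset> q" "q \<subset> r"
  show False using Ann_extension[OF *(1,4)] assms * unfolding short_primes_def by blast
qed

end

text \<open>\<open>N\<close> stands for R / I and is handled through its projection
  \<open>q\<close>; the module of cosets is substituted at the end.\<close>

locale resolved_quotient = resolved_module +
  fixes I and q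
  assumes noeth: "noetherian_ring R" and I: "ideal I R"
    and q: "q \<in> mod_hom R (regular_module R) N" "q ` carrier R = carrier N"
    and q_ker: "\<And>r. r \<in> carrier R \<Longrightarrow> q r = \<zero>\<^bsub>N\<^esub> \<longleftrightarrow> r \<in> I"
begin

lemma I_subset: "I \<subseteq> carrier R"
  using ideal.Icarr[OF I] by blast

lemma I_kills:
  assumes "r \<in> I" "y \<in> carrier N"
  shows "r \<odot>\<^bsub>N\<^esub> y = \<zero>\<^bsub>N\<^esub>"
proof -
  have rc: "r \<in> carrier R" using assms I_subset by blast
  obtain s where s: "s \<in> carrier R" "y = q s" using assms q by auto
  have "r \<odot>\<^bsub>N\<^esub> y = q (r \<otimes> s)"
    using mod_homD(3)[OF q(1) rc, of s] s by (simp add: regular_module_def)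
  then show ?thesis using q_ker[of "r \<otimes> s"] ideal.I_r_closed[OF I assms(1) s(1)] rc s by simp
qed

lemma tors_1:
  assumes "module R M"
  shows "module.tors R M I 1 = {m \<in> carrier M. \<forall>r\<in>I. r \<odot>\<^bsub>M\<^esub> m = \<zero>\<^bsub>M\<^esub>}"
  using module.tors_Suc[OF assms I_subset, of 0] module.tors_0[OF assms, of I] by simp

text \<open>\<open>Ext\<^sup>0(N, M) = Hom(N, M)\<close> is the \<open>I\<close>-torsion of exponent \<open>1\<close>, by evaluation at
  a lift \<open>u\<close> of the generator \<open>q \<one>\<close> of \<open>N\<close>.\<close>

lemma tors_1_cc:
  assumes M: "module R M" and cc: "cc asc R (C 0 M) (B 0 M) (Z 0 M)"
  shows "cc asc R M {\<zero>\<^bsub>M\<^esub>} (module.tors R M I 1)"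
proof -
  interpret M: module R M by (rule M)
  interpret RR: module R "regular_module R" by (rule N.R.regular_module)
  have c: "carrier (regular_module R) = carrier R" by (simp add: regular_module_def)
  \<comment> \<open>A comparison of two presentations of \<open>N\<close>: \<open>h\<close> lifts
    the augmentation \<open>e\<close> of the resolution to the ring itself.\<close>
  obtain h where h: "h \<in> mod_hom R (F 0) (regular_module R)" "\<And>x. x \<in> carrier (F 0) \<Longrightarrow> q (h x) = e x"
    by (rule free_module_lift[OF N.R.is_cring RR.module_axioms N.module_axioms e_hom q(1)])
      (use q(2) e_surj c in auto)
  have hc: "h x \<in> carrier R" if "x \<in> carrier (F 0)" for x using mod_homD(1)[OF h(1) that] c by simp
  have "q \<one> \<in> e ` carrier (F 0)" unfolding e_surj using q(2) by blast
  then obtain u where u: "u \<in> carrier (F 0)" "e u = q \<one>" by auto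
  \<comment> \<open>Both h u and \<one> lie over the generator of \<open>N\<close>, so
    \<open>t\<close> is in \<open>I\<close> and h u acts as the identity on elements killed by
    \<open>I\<close>.\<close>
  define t where "t = h u \<ominus>\<^bsub>regular_module R\<^esub> \<one>"
  have tc: "t \<in> carrier R" "h u = t \<oplus> \<one>"
    using RR.minus_closed[of "h u" \<one>] RR.minus_add_cancel[of "h u" \<one>] hc[OF u(1)] c
    by (simp_all add: t_def regular_module_def)
  have "q t = q (h u) \<ominus>\<^bsub>N\<^esub> q \<one>"
    unfolding t_def
    by (rule mod_hom_minus[OF RR.module_axioms N.module_axioms q(1)]) (use hc[OF u(1)] c in simp_all)
  also have "\<dots> = \<zero>\<^bsub>N\<^esub>"
    using h(2)[OF u(1)] u mod_homD(1)[OF q(1), of \<one>] c by (simp add: a_minus_def N.M.r_neg)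
  finally have tI: "t \<in> I" using q_ker[OF tc(1)] by simp
  have Zc: "z \<in> carrier (C 0 M)" if "z \<in> Z 0 M" for z using that by (simp add: Z_iff)
  show ?thesis
  proof (rule cc_linear[OF C[OF M] M B_submodule[OF M] Z_submodule[OF M] B_Z[OF M]
        M.tors_submodule[OF I_subset] cc, where \<rho> = "\<lambda>z y. z u = y"])
    fix y assume "y \<in> M.tors I 1"
    then have y: "y \<in> carrier M" "\<And>r. r \<in> I \<Longrightarrow> r \<odot>\<^bsub>M\<^esub> y = \<zero>\<^bsub>M\<^esub>" unfolding tors_1[OF M] by auto
    \<comment> \<open>The homomorphism taking the value \<open>y\<close> at \<open>u\<close>. It is
      a cocycle because \<open>h\<close> sends the image of d 0, the kernel of \<open>e\<close>,
      into \<open>I\<close>, which kills \<open>y\<close>.\<close>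
    have "(\<lambda>x. h x \<odot>\<^bsub>M\<^esub> y) \<in> mod_hom R (F 0) M"
      by (rule mod_homI)
        (use hc y mod_homD(2,3)[OF h(1)] in
          \<open>simp_all add: M.smult_l_distr M.smult_assoc1 regular_module_def\<close>)
    then have zc: "restrict (\<lambda>x. h x \<odot>\<^bsub>M\<^esub> y) (carrier (F 0)) \<in> carrier (C 0 M)"
      by (rule restrict_mod_hom[OF F])
    have "h (d 0 x) \<in> I" if x: "x \<in> carrier (F (Suc 0))" for x
    proof -
      have "e (d 0 x) = \<zero>\<^bsub>N\<^esub>" using d_0 x by (auto simp: module_ker_def)
      then show ?thesis using h(2)[OF d_closed[OF x]] q_ker[OF hc[OF d_closed[OF x]]] by simp
    qed
    then have "restrict (\<lambda>x. h x \<odot>\<^bsub>M\<^esub> y) (carrier (F 0)) \<in> Z 0 M"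
      by (intro Z_I[OF M zc]) (simp add: d_closed y(2))
    moreover have "h u \<odot>\<^bsub>M\<^esub> y = y" using tc tI y by (simp add: M.smult_l_distr)
    ultimately show "\<exists>z\<in>Z 0 M. z u = y"
      using u(1) by (intro bexI[of _ "restrict (\<lambda>x. h x \<odot>\<^bsub>M\<^esub> y) (carrier (F 0))"]) simp_all
  next
    fix z y assume "z \<in> B 0 M" "z u = y"
    then show "y \<in> {\<zero>\<^bsub>M\<^esub>}" using hom_module_simps(3)[OF u(1)] by auto
  qed (use u(1) in \<open>simp_all add: hom_module_simps\<close>)
qed

text \<open>With \<open>T\<close> the torsion of large exponent \<open>k\<close>, the module \<open>Hom(F i, T)\<close> is noetherian and
  \<open>Hom(F i, M / T)\<close> is artinian. The part of \<open>Ext\<close> that does not come from \<open>T\<close> is artinian and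
  killed by an ideal all of whose primes are maximal, hence it is noetherian as well.\<close>

lemma ext_acc:
  assumes M: "module R M" and tors: "\<And>m. m \<in> carrier M \<Longrightarrow> \<exists>k. m \<in> module.tors R M I k"
    and short: "short_primes R (Ann R M)"
    and cc: "cc True R M {\<zero>\<^bsub>M\<^esub>} (module.tors R M I 1)"
  shows "cc True R (C i M) (B i M) (Z i M)"
proof -
  interpret M: module R M by (rule M)
  interpret CM: module R "C i M" by (rule C[OF M])
  obtain k where max: "\<And>p. primeideal p R \<Longrightarrow> I \<subseteq> p \<Longrightarrow>
    {r \<in> carrier R. \<forall>x\<in>carrier M. r \<odot>\<^bsub>M\<^esub> x \<in> M.tors I k} \<subseteq> p \<Longrightarrow> maximalideal p R"
    by (rule M.primes_maximal[OF noeth I short]) blast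
  define T where "T = M.tors I k"
  have T: "submodule T R M" unfolding T_def by (rule M.tors_submodule[OF I_subset])
  have Tz: "{\<zero>\<^bsub>M\<^esub>} \<subseteq> T" "T \<subseteq> carrier M" using T by (auto simp: M.submodule_iff)
  have accT: "cc True R M {\<zero>\<^bsub>M\<^esub>} T" unfolding T_def by (rule M.tors_acc[OF noeth I cc])
  have dccT: "cc False R M T (carrier M)"
    unfolding T_def by (rule M.tors_quotient_dcc[OF noeth I tors cc max])
  define H where "H S = homs_into R (F i) M S" for S
  have H: "submodule (H S) R (C i M)" if "submodule S R M" for S
    unfolding H_def by (rule homs_into_submodule[OF F M that])
  have accH: "cc True R (C i M) (H {\<zero>\<^bsub>M\<^esub>}) (H T)"
    unfolding H_def by (rule cc_homs_into[OF M M.submodule_zero T Tz(1) accT])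
  have dccH: "cc False R (C i M) (H T) (H (carrier M))"
    unfolding H_def by (rule cc_homs_into[OF M T M.carrier_is_submodule Tz(2) dccT])
  have HM: "H (carrier M) = carrier (C i M)" using CD(1) by (auto simp: H_def homs_into_def)
  have H0: "z = \<zero>\<^bsub>C i M\<^esub>" if "z \<in> H {\<zero>\<^bsub>M\<^esub>}" for z
    by (rule C_eqI[of _ i M]) (use that in \<open>auto simp: H_def homs_into_def hom_module_simps\<close>)
  have HT: "H {\<zero>\<^bsub>M\<^esub>} \<subseteq> H T" "H T \<subseteq> H (carrier M)" using Tz unfolding H_def homs_into_def by blast+
  note Zs = Z_submodule[OF M, of i] and Bs = B_submodule[OF M, of i] and BZ = B_Z[OF M, of i]
  have Zc: "z \<in> carrier (C i M)" if "z \<in> Z i M" for z using that by (simp add: Z_iff)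
  \<comment> \<open>The cocycles cohomologous to one with values in \<open>T\<close>. D / B is a
    subquotient of Hom(F i, T).\<close>
  define D where "D = {z \<in> Z i M. \<exists>w\<in>B i M. z \<ominus>\<^bsub>C i M\<^esub> w \<in> H T}"
  have D: "submodule D R (C i M)" unfolding D_def by (rule CM.sum_submodule[OF Zs Bs H[OF T]])
  have DZ: "D \<subseteq> Z i M" by (auto simp: D_def)
  have HT0: "\<zero>\<^bsub>C i M\<^esub> \<in> H T" using H[OF T] by (simp add: CM.submodule_iff)
  have BD: "B i M \<subseteq> D"
  proof
    fix z assume z: "z \<in> B i M"
    then have "z \<ominus>\<^bsub>C i M\<^esub> z \<in> H T" using HT0 BZ Zc by (auto simp: a_minus_def CM.M.r_neg)
    then show "z \<in> D" using z BZ by (auto simp: D_def)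
  qed
  have HTD: "z \<in> D" if "z \<in> Z i M" "z \<in> H T" for z
  proof -
    have "z \<ominus>\<^bsub>C i M\<^esub> \<zero>\<^bsub>C i M\<^esub> \<in> H T" "\<zero>\<^bsub>C i M\<^esub> \<in> B i M"
      using that Zc Bs by (auto simp: a_minus_def CM.minus_zero CM.submodule_iff)
    then show ?thesis using that by (auto simp: D_def)
  qed
  have DB: "cc True R (C i M) (B i M) D"
  proof (rule cc_congruent[OF C[OF M] C[OF M] _ H[OF M.submodule_zero] H[OF T] HT(1) Bs D accH,
        where f = "\<lambda>c. c"])
    show "(\<lambda>c. c) \<in> mod_hom R (C i M) (C i M)" by (rule mod_homI) simp_all
  next
    fix z assume z: "z \<in> D"
    then obtain w where w: "w \<in> B i M" "z \<ominus>\<^bsub>C i M\<^esub> w \<in> H T" by (auto simp: D_def)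
    have c: "z \<in> carrier (C i M)" "w \<in> carrier (C i M)" using z w DZ BZ Zc by auto
    have "z \<ominus>\<^bsub>C i M\<^esub> (z \<ominus>\<^bsub>C i M\<^esub> w) = w"
      using c by (simp add: a_minus_def CM.M.minus_add CM.M.a_assoc[symmetric] CM.M.r_neg)
    then show "\<exists>c\<in>H T. z \<ominus>\<^bsub>C i M\<^esub> c \<in> B i M"
      using w by (intro bexI[of _ "z \<ominus>\<^bsub>C i M\<^esub> w"]) simp_all
  next
    fix c assume "c \<in> H {\<zero>\<^bsub>M\<^esub>}"
    then show "c \<in> B i M" using H0 Bs by (simp add: CM.submodule_iff)
  qed
  \<comment> \<open>Cocycles with values in \<open>T\<close> lie in \<open>D\<close>, so Z / D is a
    subquotient of Hom(F i, M) / Hom(F i, T).\<close>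
  have "cc False R (C i M) D (Z i M)"
    by (rule cc_linear[OF C[OF M] C[OF M] H[OF T] H[OF M.carrier_is_submodule] HT(2) Zs dccH,
          where \<rho> = "\<lambda>c z. c = z"])
      (use HM Zc HTD in auto)
  then have ZD: "cc True R (C i M) D (Z i M)"
  proof (rule CM.cc_swap[OF noeth CM.transporter_ideal[OF D, of "Z i M"] _ D Zs DZ, rotated -1])
    show "Z i M \<subseteq> carrier (C i M)" using Zc by blast
    let ?J = "{r \<in> carrier R. \<forall>x\<in>Z i M. r \<odot>\<^bsub>C i M\<^esub> x \<in> D}"
    fix p assume p: "primeideal p R" "?J \<subseteq> p"
    \<comment> \<open>\<open>I\<close> kills Ext, so it carries cocycles into B \<subseteq> D. An
      element carrying \<open>M\<close> into \<open>T\<close> sends each cocycle into Hom(F i, T).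
      Thus \<open>?J\<close> contains both ideals named in \<open>max\<close>.\<close>
    have "I \<subseteq> ?J"
      using annihilator_Z_B[OF M _ I_kills] I_subset BD by blast
    moreover have "{r \<in> carrier R. \<forall>x\<in>carrier M. r \<odot>\<^bsub>M\<^esub> x \<in> M.tors I k} \<subseteq> ?J"
    proof
      fix r assume r: "r \<in> {r \<in> carrier R. \<forall>x\<in>carrier M. r \<odot>\<^bsub>M\<^esub> x \<in> M.tors I k}"
      have "r \<odot>\<^bsub>C i M\<^esub> z \<in> D" if z: "z \<in> Z i M" for z
      proof (rule HTD)
        show "r \<odot>\<^bsub>C i M\<^esub> z \<in> Z i M" using z r Zs by (simp add: CM.submodule_iff)
        show "r \<odot>\<^bsub>C i M\<^esub> z \<in> H T"
          using r Zc[OF z] CD(1)[OF Zc[OF z]] CM.smult_closed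
          by (simp add: H_def homs_into_def T_def hom_module_simps)
      qed
      then show "r \<in> ?J" using r by blast
    qed
    ultimately show "maximalideal p R" using p by (intro max) blast+
  qed simp_all
  show ?thesis by (rule CM.cc_extension[OF D BD DZ Zs DB ZD])
qed

text \<open>The condition of the theorem in working form: the dimension is expressed by primes of
  \<open>R\<close>, and finite generation of Ext by the interval from coboundaries to
  cocycles.\<close>

definition cofinite_short where
  "cofinite_short M \<longleftrightarrow> Supp R M \<subseteq> zero_locus R I \<and> short_primes R (Ann R M) \<and>
    (\<forall>i. cc True R (C i M) (B i M) (Z i M))"

end

section \<open>Closure under submodules, quotients and extensions\<close>

context resolved_quotient
begin

lemma cofinite_shortD:
  assumes "cofinite_short M"
  shows "Supp R M \<subseteq> zero_locus R I" "short_primes R (Ann R M)"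
    "cc True R (C i M) (B i M) (Z i M)"
  using assms unfolding cofinite_short_def by blast+

lemma cofinite_shortI:
  assumes "Supp R M \<subseteq> zero_locus R I" "short_primes R (Ann R M)"
    "\<And>i. cc True R (C i M) (B i M) (Z i M)"
  shows "cofinite_short M"
  using assms unfolding cofinite_short_def by blast

text \<open>The exact sequence does not help, as nothing is known about Ext of the quotient M / L.
  Instead Ext^0 of \<open>M\<close> is read as T_1, the T_1 of \<open>L\<close> embeds in it, and
  \<open>ext_acc\<close> rebuilds all Ext^i of \<open>L\<close>.\<close>

lemma cofinite_short_inj:
  assumes L: "module R L" and M: "module R M" and f: "f \<in> mod_hom R L M" "inj_on f (carrier L)"
    and cof: "cofinite_short M"
  shows "cofinite_short L"
proof -
  interpret L: module R L by (rule L)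
  interpret M: module R M by (rule M)
  have S: "Supp R L \<subseteq> zero_locus R I"
    using Supp_mono_inj[OF L M f] cofinite_shortD(1)[OF cof] by (rule subset_trans)
  have short: "short_primes R (Ann R L)"
    by (rule short_primes_mono[OF cofinite_shortD(2)[OF cof] Ann_mono_inj[OF L M f]])
  have ccM: "cc True R M {\<zero>\<^bsub>M\<^esub>} (M.tors I 1)"
    by (rule tors_1_cc[OF M cofinite_shortD(3)[OF cof]])
  have cc: "cc True R L {\<zero>\<^bsub>L\<^esub>} (L.tors I 1)"
  proof (rule cc_linear[OF M L M.submodule_zero M.tors_submodule[OF I_subset] _
        L.tors_submodule[OF I_subset] ccM, where \<rho> = "\<lambda>x y. x = f y"])
    show "{\<zero>\<^bsub>M\<^esub>} \<subseteq> M.tors I 1"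
      using M.tors_submodule[OF I_subset, of 1] by (simp add: M.submodule_iff)
    fix y assume "y \<in> L.tors I 1"
    then have y: "y \<in> carrier L" "\<And>r. r \<in> I \<Longrightarrow> r \<odot>\<^bsub>L\<^esub> y = \<zero>\<^bsub>L\<^esub>"
      unfolding tors_1[OF L] by auto
    have "r \<odot>\<^bsub>M\<^esub> f y = \<zero>\<^bsub>M\<^esub>" if r: "r \<in> I" for r
      using mod_homD(3)[OF f(1) _ y(1), of r] y(2)[OF r] mod_hom_zero[OF L M f(1)] r I_subset by auto
    then show "\<exists>x\<in>M.tors I 1. x = f y"
      unfolding tors_1[OF M] using mod_homD(1)[OF f(1) y(1)] by blast
  next
    fix x y assume *: "x \<in> {\<zero>\<^bsub>M\<^esub>}" "y \<in> L.tors I 1" "x = f y"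
    then have "y \<in> carrier L" unfolding tors_1[OF L] by blast
    moreover have "f y = f \<zero>\<^bsub>L\<^esub>" using * mod_hom_zero[OF L M f(1)] by simp
    ultimately show "y \<in> {\<zero>\<^bsub>L\<^esub>}" using inj_onD[OF f(2)] by simp
  qed (simp_all add: mod_homD(2,3)[OF f(1)] tors_1[OF L] del: One_nat_def)
  have "cc True R (C i L) (B i L) (Z i L)" for i
    by (rule ext_acc[OF L L.torsion_of_Supp[OF noeth I S] short cc])
  then show ?thesis by (rule cofinite_shortI[OF S short])
qed

lemma cofinite_short_surj:
  assumes M: "module R M" and P: "module R P" and g: "g \<in> mod_hom R M P" "g ` carrier M = carrier P"
    and cof: "cofinite_short M"
  shows "cofinite_short P"
proof -
  interpret M: module R M by (rule M)
  let ?K = "M\<lparr>carrier := module_ker M P g\<rparr>"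
  have sK: "submodule (module_ker M P g) R M" by (rule M.module_ker_submodule[OF P g(1)])
  have K: "module R ?K" by (rule submodule.submodule_is_module[OF sK M])
  have f: "(\<lambda>x. x) \<in> mod_hom R ?K M" "inj_on (\<lambda>x. x) (carrier ?K)"
    by (auto intro!: mod_homI simp: module_ker_def)
  \<comment> \<open>The kernel is a submodule of \<open>M\<close>, so its Ext^(i+1), the target of
    the connecting map, is under control.\<close>
  have cofK: "cofinite_short ?K" by (rule cofinite_short_inj[OF K M f cof])
  show ?thesis
  proof (rule cofinite_shortI)
    show "Supp R P \<subseteq> zero_locus R I"
      using Supp_mono_surj[OF M P g] cofinite_shortD(1)[OF cof] by (rule subset_trans)
    show "short_primes R (Ann R P)"
      by (rule short_primes_mono[OF cofinite_shortD(2)[OF cof] Ann_mono_surj[OF M P g]])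
    show "cc True R (C i P) (B i P) (Z i P)" for i
      by (rule ext_quotient[OF K M P f g _ cofinite_shortD(3)[OF cof] cofinite_shortD(3)[OF cofK]]) simp
  qed
qed

lemma cofinite_short_extension:
  assumes E: "exact_sequence R L M P f g" and cof: "cofinite_short L" "cofinite_short P"
  shows "cofinite_short M"
proof -
  interpret E: exact_sequence R L M P f g by (rule E)
  show ?thesis
  proof (rule cofinite_shortI)
    show "Supp R M \<subseteq> zero_locus R I"
      using E.Supp_extension cof[THEN cofinite_shortD(1)] by blast
    show "short_primes R (Ann R M)"
      by (rule E.short_primes_extension[OF cof[THEN cofinite_shortD(2)]])
    show "cc True R (C i M) (B i M) (Z i M)" for i
      by (rule ext_extension[OF E.L.module_axioms E.M.module_axioms E.P.module_axioms E.f E.g E.exact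
            cof[THEN cofinite_shortD(3)]])
  qed
qed

end

text \<open>R / I is finitely generated, hence has a resolution, and the choice inside
  \<open>Ext\<close> returns a genuine one. Since that choice sees neither \<open>M\<close> nor
  \<open>i\<close>, one resolution serves for all modules of an exact sequence.\<close>

lemma resolved_quotient_exists:
  fixes R :: "('a, 'x) ring_scheme" and I :: "'a set"
  assumes "cring R" "noetherian_ring R" "ideal I R"
  defines "Q \<equiv> quotient_module (regular_module R) I"
  obtains n d e where "resolved_quotient R Q n d e I (\<lambda>r. I +>\<^bsub>regular_module R\<^esub> r)"
    "\<And>i M. Ext R i Q M = ext_of_resolution R n d i M"
proof -
  interpret R: cring R by fact
  interpret RR: module R "regular_module R" by (rule R.regular_module)
  have c: "carrier (regular_module R) = carrier R" "\<zero>\<^bsub>regular_module R\<^esub> = \<zero>\<^bsub>R\<^esub>"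
    by (simp_all add: regular_module_def)
  have I: "submodule I R (regular_module R)" using assms(3) by (simp add: R.submodule_regular)
  note q = RR.quotient_module_simps[OF I]
  interpret Q: module R Q unfolding Q_def by (rule RR.quotient_module[OF I])
  have "cc True R (regular_module R) I (carrier R)"
    by (rule cc_subinterval[OF noetherian_cc[OF assms(1,2)]])
      (use I in \<open>simp_all add: RR.submodule_iff c\<close>)
  then have fg: "finitely_generated_module R Q"
    unfolding Q.fg_iff_cc[OF assms(2)] unfolding Q_def RR.cc_quotient_iff[OF I] c .
  \<comment> \<open>The very choice made inside \<open>Ext\<close>; folding it there puts
    \<open>n\<close> and \<open>d\<close> in its place.\<close>
  define nd where "nd = (SOME (n, d). \<exists>e. free_resolution R Q n d e)"
  obtain n d where nd: "nd = (n, d)" by (cases nd)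
  have "\<exists>p. (case p of (n, d) \<Rightarrow> \<exists>e. free_resolution R Q n d e)"
    using Q.free_resolution_exists[OF assms(2) fg] by auto
  from someI_ex[OF this] have "\<exists>e. free_resolution R Q n d e"
    unfolding nd_def[symmetric] nd by simp
  then obtain e where e: "free_resolution R Q n d e" by blast
  have qh: "(\<lambda>r. I +>\<^bsub>regular_module R\<^esub> r) \<in> mod_hom R (regular_module R) Q"
    unfolding Q_def by (rule mod_homI) (simp_all add: q)
  have qk: "I +>\<^bsub>regular_module R\<^esub> r = \<zero>\<^bsub>Q\<^esub> \<longleftrightarrow> r \<in> I" if "r \<in> carrier R" for r
    unfolding Q_def q(2) using RR.coset_eq[OF I _ RR.zero_closed, of r] that
    by (simp add: c(1) a_minus_def RR.minus_zero)
  have "resolved_quotient R Q n d e I (\<lambda>r. I +>\<^bsub>regular_module R\<^esub> r)"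
  proof (intro_locales)
    show "resolved_module_axioms R Q n d e" by (rule resolved_module_axioms.intro) (rule e)
    show "resolved_quotient_axioms R Q I (\<lambda>r. I +>\<^bsub>regular_module R\<^esub> r)"
      by (rule resolved_quotient_axioms.intro)
        (use assms(2,3) qh qk q(1) c(1) in \<open>simp_all add: Q_def\<close>)
  qed
  moreover have "Ext R i Q M = ext_of_resolution R n d i M" for i M
    unfolding Ext_def nd_def[symmetric] nd by simp
  ultimately show ?thesis by (rule that)
qed

theorem proposition3p8:
  fixes R :: "('a, 'x) ring_scheme" and \<aa> :: "'a set"
  assumes "cring R" and "noetherian_ring R" and "ideal \<aa> R"
  shows "serre_subcategory R (\<lambda>M :: ('a, 'm) module. cofinite_module R \<aa> M \<and> dim_bar R M \<le> 1)"
proof -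
  obtain n d e where rq: "resolved_quotient R (quotient_module (regular_module R) \<aa>) n d e \<aa>
      (\<lambda>r. \<aa> +>\<^bsub>regular_module R\<^esub> r)"
    and ext: "\<And>i (M :: ('a, 'm) module).
      Ext R i (quotient_module (regular_module R) \<aa>) M = ext_of_resolution R n d i M"
    by (rule resolved_quotient_exists[OF assms]) blast
  interpret Q: resolved_quotient R "quotient_module (regular_module R) \<aa>" n d e \<aa>
    "\<lambda>r. \<aa> +>\<^bsub>regular_module R\<^esub> r" by (rule rq)
  have eq: "cofinite_module R \<aa> M \<and> dim_bar R M \<le> 1 \<longleftrightarrow> Q.cofinite_short M"
    if "module R M" for M :: "('a, 'm) module"
    unfolding cofinite_module_def ext Q.ext_fg_iff[OF that assms(2)] Q.cofinite_short_def
      module.dim_bar_le_1_iff[OF that] by blast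
  show ?thesis
    unfolding serre_subcategory_def
  proof (intro conjI[OF _ conjI] allI impI; elim conjE)
    fix L M :: "('a, 'm) module" and f
    assume "module R L" "module R M" "f \<in> mod_hom R L M" "inj_on f (carrier L)"
      "cofinite_module R \<aa> M" "dim_bar R M \<le> 1"
    then show "cofinite_module R \<aa> L \<and> dim_bar R L \<le> 1"
      using Q.cofinite_short_inj[of L M f] eq[of L] eq[of M] by blast
  next
    fix M N :: "('a, 'm) module" and g
    assume "module R M" "module R N" "g \<in> mod_hom R M N" "g ` carrier M = carrier N"
      "cofinite_module R \<aa> M" "dim_bar R M \<le> 1"
    then show "cofinite_module R \<aa> N \<and> dim_bar R N \<le> 1"
      using Q.cofinite_short_surj[of M N g] eq[of M] eq[of N] by blast
  next
    fix L M N :: "('a, 'm) module" and f g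
    assume *: "module R L" "module R M" "module R N" "f \<in> mod_hom R L M" "inj_on f (carrier L)"
      "g \<in> mod_hom R M N" "g ` carrier M = carrier N" "f ` carrier L = module_ker M N g"
      "cofinite_module R \<aa> L" "dim_bar R L \<le> 1" "cofinite_module R \<aa> N" "dim_bar R N \<le> 1"
    then have "exact_sequence R L M N f g"
      by (simp add: exact_sequence_def exact_sequence_axioms_def)
    then show "cofinite_module R \<aa> M \<and> dim_bar R M \<le> 1"
      using Q.cofinite_short_extension[of L M N f g] eq[of L] eq[of M] eq[of N] * by blast
  qed
qed

end
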